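(* Let $k$ be an algebraically closed field of characteristic $p=3$. Let $P$ be the extraspecial group of order $27$ and exponent $3$, let $H$ be a quaternion group of order $8$ acting on $P$ as described in the context, set $G=P\rtimes H$, and let $e$ be the non-principal block of $kG$. The algebra $kP$ is given by generators $\tilde x,\tilde y,\tilde z$ subject to the relations $$\tilde x^3=0,\quad \tilde y^3=0,\quad \tilde x\tilde y-\tilde y\tilde x=\tilde z,\quad \tilde x\tilde z-\tilde z\tilde x=\tilde z\tilde y\tilde z,\quad \tilde y\tilde z-\tilde z\tilde y=-\tilde z\tilde x\tilde z$$ (these imply $\tilde z^3=0$), while a basic algebra of $kGe$ is given by generators $\tilde{\mathsf x},\tilde{\mathsf y},\tilde{\mathsf z}$ subject to the relations $$\tilde{\mathsf x}^3=0,\quad \tilde{\mathsf y}^3=0,\quad \tilde{\mathsf x}\tilde{\mathsf y}+\tilde{\mathsf y}\tilde{\mathsf x}=\tilde{\mathsf z},\quad \tilde{\mathsf x}\tilde{\mathsf z}+\tilde{\mathsf z}\tilde{\mathsf x}=-\tilde{\mathsf z}\tilde{\mathsf y}\tilde{\mathsf z},\quad \tilde{\mathsf y}\tilde{\mathsf z}+\tilde{\mathsf z}\tilde{\mathsf y}=-\tilde{\mathsf z}\tilde{\mathsf x}\tilde{\mathsf z}$$ (these imply $\tilde{\mathsf z}^3=0$).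
   Context: $P=\langle g,h,c\mid g^3=h^3=c^3=1,\ [g,h]=c,\ [g,c]=[h,c]=1\rangle$ with $[g,h]=ghg^{-1}h^{-1}$, and $H=\langle s,t\mid s^4=1,\ s^2=t^2,\ ts=s^{-1}t\rangle\cong Q_8$, acting by $g^s=g^{-1}$, $g^t=g$, $h^s=h$, $h^t=h^{-1}$ (hence $c^s=c^t=c^{-1}$, and $Z(H)=\langle s^2\rangle$ acts trivially). The group algebra $kG$ has exactly two blocks, the principal block idempotent $\frac12(1+s^2)$ and the non-principal one $e=\frac12(1-s^2)$. Presentations are as associative unital $k$-algebras. *)

theory Defs
  imports
    "HOL-Library.Poly_Mapping"
    "HOL-Computational_Algebra.Computational_Algebra"
begin

text \<open>
  The convolution product of \<^theory>\<open>HOL-Library.Poly_Mapping\<close> makes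
  \<open>'m \<Rightarrow>\<^sub>0 'k\<close> the monoid algebra over \<open>'k\<close> of the monoid \<open>'m\<close>, which is written additively.
  The two cases used here are the group algebra \<open>'g \<Rightarrow>\<^sub>0 'k\<close> of a group
  \<open>'g :: group_add\<close> (not assumed abelian, despite the additive notation) and the free
  associative unital algebra \<open>'x list \<Rightarrow>\<^sub>0 'k\<close> on \<open>'x\<close>. The scalar \<open>l\<close> is the element
  \<open>Poly_Mapping.single 0 l\<close>, and the group element \<open>g\<close> is \<open>Poly_Mapping.single g 1\<close>.
\<close>


subsection \<open>Groups, written additively\<close>

definition is_subgroup :: "'g::group_add set \<Rightarrow> bool" where
  "is_subgroup S \<longleftrightarrow> 0 \<in> S \<and> (\<forall>a\<in>S. \<forall>b\<in>S. a + b \<in> S) \<and> (\<forall>a\<in>S. - a \<in> S)"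

text \<open>The whole group \<open>'g\<close> is the (internal) semidirect product of \<open>P\<close> by \<open>H\<close>.\<close>
definition is_semidirect_product :: "'g::group_add set \<Rightarrow> 'g set \<Rightarrow> bool" where
  "is_semidirect_product P H \<longleftrightarrow>
     is_subgroup P \<and> is_subgroup H \<and> (\<forall>a. \<forall>p\<in>P. - a + p + a \<in> P) \<and>
     P \<inter> H = {0} \<and> {p + q | p q. p \<in> P \<and> q \<in> H} = UNIV"

text \<open>
  \<open>P\<close> is presented by \<open>g, h, c\<close> with \<open>g\<^sup>3 = h\<^sup>3 = c\<^sup>3 = 1\<close>, \<open>[g,h] = c\<close>,
  \<open>[g,c] = [h,c] = 1\<close>, where \<open>[a,b] = a b a\<^sup>-\<^sup>1 b\<^sup>-\<^sup>1\<close>. As the presented group has order 27,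
  a group satisfies the presentation iff it has order 27, is generated by \<open>g, h, c\<close> and the
  relations hold. The quaternion group of order 8 is treated in the same way.
\<close>
definition is_extraspecial_27 :: "'g::group_add set \<Rightarrow> 'g \<Rightarrow> 'g \<Rightarrow> 'g \<Rightarrow> bool" where
  "is_extraspecial_27 P g h c \<longleftrightarrow>
     P = is_subgroup hull {g, h, c} \<and> card P = 27 \<and>
     g + g + g = 0 \<and> h + h + h = 0 \<and> c + c + c = 0 \<and>
     g + h - g - h = c \<and> g + c - g - c = 0 \<and> h + c - h - c = 0"

definition is_quaternion_8 :: "'g::group_add set \<Rightarrow> 'g \<Rightarrow> 'g \<Rightarrow> bool" where
  "is_quaternion_8 H s t \<longleftrightarrow>
     H = is_subgroup hull {s, t} \<and> card H = 8 \<and>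
     s + s + s + s = 0 \<and> s + s = t + t \<and> t + s = - s + t"


subsection \<open>Idempotents, blocks and basic algebras\<close>

text \<open>
  Below, \<open>A\<close> is a subset of a ring which is closed under the ring operations and has an identity
  element of its own, not necessarily the \<open>1\<close> of the surrounding ring.
\<close>

definition primitive_idempotent :: "'r::ring_1 set \<Rightarrow> 'r \<Rightarrow> bool" where
  "primitive_idempotent A i \<longleftrightarrow>
     i \<in> A \<and> i * i = i \<and> i \<noteq> 0 \<and>
     (\<forall>a\<in>A. \<forall>b\<in>A. a * a = a \<and> b * b = b \<and> a * b = 0 \<and> b * a = 0 \<and> i = a + b
        \<longrightarrow> a = 0 \<or> b = 0)"

definition ring_center :: "'r::ring_1 set" where
  "ring_center = {z. \<forall>a. z * a = a * z}"

definition is_block :: "('g::group_add \<Rightarrow>\<^sub>0 'k::field) \<Rightarrow> bool" where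
  "is_block e \<longleftrightarrow> primitive_idempotent ring_center e"

text \<open>
  An element of the group algebra acts on the trivial module by the sum of its coefficients; the
  principal block is the one not annihilating the trivial module.
\<close>
definition augmentation :: "('g \<Rightarrow>\<^sub>0 'k::field) \<Rightarrow> 'k" where
  "augmentation a = (\<Sum>x\<in>Poly_Mapping.keys a. Poly_Mapping.lookup a x)"

definition is_principal_block :: "('g::group_add \<Rightarrow>\<^sub>0 'k::field) \<Rightarrow> bool" where
  "is_principal_block e \<longleftrightarrow> is_block e \<and> augmentation e \<noteq> 0"

definition block_algebra :: "('g::group_add \<Rightarrow>\<^sub>0 'k::field) \<Rightarrow> ('g \<Rightarrow>\<^sub>0 'k) set" where
  "block_algebra e = range (\<lambda>a. a * e)"

definition subgroup_algebra :: "'g::group_add set \<Rightarrow> ('g \<Rightarrow>\<^sub>0 'k::field) set" where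
  "subgroup_algebra P = {a. Poly_Mapping.keys a \<subseteq> P}"

text \<open>The left \<open>A\<close>-modules \<open>A i\<close> and \<open>A j\<close> are isomorphic.\<close>
definition isomorphic_projectives :: "'r::ring_1 set \<Rightarrow> 'r \<Rightarrow> 'r \<Rightarrow> bool" where
  "isomorphic_projectives A i j \<longleftrightarrow>
     (\<exists>\<phi>. bij_betw \<phi> ((\<lambda>a. a * i) ` A) ((\<lambda>a. a * j) ` A) \<and>
          (\<forall>x\<in>(\<lambda>a. a * i) ` A. \<forall>y\<in>(\<lambda>a. a * i) ` A. \<phi> (x + y) = \<phi> x + \<phi> y) \<and>
          (\<forall>a\<in>A. \<forall>x\<in>(\<lambda>a. a * i) ` A. \<phi> (a * x) = a * \<phi> x))"

text \<open>
  Let \<open>A\<close> be a finite-dimensional algebra with identity element \<open>u\<close>. Decompose \<open>u\<close> into pairwise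
  orthogonal primitive idempotents and let \<open>f\<close> be the sum of a choice \<open>J\<close> of them such that every
  indecomposable projective module is isomorphic to \<open>A j\<close> for exactly one \<open>j \<in> J\<close>. Then \<open>f A f\<close> is
  a basic algebra of \<open>A\<close>.
\<close>
definition is_basic_idempotent :: "'r::ring_1 set \<Rightarrow> 'r \<Rightarrow> 'r \<Rightarrow> bool" where
  "is_basic_idempotent A u f \<longleftrightarrow>
     (\<exists>I J. finite I \<and> J \<subseteq> I \<and>
        (\<forall>i\<in>I. primitive_idempotent A i) \<and>
        (\<forall>i\<in>I. \<forall>j\<in>I. i \<noteq> j \<longrightarrow> i * j = 0) \<and>
        \<Sum>I = u \<and>
        (\<forall>i\<in>J. \<forall>j\<in>J. isomorphic_projectives A i j \<longrightarrow> i = j) \<and>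
        (\<forall>i\<in>I. \<exists>j\<in>J. isomorphic_projectives A i j) \<and>
        f = \<Sum>J)"

definition corner :: "'r::ring_1 \<Rightarrow> 'r set \<Rightarrow> 'r set" where
  "corner f A = (\<lambda>a. f * a * f) ` A"


subsection \<open>Presentations of algebras\<close>

text \<open>Lists under concatenation are the free monoid.\<close>
instantiation list :: (type) monoid_add
begin

definition zero_list :: "'a list" where
  "zero_list = []"

definition plus_list :: "'a list \<Rightarrow> 'a list \<Rightarrow> 'a list" where
  "plus_list xs ys = xs @ ys"

instance
  by standard (simp_all add: zero_list_def plus_list_def)

end

definition free_gen :: "'x \<Rightarrow> ('x list \<Rightarrow>\<^sub>0 'k::field)" where
  "free_gen x = Poly_Mapping.single [x] 1"

definition two_sided_ideal :: "'r::ring_1 set \<Rightarrow> bool" where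
  "two_sided_ideal I \<longleftrightarrow>
     0 \<in> I \<and> (\<forall>a\<in>I. \<forall>b\<in>I. a + b \<in> I) \<and> (\<forall>a\<in>I. \<forall>r. r * a \<in> I \<and> a * r \<in> I)"

text \<open>A relation \<open>l = r\<close> is given as the pair \<open>(l, r)\<close>.\<close>
definition relation_ideal :: "('r::ring_1 \<times> 'r) set \<Rightarrow> 'r set" where
  "relation_ideal R = two_sided_ideal hull {l - r | l r. (l, r) \<in> R}"

text \<open>
  The subalgebra \<open>A\<close> (with identity element \<open>u\<close>) of a monoid algebra is given by the generators
  \<open>'x\<close> subject to the relations \<open>R\<close>: it is the image of a homomorphism of unital \<open>'k\<close>-algebras
  from the free algebra whose kernel is the two-sided ideal generated by the relations.
\<close>
definition has_presentation ::
    "('m::monoid_add \<Rightarrow>\<^sub>0 'k::field) set \<Rightarrow> ('m \<Rightarrow>\<^sub>0 'k) \<Rightarrow>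
     (('x list \<Rightarrow>\<^sub>0 'k) \<times> ('x list \<Rightarrow>\<^sub>0 'k)) set \<Rightarrow> bool" where
  "has_presentation A u R \<longleftrightarrow>
     (\<exists>\<phi> :: ('x list \<Rightarrow>\<^sub>0 'k) \<Rightarrow> ('m \<Rightarrow>\<^sub>0 'k).
        (\<forall>a b. \<phi> (a + b) = \<phi> a + \<phi> b) \<and>
        (\<forall>a b. \<phi> (a * b) = \<phi> a * \<phi> b) \<and>
        (\<forall>l a. \<phi> (Poly_Mapping.single 0 l * a) = Poly_Mapping.single 0 l * \<phi> a) \<and>
        \<phi> 1 = u \<and>
        range \<phi> = A \<and>
        {a. \<phi> a = 0} = relation_ideal R)"

datatype gen3 = Gen_x | Gen_y | Gen_z

definition relations_P :: "'r::ring_1 \<Rightarrow> 'r \<Rightarrow> 'r \<Rightarrow> ('r \<times> 'r) set" where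
  "relations_P x y z =
     {(x ^ 3, 0), (y ^ 3, 0), (x * y - y * x, z),
      (x * z - z * x, z * y * z), (y * z - z * y, - (z * x * z))}"

definition relations_block :: "'r::ring_1 \<Rightarrow> 'r \<Rightarrow> 'r \<Rightarrow> ('r \<times> 'r) set" where
  "relations_block x y z =
     {(x ^ 3, 0), (y ^ 3, 0), (x * y + y * x, z),
      (x * z + z * x, - (z * y * z)), (y * z + z * y, - (z * x * z))}"

end

theory Submission
  imports Defs
begin

text \<open>
  Put \<open>x = g - g\<^sup>-\<^sup>1\<close>, \<open>y = h - h\<^sup>-\<^sup>1\<close> and \<open>z = x y - y x\<close> in \<open>k P\<close>. They satisfy the relations of \<open>k P\<close> on the
  nose, they generate since \<open>g = 1 - x - x\<^sup>2\<close>, and \<open>H\<close> acts on them by signs. Both presentations are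
  the cases \<open>\<epsilon> = 1\<close> and \<open>\<epsilon> = - 1\<close> of \<open>x y - \<epsilon> y x = z\<close>, \<open>x z - \<epsilon> z x = \<epsilon> z y z\<close>,
  \<open>y z - \<epsilon> z y = - z x z\<close>. There \<open>y z = z w\<close> and \<open>z y = v z\<close> for \<open>w = \<epsilon> y - x z\<close>, \<open>v = \<epsilon> y + \<epsilon> z x\<close>,
  so \<open>z\<^sup>3 = z y z y z = v z\<^sup>3 w\<close>, and iterating gives \<open>z\<^sup>3 = v\<^sup>3 z\<^sup>3 w\<^sup>3 = v\<^sup>3 z\<^sup>2 y\<^sup>3 z = 0\<close>. As \<open>z\<close> is normal, the
  27 monomials \<open>z\<^sup>l x\<^sup>i y\<^sup>j\<close> with \<open>l, i, j < 3\<close> span the presented algebra, and they are linearly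
  independent in \<open>k P\<close> because they span it and its dimension is 27.

  In \<open>k G e\<close> the images of \<open>s\<close> and \<open>t\<close> generate a quaternion algebra, which is a matrix algebra
  complementing the nilpotent kernel of \<open>k G \<rightarrow> k H\<close>, and the elements \<open>x t\<close>, \<open>y s\<close>, \<open>z s t\<close> commute with
  it and satisfy the relations for \<open>\<epsilon> = - 1\<close>. Hence all primitive idempotents of \<open>k G e\<close> are
  equivalent to one fixed idempotent \<open>F\<close> of the quaternion algebra, and \<open>F k G e F\<close> is generated by
  \<open>x t F\<close>, \<open>y s F\<close>, \<open>z s t F\<close>.
\<close>

subsection \<open>Monoid algebras as vector spaces\<close>

abbreviation scal :: "'k::field \<Rightarrow> ('m::monoid_add \<Rightarrow>\<^sub>0 'k)" where
  "scal l \<equiv> Poly_Mapping.single 0 l"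

lemma single_add_induct [case_names single add]:
  assumes "\<And>m l. Q (Poly_Mapping.single m l)" and "\<And>a b. Q a \<Longrightarrow> Q b \<Longrightarrow> Q (a + b)"
  shows "Q (a :: 'm \<Rightarrow>\<^sub>0 'k::comm_monoid_add)"
proof (induction a rule: update_induct)
  case const
  then show ?case using assms(1)[of undefined 0] by simp
next
  case (update a m l)
  have "Poly_Mapping.update m l a = a + Poly_Mapping.single m l"
    by (rule poly_mapping_eqI)
      (use update in \<open>auto simp: lookup_update lookup_add lookup_single when_def in_keys_iff\<close>)
  then show ?case using assms update by simp
qed

lemma scal_commute: "scal l * a = a * scal l"
  by (induction a rule: single_add_induct) (simp_all add: mult_single algebra_simps)

lemma scal_mult: "scal (k * l) = scal k * scal l"
  by (simp add: mult_single)

lemma scal_minus_one [simp]: "scal (- 1) = - 1"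
  by (simp add: single_uminus)

lemma lookup_scal_mult [simp]: "Poly_Mapping.lookup (scal l * a) m = l * Poly_Mapping.lookup a m"
  by (induction a rule: single_add_induct)
    (simp_all add: mult_single algebra_simps lookup_add lookup_single when_def)

global_interpretation pm: vector_space "\<lambda>l (a :: 'm::monoid_add \<Rightarrow>\<^sub>0 'k::field). scal l * a"
proof unfold_locales
  show "scal k * (scal l * a) = scal (k * l) * a" for k l :: 'k and a :: "'m \<Rightarrow>\<^sub>0 'k"
    by (subst mult.assoc[symmetric], subst mult_single) simp
qed (simp_all add: distrib_left distrib_right single_add)

lemma span_family:
  assumes "finite S"
  shows "pm.span (f ` S) = range (\<lambda>c. \<Sum>m\<in>S. scal (c m) * f m)"
proof
  have "pm.subspace (range (\<lambda>c. \<Sum>m\<in>S. scal (c m) * f m))"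
  proof (rule pm.subspaceI)
    show "0 \<in> range (\<lambda>c. \<Sum>m\<in>S. scal (c m) * f m)"
      by (rule range_eqI[where x="\<lambda>_. 0"]) simp
  next
    fix a b assume "a \<in> range (\<lambda>c. \<Sum>m\<in>S. scal (c m) * f m)" "b \<in> range (\<lambda>c. \<Sum>m\<in>S. scal (c m) * f m)"
    then obtain c d where "a = (\<Sum>m\<in>S. scal (c m) * f m)" "b = (\<Sum>m\<in>S. scal (d m) * f m)" by auto
    then show "a + b \<in> range (\<lambda>c. \<Sum>m\<in>S. scal (c m) * f m)"
      by (intro range_eqI[where x="\<lambda>m. c m + d m"]) (simp add: single_add algebra_simps sum.distrib)
  next
    fix l a assume "a \<in> range (\<lambda>c. \<Sum>m\<in>S. scal (c m) * f m)"
    then obtain c where "a = (\<Sum>m\<in>S. scal (c m) * f m)" by auto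
    then show "scal l * a \<in> range (\<lambda>c. \<Sum>m\<in>S. scal (c m) * f m)"
      by (intro range_eqI[where x="\<lambda>m. l * c m"])
        (simp add: sum_distrib_left mult_single flip: mult.assoc)
  qed
  moreover have "f ` S \<subseteq> range (\<lambda>c. \<Sum>m\<in>S. scal (c m) * f m)"
  proof
    fix a assume "a \<in> f ` S"
    then obtain m where m: "m \<in> S" "a = f m" by auto
    have "(\<Sum>n\<in>S. scal (if n = m then 1 else 0) * f n) = (\<Sum>n\<in>S. if n = m then f n else 0)"
      by (rule sum.cong) auto
    then show "a \<in> range (\<lambda>c. \<Sum>m\<in>S. scal (c m) * f m)"
      using m assms by (intro range_eqI[where x="\<lambda>n. if n = m then 1 else 0"]) simp
  qed
  ultimately show "pm.span (f ` S) \<subseteq> range (\<lambda>c. \<Sum>m\<in>S. scal (c m) * f m)"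
    by (rule pm.span_minimal[rotated])
  show "range (\<lambda>c. \<Sum>m\<in>S. scal (c m) * f m) \<subseteq> pm.span (f ` S)"
    by (intro image_subsetI pm.span_sum pm.span_scale pm.span_base imageI)
qed

text \<open>A nontrivial relation can be solved for one member \<open>f m\<close>; the others, fewer
  than \<open>card B\<close>, would then still span the independent set \<open>B\<close>, against
  the exchange lemma. Working with an indexed family also rules out repeated values of
  \<open>f\<close>.\<close>

lemma spanning_family_independent:
  assumes S: "finite S" "card S \<le> card B" and B: "pm.independent B" "B \<subseteq> pm.span (f ` S)"
    and sum0: "(\<Sum>m\<in>S. scal (c m) * f m) = 0" and m: "m \<in> S"
  shows "c m = (0 :: 'k::field)"
proof (rule ccontr)
  assume c: "c m \<noteq> 0"
  let ?T = "f ` (S - {m})"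
  have "scal (c m) * f m = - (\<Sum>n\<in>S - {m}. scal (c n) * f n)"
    using sum0 S m by (simp add: sum.remove eq_neg_iff_add_eq_0)
  then have "scal (inverse (c m)) * (scal (c m) * f m) = scal (inverse (c m)) * - (\<Sum>n\<in>S - {m}. scal (c n) * f n)"
    by simp
  then have "f m = scal (inverse (c m)) * - (\<Sum>n\<in>S - {m}. scal (c n) * f n)"
    using c by (simp add: mult_single flip: mult.assoc)
  also have "\<dots> \<in> pm.span ?T"
    by (intro pm.span_scale pm.span_neg pm.span_sum pm.span_base) auto
  finally have "f ` S \<subseteq> pm.span ?T"
    using pm.span_superset[of ?T] by auto
  then have "B \<subseteq> pm.span ?T"
    using pm.span_minimal[OF _ pm.subspace_span] B(2) by blast
  then have "card B \<le> card ?T"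
    using pm.independent_span_bound[OF _ B(1)] S by simp
  also have "\<dots> \<le> card (S - {m})"
    using S by (simp add: card_image_le)
  also have "\<dots> < card S"
    using S m by (intro card_Diff1_less)
  finally show False
    using S by simp
qed

subsection \<open>Evaluation of noncommutative polynomials\<close>

definition lin_ext :: "('x \<Rightarrow> ('m::monoid_add \<Rightarrow>\<^sub>0 'k::field)) \<Rightarrow> ('x \<Rightarrow>\<^sub>0 'k) \<Rightarrow> ('m \<Rightarrow>\<^sub>0 'k)" where
  "lin_ext f a = (\<Sum>w\<in>Poly_Mapping.keys a. scal (Poly_Mapping.lookup a w) * f w)"

lemma lin_ext_superset:
  assumes "finite S" "Poly_Mapping.keys a \<subseteq> S"
  shows "lin_ext f a = (\<Sum>w\<in>S. scal (Poly_Mapping.lookup a w) * f w)"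
  unfolding lin_ext_def by (rule sum.mono_neutral_left) (use assms in \<open>auto simp: in_keys_iff\<close>)

lemma lin_ext_add: "lin_ext f (a + b) = lin_ext f a + lin_ext f b"
proof -
  let ?S = "Poly_Mapping.keys a \<union> Poly_Mapping.keys b"
  have "Poly_Mapping.keys (a + b) \<subseteq> ?S" by (rule keys_add)
  then show ?thesis
    by (simp add: lin_ext_superset[of ?S] lookup_add single_add algebra_simps sum.distrib)
qed

lemma lin_ext_single [simp]: "lin_ext f (Poly_Mapping.single w l) = scal l * f w"
  by (cases "l = 0") (simp_all add: lin_ext_def)

lemma lin_ext_scal:
  fixes a :: "'x::monoid_add \<Rightarrow>\<^sub>0 'k::field"
  shows "lin_ext f (scal l * a) = scal l * lin_ext f a"
proof (induction a rule: single_add_induct)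
  case (single w l')
  have "scal l * Poly_Mapping.single w l' = Poly_Mapping.single w (l * l')"
    by (simp add: mult_single)
  then show ?case by (metis lin_ext_single scal_mult mult.assoc)
qed (simp add: lin_ext_add distrib_left)

lemma lin_ext_mult:
  assumes "\<And>v w. f (v + w) = f v * f w"
  shows "lin_ext f (a * b) = lin_ext f a * lin_ext f b"
proof (induction a rule: single_add_induct)
  case (single v l)
  show ?case
  proof (induction b rule: single_add_induct)
    case (single w l')
    have "scal l * (scal l' * (f v * f w)) = scal l * (f v * (scal l' * f w))"
      by (metis mult.assoc scal_commute)
    then show ?case
      unfolding mult_single lin_ext_single assms scal_mult by (simp add: mult.assoc)
  qed (simp add: lin_ext_add distrib_left)
qed (simp add: lin_ext_add distrib_right)

text \<open>The empty word goes to \<open>u\<close> and not to 1, which allows targets with an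
  identity element of their own.\<close>

primrec eval_word :: "'r::ring_1 \<Rightarrow> ('x \<Rightarrow> 'r) \<Rightarrow> 'x list \<Rightarrow> 'r" where
  "eval_word u v [] = u"
| "eval_word u v (g # w) = v g * eval_word u v w"

lemma eval_word_append:
  assumes "u * u = u" "\<And>g. u * v g = v g"
  shows "eval_word u v (w + w') = eval_word u v w * eval_word u v w'"
proof -
  have 1: "u * eval_word u v w' = eval_word u v w'" for w'
    by (cases w') (simp_all add: assms flip: mult.assoc)
  show ?thesis by (induction w) (simp_all add: plus_list_def 1 mult.assoc)
qed

text \<open>Preservation of 1 is left out on purpose: a map onto a corner, such as
  \<open>\<lambda>a. \<Phi> a * F\<close> below, sends 1 to an idempotent.\<close>

definition is_alg_hom :: "(('n::monoid_add \<Rightarrow>\<^sub>0 'k::field) \<Rightarrow> ('m::monoid_add \<Rightarrow>\<^sub>0 'k)) \<Rightarrow> bool" where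
  "is_alg_hom \<phi> \<longleftrightarrow> (\<forall>a b. \<phi> (a + b) = \<phi> a + \<phi> b) \<and> (\<forall>a b. \<phi> (a * b) = \<phi> a * \<phi> b) \<and>
     (\<forall>l a. \<phi> (scal l * a) = scal l * \<phi> a)"

lemma alg_hom_exists:
  fixes u :: "'m::monoid_add \<Rightarrow>\<^sub>0 'k::field"
  assumes "u * u = u" "\<And>g. u * v g = v g" "\<And>g. v g * u = v g"
  obtains \<phi> where "is_alg_hom \<phi>" "\<phi> 1 = u" "\<And>g. \<phi> (free_gen g) = v g"
proof
  let ?\<phi> = "lin_ext (eval_word u v)"
  show "is_alg_hom ?\<phi>"
    unfolding is_alg_hom_def using eval_word_append[of u v] assms
    by (simp add: lin_ext_add lin_ext_mult lin_ext_scal)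
  show "?\<phi> 1 = u"
    using lin_ext_single[of "eval_word u v" 0 1] by (metis single_one mult_1 zero_list_def eval_word.simps(1))
  show "\<And>g. ?\<phi> (free_gen g) = v g"
    by (simp add: free_gen_def assms)
qed

context
  fixes \<phi> :: "('n::monoid_add \<Rightarrow>\<^sub>0 'k::field) \<Rightarrow> ('m::monoid_add \<Rightarrow>\<^sub>0 'k)"
  assumes hom: "is_alg_hom \<phi>"
begin

lemma alg_hom_add: "\<phi> (a + b) = \<phi> a + \<phi> b"
  and alg_hom_mult: "\<phi> (a * b) = \<phi> a * \<phi> b"
  and alg_hom_scal: "\<phi> (scal l * a) = scal l * \<phi> a"
  using hom unfolding is_alg_hom_def by auto

lemma alg_hom_0: "\<phi> 0 = 0"
  using alg_hom_add[of 0 0] by simp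

lemma alg_hom_minus: "\<phi> (- a) = - \<phi> a"
  using alg_hom_add[of a "- a"] by (simp add: alg_hom_0 eq_neg_iff_add_eq_0 add.commute)

lemma alg_hom_diff: "\<phi> (a - b) = \<phi> a - \<phi> b"
  using alg_hom_add[of a "- b"] by (simp add: alg_hom_minus)

lemma alg_hom_sum: "\<phi> (sum f S) = (\<Sum>m\<in>S. \<phi> (f m))"
  by (induction S rule: infinite_finite_induct) (simp_all add: alg_hom_0 alg_hom_add)

lemma two_sided_ideal_kernel: "two_sided_ideal {a. \<phi> a = 0}"
  unfolding two_sided_ideal_def by (simp add: alg_hom_0 alg_hom_add alg_hom_mult)

end

lemma free_algebra_induct [case_names const add gen]:
  fixes a :: "'x list \<Rightarrow>\<^sub>0 'k::field"
  assumes "\<And>l. Q (scal l)" "\<And>a b. Q a \<Longrightarrow> Q b \<Longrightarrow> Q (a + b)" "\<And>g a. Q a \<Longrightarrow> Q (free_gen g * a)"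
  shows "Q a"
proof (induction a rule: single_add_induct)
  case (single w l)
  show ?case
  proof (induction w)
    case Nil
    then show ?case using assms(1)[of l] by (simp add: zero_list_def)
  next
    case (Cons g w)
    have "Poly_Mapping.single (g # w) l = free_gen g * Poly_Mapping.single w l"
      by (simp add: free_gen_def mult_single plus_list_def)
    then show ?case using assms(3)[OF Cons] by simp
  qed
next
  case (add a b)
  then show ?case by (rule assms(2))
qed

subsection \<open>The common form of both presentations\<close>

lemma two_sided_ideal_relation_ideal: "two_sided_ideal (relation_ideal R)"
  unfolding relation_ideal_def hull_def two_sided_ideal_def by blast

lemma relation_idealI: "(l, r) \<in> R \<Longrightarrow> l - r \<in> relation_ideal R"
  unfolding relation_ideal_def by (rule hull_inc) blast

lemma relation_ideal_subset:
  assumes "two_sided_ideal I" "\<And>l r. (l, r) \<in> R \<Longrightarrow> l - r \<in> I"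
  shows "relation_ideal R \<subseteq> I"
  unfolding relation_ideal_def using assms by (intro hull_minimal) auto

section \<open>Congruences modulo a two-sided ideal\<close>

context
  fixes I :: "'r::ring_1 set"
  assumes ideal: "two_sided_ideal I"
begin

lemma ideal_0: "0 \<in> I"
  and ideal_add: "a \<in> I \<Longrightarrow> b \<in> I \<Longrightarrow> a + b \<in> I"
  and ideal_mult_left: "a \<in> I \<Longrightarrow> r * a \<in> I"
  and ideal_mult_right: "a \<in> I \<Longrightarrow> a * r \<in> I"
  using ideal unfolding two_sided_ideal_def by blast+

lemma ideal_minus: "a \<in> I \<Longrightarrow> - a \<in> I"
  using ideal_mult_left[of a "- 1"] by simp

lemma ideal_diff: "a \<in> I \<Longrightarrow> b \<in> I \<Longrightarrow> a - b \<in> I"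
  using ideal_add[of a "- b"] ideal_minus[of b] by simp

lemma ideal_diff_commute: "a - b \<in> I \<Longrightarrow> b - a \<in> I"
  using ideal_minus[of "a - b"] by simp

lemma ideal_trans: "a - b \<in> I \<Longrightarrow> b - c \<in> I \<Longrightarrow> a - c \<in> I"
  using ideal_add[of "a - b" "b - c"] by simp

lemma ideal_mult_cong: "a - a' \<in> I \<Longrightarrow> b - b' \<in> I \<Longrightarrow> a * b - a' * b' \<in> I"
proof -
  assume "a - a' \<in> I" "b - b' \<in> I"
  then have "(a - a') * b + a' * (b - b') \<in> I"
    by (intro ideal_add ideal_mult_left ideal_mult_right)
  then show ?thesis by (simp add: algebra_simps)
qed

lemma ideal_power_cong: "a - b \<in> I \<Longrightarrow> a ^ n - b ^ n \<in> I"
  by (induction n) (simp_all add: ideal_0 ideal_mult_cong)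

lemma ideal_cong_iff: "a - b \<in> I \<Longrightarrow> a \<in> I \<longleftrightarrow> b \<in> I"
  using ideal_add[of "a - b" b] ideal_diff[of a "a - b"] by auto

end

section \<open>The twisted relations and the nilpotency of z\<close>

lemma char3_triple:
  assumes "(3 :: 'r::ring_1) = 0"
  shows "a + a + a = (0 :: 'r)"
proof -
  have "a + a + a = (1 + 1 + 1) * a" by (simp only: distrib_right mult_1_left)
  also have "(1 + 1 + 1 :: 'r) = 3" by simp
  finally show ?thesis using assms by simp
qed

text \<open>The relations are memberships in \<open>I\<close>, that is, equations modulo
  \<open>I\<close>, so that they apply to the free algebra without passing to a quotient ring. The
  sign \<open>\<epsilon>\<close> is itself a ring element, which lets both presentations share the
  reductions.\<close>

locale twisted_relations =
  fixes I :: "'r::ring_1 set" and x y z \<epsilon> :: 'r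
  assumes ideal: "two_sided_ideal I" and char3: "(3 :: 'r) = 0" and sign: "\<epsilon> = 1 \<or> \<epsilon> = - 1"
    and x_cubed: "x ^ 3 \<in> I" and y_cubed: "y ^ 3 \<in> I"
    and xy: "x * y - \<epsilon> * (y * x) - z \<in> I"
    and xz: "x * z - \<epsilon> * (z * x) - \<epsilon> * (z * y * z) \<in> I"
    and yz: "y * z - \<epsilon> * (z * y) + z * x * z \<in> I"
begin

text \<open>
  For \<open>\<epsilon> = 1\<close> this is \<open>ad(x)\<^sup>3(y) = [x\<^sup>3, y] = 0\<close> in characteristic 3; for \<open>\<epsilon> = - 1\<close> it comes from
  \<open>x\<^sup>3 y + y x\<^sup>3 = 0\<close> in the same way.
\<close>
lemma z_cubed_cong: "z * z * z - z * y * z * y * z \<in> I"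
proof -
  define w where "w = z * y * z * y * z"
  define r3 where "r3 = x * y - \<epsilon> * (y * x) - z"
  define r4 where "r4 = x * z - \<epsilon> * (z * x) - \<epsilon> * (z * y * z)"
  define p where "p = x * x * y * x"
  define q where "q = x * y * x * x"
  have r: "r3 \<in> I" "r4 \<in> I" using xy xz by (simp_all add: r3_def r4_def)
  have x3: "x * x * x \<in> I" using x_cubed by (simp add: power3_eq_cube)
  have triple: "w + w + w = 0" "p + p + p = 0" "q + q + q = 0"
    using char3_triple[OF char3] by auto
  have mult: "a * b \<in> I" if "a \<in> I \<or> b \<in> I" for a b
    using that ideal_mult_left[OF ideal] ideal_mult_right[OF ideal] by blast
  note ideal_intros = ideal_add[OF ideal] ideal_diff[OF ideal]
  from sign show ?thesis
  proof
    assume [simp]: "\<epsilon> = 1"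
    \<comment> \<open>Modulo the relations, the commutator with \<open>x\<close> sends
      \<open>y\<close> to \<open>z\<close>, \<open>z\<close> to \<open>z * y * z\<close>, and the
      latter to \<open>z * z * z + w + w\<close>. Its third iterate on \<open>y\<close> is x^3 y - 3
      p + 3 q - y x^3. As 2 = -1, this gives the claim; the terms in \<open>r3\<close> and
      \<open>r4\<close> make the identity exact.\<close>
    have "z * z * z - w = x * x * x * y - y * (x * x * x) - (p + p + p) + (q + q + q) - (w + w + w)
      - (r4 * y * z + z * r3 * z + z * y * r4 + (x * r4 - r4 * x) + (x * x * r3 - x * r3 * x - (x * r3 * x - r3 * x * x)))"
      by (simp add: w_def p_def q_def r3_def r4_def algebra_simps)
    also have "\<dots> \<in> I" unfolding triple diff_0_right add_0_right
      by (intro ideal_intros; simp add: mult r x3)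
    finally show ?thesis by (simp add: w_def)
  next
    assume [simp]: "\<epsilon> = - 1"
    \<comment> \<open>Here the anticommutator with \<open>x\<close> sends \<open>y\<close> to
      \<open>z\<close>, \<open>z\<close> to \<open>- (z * y * z)\<close>, and the latter to
      \<open>z * z * z + w + w\<close>. Its third iterate on \<open>y\<close> is x^3 y + 3 p + 3 q +
      y x^3.\<close>
    have "z * z * z - w = x * x * x * y + y * (x * x * x) + (p + p + p) + (q + q + q) - (w + w + w)
      - (x * x * r3 + x * r3 * x + x * r3 * x + r3 * x * x) - (x * r4 + r4 * x)
      + (r4 * y * z + z * y * r4 - z * r3 * z)"
      by (simp add: w_def p_def q_def r3_def r4_def algebra_simps)
    also have "\<dots> \<in> I" unfolding triple diff_0_right add_0_right
      by (intro ideal_intros; simp add: mult r x3)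
    finally show ?thesis by (simp add: w_def)
  qed
qed

lemma z_cubed: "z ^ 3 \<in> I"
proof -
  note cong = ideal_mult_cong[OF ideal] ideal_trans[OF ideal]
  have refl: "a - a \<in> I" for a using ideal_0[OF ideal] by simp
  define w where "w = \<epsilon> * y - x * z"
  define v where "v = \<epsilon> * y + \<epsilon> * (z * x)"
  have yz_w: "y * z - z * w \<in> I" and zy_v: "z * y - v * z \<in> I"
    using sign yz ideal_minus[OF ideal yz] by (auto simp: w_def v_def algebra_simps)
  have "z * y * z * y * z - v * z * z * z * w \<in> I"
    using cong(1)[OF cong(1)[OF zy_v refl[of z]] yz_w] by (simp add: mult.assoc)
  then have step: "z * z * z - v * (z * z * z) * w \<in> I"
    using cong(2)[OF z_cubed_cong] by (simp add: mult.assoc)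
  have 1: "z * z * z - v * (v * (v * (z * z * z) * w) * w) * w \<in> I"
    by (rule cong(2)[OF step] cong(1) refl step)+
  \<comment> \<open>Passing \<open>z\<close> turns a left factor \<open>y\<close> into a factor
    \<open>w\<close> behind \<open>z\<close>. Three rounds turn y^3 z into z w^3, so z w^3 lies in
    \<open>I\<close> along with y^3.\<close>
  have ys: "y * b - z * (w * b') \<in> I" if "b - z * b' \<in> I" for b b'
    using cong(2)[OF cong(1)[OF refl[of y] that], of "z * w * b'"] cong(1)[OF yz_w refl[of b']]
    by (simp add: mult.assoc)
  have "y * (y * (y * z)) - z * (w * (w * w)) \<in> I"
    by (intro ys yz_w)
  moreover have "y * (y * (y * z)) \<in> I"
    using ideal_mult_right[OF ideal y_cubed, of z] by (simp add: power3_eq_cube mult.assoc)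
  ultimately have "z * (w * (w * w)) \<in> I"
    by (simp add: ideal_cong_iff[OF ideal])
  then have "v * v * v * z * z * (z * (w * (w * w))) \<in> I"
    by (rule ideal_mult_left[OF ideal])
  then have "v * (v * (v * (z * z * z) * w) * w) * w \<in> I"
    by (simp add: mult.assoc)
  then show ?thesis
    using ideal_cong_iff[OF ideal 1] by (simp add: power3_eq_cube)
qed

end

lemma scal_left_commute: "a * (scal l * b) = scal l * (a * b)"
  by (metis mult.assoc scal_commute)

section \<open>Spanning the presented algebra by 27 monomials\<close>

definition exponents :: "(nat \<times> nat \<times> nat) set" where
  "exponents = {..<3} \<times> {..<3} \<times> {..<3}"

definition monomial :: "'r::monoid_mult \<Rightarrow> 'r \<Rightarrow> 'r \<Rightarrow> nat \<times> nat \<times> nat \<Rightarrow> 'r" where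
  "monomial x y z = (\<lambda>(l, i, j). z ^ l * x ^ i * y ^ j)"

lemma finite_exponents: "finite exponents"
  and card_exponents: "card exponents = 27"
  by (simp_all add: exponents_def)

locale free_twisted_relations =
  twisted_relations I "free_gen Gen_x" "free_gen Gen_y" "free_gen Gen_z" \<epsilon>
  for I :: "(gen3 list \<Rightarrow>\<^sub>0 'k::field) set" and \<epsilon>
begin

abbreviation "x \<equiv> free_gen Gen_x :: gen3 list \<Rightarrow>\<^sub>0 'k"
abbreviation "y \<equiv> free_gen Gen_y :: gen3 list \<Rightarrow>\<^sub>0 'k"
abbreviation "z \<equiv> free_gen Gen_z :: gen3 list \<Rightarrow>\<^sub>0 'k"

definition low :: "(gen3 list \<Rightarrow>\<^sub>0 'k) set" where
  "low = pm.span ((\<lambda>(i, j). x ^ i * y ^ j) ` ({..<3} \<times> {..<3}))"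

text \<open>Modulo \<open>I\<close> these are the elements of \<open>low\<close> plus the right
  ideal generated by \<open>z\<close>. Once this is known to be everything, it can be applied again
  to the cofactor \<open>b\<close> of \<open>z\<close>, and this stops at z^3.\<close>

definition reducible :: "(gen3 list \<Rightarrow>\<^sub>0 'k) set" where
  "reducible = {a. \<exists>e\<in>low. \<exists>b. a - e - z * b \<in> I}"

lemma low_base: "i < 3 \<Longrightarrow> j < 3 \<Longrightarrow> x ^ i * y ^ j \<in> low"
  unfolding low_def by (rule pm.span_base) force

lemma reducible_low: "e \<in> low \<Longrightarrow> e \<in> reducible"
  unfolding reducible_def using ideal_0[OF ideal]
  by (intro CollectI bexI[of _ e] exI[of _ 0]) auto

lemma zero_in_low: "0 \<in> low"
  by (simp add: low_def pm.span_zero)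

lemma reducible_ideal: "a \<in> I \<Longrightarrow> a \<in> reducible"
  unfolding reducible_def using zero_in_low by (intro CollectI bexI[of _ 0] exI[of _ 0]) auto

lemma reducible_z: "z * b \<in> reducible"
  unfolding reducible_def using zero_in_low ideal_0[OF ideal]
  by (intro CollectI bexI[of _ 0] exI[of _ b]) auto

lemma reducible_add:
  assumes "a \<in> reducible" "a' \<in> reducible"
  shows "a + a' \<in> reducible"
proof -
  obtain e b e' b' where e: "e \<in> low" "e' \<in> low" and I: "a - e - z * b \<in> I" "a' - e' - z * b' \<in> I"
    using assms unfolding reducible_def by auto
  have "e + e' \<in> low" using e by (simp add: low_def pm.span_add)
  moreover have "a + a' - (e + e') - z * (b + b') \<in> I"
    using ideal_add[OF ideal I] by (simp add: algebra_simps)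
  ultimately show ?thesis unfolding reducible_def by blast
qed

lemma reducible_scal:
  assumes "a \<in> reducible"
  shows "scal l * a \<in> reducible"
proof -
  obtain e b where e: "e \<in> low" and I: "a - e - z * b \<in> I"
    using assms unfolding reducible_def by auto
  have "scal l * e \<in> low" using e by (simp add: low_def pm.span_scale)
  moreover have "scal l * a - scal l * e - z * (scal l * b) \<in> I"
    using ideal_mult_left[OF ideal I, of "scal l"]
    by (simp add: right_diff_distrib scal_left_commute)
  ultimately show ?thesis unfolding reducible_def by blast
qed

lemma reducible_minus: "a \<in> reducible \<Longrightarrow> - a \<in> reducible"
  using reducible_scal[of a "- 1"] by (simp add: single_uminus)

lemma reducible_sign: "a \<in> reducible \<Longrightarrow> \<epsilon> * a \<in> reducible"
  using sign reducible_minus by auto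

lemma reducible_cong: "a - b \<in> I \<Longrightarrow> b \<in> reducible \<Longrightarrow> a \<in> reducible"
  using reducible_add[OF reducible_ideal, of "a - b" b] by simp

text \<open>For a = e + z b modulo \<open>I\<close>, the product g a is g e + z d b: the first
  summand is covered by the hypothesis on the basis of \<open>low\<close>, the second is again a
  right multiple of \<open>z\<close>.\<close>

lemma reducible_mult_left:
  assumes low: "\<And>i j. i < 3 \<Longrightarrow> j < 3 \<Longrightarrow> g * (x ^ i * y ^ j) \<in> reducible"
    and z: "g * z - z * d \<in> I" and a: "a \<in> reducible"
  shows "g * a \<in> reducible"
proof -
  obtain e b where e: "e \<in> low" and I: "a - e - z * b \<in> I"
    using a unfolding reducible_def by auto
  have "pm.subspace {e. g * e \<in> reducible}"
    by (rule pm.subspaceI)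
      (auto simp: distrib_left scal_left_commute intro: reducible_add reducible_scal
        reducible_ideal ideal_0[OF ideal])
  then have "low \<subseteq> {e. g * e \<in> reducible}"
    unfolding low_def by (rule pm.span_minimal[rotated]) (use low in auto)
  then have "g * e + z * (d * b) \<in> reducible"
    using e by (blast intro: reducible_add reducible_z)
  moreover have "g * a - (g * e + z * (d * b)) \<in> I"
    using ideal_add[OF ideal ideal_mult_left[OF ideal I, of g] ideal_mult_right[OF ideal z, of b]]
    by (simp add: algebra_simps)
  ultimately show ?thesis by (rule reducible_cong[rotated])
qed

lemma reducible_x:
  assumes "a \<in> reducible"
  shows "x * a \<in> reducible"
proof (rule reducible_mult_left[OF _ _ assms])
  fix i j :: nat assume ij: "i < 3" "j < 3"
  show "x * (x ^ i * y ^ j) \<in> reducible"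
  proof (cases "i = 2")
    case True
    then have "x * (x ^ i * y ^ j) = x ^ 3 * y ^ j"
      by (simp add: numeral_eq_Suc mult.assoc)
    then show ?thesis
      using ideal_mult_right[OF ideal x_cubed] by (simp add: reducible_ideal)
  next
    case False
    then show ?thesis
      using ij low_base[of "Suc i" j] by (simp add: mult.assoc reducible_low)
  qed
next
  show "x * z - z * (\<epsilon> * x + \<epsilon> * (y * z)) \<in> I"
    using xz sign by (auto simp: algebra_simps)
qed

lemma reducible_y:
  assumes "a \<in> reducible"
  shows "y * a \<in> reducible"
proof (rule reducible_mult_left[OF _ _ assms])
  fix i j :: nat assume ij: "i < 3" "j < 3"
  show "y * (x ^ i * y ^ j) \<in> reducible"
  proof (induction i)
    case 0
    show ?case
    proof (cases "j = 2")
      case True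
      then have "y * (x ^ 0 * y ^ j) = y ^ 3"
        by (simp add: numeral_eq_Suc mult.assoc)
      then show ?thesis using y_cubed by (simp add: reducible_ideal)
    next
      case False
      then show ?thesis using ij low_base[of 0 "Suc j"] by (simp add: reducible_low)
    qed
  next
    case (Suc i)
    \<comment> \<open>Solving the relation for y x moves \<open>y\<close> past one factor
      \<open>x\<close> at the cost of a term starting with \<open>z\<close>, which is reducible. The
      leading \<open>x\<close> is absorbed by \<open>reducible_x\<close>, hence the order of the two
      lemmas.\<close>
    have "y * x - (\<epsilon> * (x * y) - \<epsilon> * z) \<in> I"
      using xy ideal_minus[OF ideal xy] sign by (auto simp: algebra_simps)
    from ideal_mult_right[OF ideal this, of "x ^ i * y ^ j"]
    have "y * (x ^ Suc i * y ^ j) -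
        (\<epsilon> * (x * (y * (x ^ i * y ^ j))) + \<epsilon> * - (z * (x ^ i * y ^ j))) \<in> I"
      by (simp add: algebra_simps)
    then show ?case
      by (rule reducible_cong)
        (intro reducible_add reducible_sign reducible_x reducible_minus reducible_z Suc)
  qed
next
  show "y * z - z * (\<epsilon> * y - x * z) \<in> I"
    using yz sign by (auto simp: algebra_simps)
qed

lemma reducible_all: "a \<in> reducible"
proof (induction a rule: free_algebra_induct)
  case (const l)
  show ?case
    using reducible_scal[OF reducible_low[OF low_base[of 0 0]], of l] by simp
next
  case (gen g a)
  then show ?case by (cases g) (simp_all add: reducible_x reducible_y reducible_z)
qed (rule reducible_add)

text \<open>Three reductions write \<open>a\<close> as e0 + z e1 + z^2 e2 + z^3 b2 modulo
  \<open>I\<close> with each coefficient in \<open>low\<close>, and the last term lies in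
  \<open>I\<close> by \<open>z_cubed\<close>.\<close>

lemma monomials_span:
  obtains c where "a - (\<Sum>m\<in>exponents. scal (c m) * monomial x y z m) \<in> I"
proof -
  have red: "\<exists>e\<in>low. \<exists>b. a - e - z * b \<in> I" for a
    using reducible_all unfolding reducible_def by blast
  obtain e0 b0 where 0: "e0 \<in> low" "a - e0 - z * b0 \<in> I" using red by blast
  obtain e1 b1 where 1: "e1 \<in> low" "b0 - e1 - z * b1 \<in> I" using red by blast
  obtain e2 b2 where 2: "e2 \<in> low" "b1 - e2 - z * b2 \<in> I" using red by blast
  have low_span: "z ^ l * e \<in> pm.span (monomial x y z ` exponents)" if "e \<in> low" "l < 3" for e l
  proof -
    have "pm.subspace {e. z ^ l * e \<in> pm.span (monomial x y z ` exponents)}"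
      by (rule pm.subspaceI)
        (auto simp: distrib_left scal_left_commute intro: pm.span_add pm.span_scale pm.span_zero)
    moreover have "z ^ l * (x ^ i * y ^ j) \<in> pm.span (monomial x y z ` exponents)"
      if "i < 3" "j < 3" for i j
      by (rule pm.span_base, rule image_eqI[of _ _ "(l, i, j)"])
        (use that \<open>l < 3\<close> in \<open>auto simp: exponents_def monomial_def mult.assoc\<close>)
    ultimately have "low \<subseteq> {e. z ^ l * e \<in> pm.span (monomial x y z ` exponents)}"
      unfolding low_def by (intro pm.span_minimal) auto
    with that show ?thesis by blast
  qed
  let ?s = "z ^ 0 * e0 + z ^ 1 * e1 + z ^ 2 * e2"
  have "?s \<in> pm.span (monomial x y z ` exponents)"
    using 0 1 2 by (intro pm.span_add low_span) auto
  then obtain c where c: "?s = (\<Sum>m\<in>exponents. scal (c m) * monomial x y z m)"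
    unfolding span_family[OF finite_exponents] by blast
  have "(a - e0 - z * b0) + z * (b0 - e1 - z * b1) + z * z * (b1 - e2 - z * b2) + z ^ 3 * b2 \<in> I"
    by (intro ideal_add[OF ideal] ideal_mult_left[OF ideal] ideal_mult_right[OF ideal] 0 1 2 z_cubed)
  then have "a - ?s \<in> I"
    by (simp add: algebra_simps power2_eq_square power3_eq_cube)
  then show ?thesis using c that by simp
qed

text \<open>Modulo \<open>I\<close> an element of the kernel is a combination of the 27 monomials,
  and independence of their images forces all its coefficients to vanish. This settles the kernel
  for both presentations.\<close>

lemma kernel_eq_ideal:
  fixes \<phi> :: "(gen3 list \<Rightarrow>\<^sub>0 'k) \<Rightarrow> ('m::monoid_add \<Rightarrow>\<^sub>0 'k)"
  assumes hom: "is_alg_hom \<phi>" and I: "I \<subseteq> {a. \<phi> a = 0}"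
    and indep: "\<And>c m. (\<Sum>m\<in>exponents. scal (c m) * \<phi> (monomial x y z m)) = 0 \<Longrightarrow>
      m \<in> exponents \<Longrightarrow> c m = 0"
  shows "{a. \<phi> a = 0} = I"
proof
  show "{a. \<phi> a = 0} \<subseteq> I"
  proof
    fix a assume "a \<in> {a. \<phi> a = 0}"
    then have a: "\<phi> a = 0" by simp
    obtain c where c: "a - (\<Sum>m\<in>exponents. scal (c m) * monomial x y z m) \<in> I"
      by (rule monomials_span)
    then have "\<phi> (a - (\<Sum>m\<in>exponents. scal (c m) * monomial x y z m)) = 0" using I by blast
    then have "(\<Sum>m\<in>exponents. scal (c m) * \<phi> (monomial x y z m)) = 0"
      using a by (simp add: alg_hom_diff[OF hom] alg_hom_sum[OF hom] alg_hom_scal[OF hom])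
    then have "\<And>m. m \<in> exponents \<Longrightarrow> c m = 0" by (rule indep)
    then show "a \<in> I" using c by simp
  qed
qed (rule I)

end

lemma free_twisted_relations_P:
  assumes "(3 :: 'k::field) = 0"
  shows "free_twisted_relations (relation_ideal
    (relations_P (free_gen Gen_x) (free_gen Gen_y) (free_gen Gen_z :: gen3 list \<Rightarrow>\<^sub>0 'k))) 1"
    (is "free_twisted_relations (relation_ideal ?R) 1")
proof unfold_locales
  have "(3 :: gen3 list \<Rightarrow>\<^sub>0 'k) = scal 3" by simp
  then show "(3 :: gen3 list \<Rightarrow>\<^sub>0 'k) = 0" unfolding assms by simp
  have rel: "l - r \<in> relation_ideal ?R" if "(l, r) \<in> ?R" for l r
    using that by (rule relation_idealI)
  let ?x = "free_gen Gen_x :: gen3 list \<Rightarrow>\<^sub>0 'k" and ?y = "free_gen Gen_y :: gen3 list \<Rightarrow>\<^sub>0 'k"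
    and ?z = "free_gen Gen_z :: gen3 list \<Rightarrow>\<^sub>0 'k"
  show "?x ^ 3 \<in> relation_ideal ?R" "?y ^ 3 \<in> relation_ideal ?R"
    using rel[of "?x ^ 3" 0] rel[of "?y ^ 3" 0] by (simp_all add: relations_P_def)
  show "?x * ?y - 1 * (?y * ?x) - ?z \<in> relation_ideal ?R"
    "?x * ?z - 1 * (?z * ?x) - 1 * (?z * ?y * ?z) \<in> relation_ideal ?R"
    "?y * ?z - 1 * (?z * ?y) + ?z * ?x * ?z \<in> relation_ideal ?R"
    using rel[of "?x * ?y - ?y * ?x" ?z] rel[of "?x * ?z - ?z * ?x" "?z * ?y * ?z"]
      rel[of "?y * ?z - ?z * ?y" "- (?z * ?x * ?z)"] by (simp_all add: relations_P_def)
qed (simp_all add: two_sided_ideal_relation_ideal)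

lemma free_twisted_relations_block:
  assumes "(3 :: 'k::field) = 0"
  shows "free_twisted_relations (relation_ideal
    (relations_block (free_gen Gen_x) (free_gen Gen_y) (free_gen Gen_z :: gen3 list \<Rightarrow>\<^sub>0 'k))) (- 1)"
    (is "free_twisted_relations (relation_ideal ?R) _")
proof unfold_locales
  have "(3 :: gen3 list \<Rightarrow>\<^sub>0 'k) = scal 3" by simp
  then show "(3 :: gen3 list \<Rightarrow>\<^sub>0 'k) = 0" unfolding assms by simp
  have rel: "l - r \<in> relation_ideal ?R" if "(l, r) \<in> ?R" for l r
    using that by (rule relation_idealI)
  let ?x = "free_gen Gen_x :: gen3 list \<Rightarrow>\<^sub>0 'k" and ?y = "free_gen Gen_y :: gen3 list \<Rightarrow>\<^sub>0 'k"
    and ?z = "free_gen Gen_z :: gen3 list \<Rightarrow>\<^sub>0 'k"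
  show "?x ^ 3 \<in> relation_ideal ?R" "?y ^ 3 \<in> relation_ideal ?R"
    using rel[of "?x ^ 3" 0] rel[of "?y ^ 3" 0] by (simp_all add: relations_block_def)
  show "?x * ?y - - 1 * (?y * ?x) - ?z \<in> relation_ideal ?R"
    "?x * ?z - - 1 * (?z * ?x) - - 1 * (?z * ?y * ?z) \<in> relation_ideal ?R"
    "?y * ?z - - 1 * (?z * ?y) + ?z * ?x * ?z \<in> relation_ideal ?R"
    using rel[of "?x * ?y + ?y * ?x" ?z] rel[of "?x * ?z + ?z * ?x" "- (?z * ?y * ?z)"]
      rel[of "?y * ?z + ?z * ?y" "- (?z * ?x * ?z)"] by (simp_all add: relations_block_def)
qed (simp_all add: two_sided_ideal_relation_ideal)

subsection \<open>The group algebra of the extraspecial group\<close>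

text \<open>The equations are oriented so that words are rewritten to the form G^i H^j C^l. The one
  for \<open>H * G\<close> is [g,h] = c with the inverse of c written as c^2, so no inverses
  occur.\<close>

locale heisenberg_ring =
  fixes G H C :: "'r::ring_1"
  assumes char3: "(3 :: 'r) = 0"
    and G3: "G * (G * G) = 1" and H3: "H * (H * H) = 1" and C3: "C * (C * C) = 1"
    and HG: "H * G = G * (H * (C * C))" and CG: "C * G = G * C" and CH: "C * H = H * C"
begin

lemma triple: "a + (a + a) = 0" "a + (a + (a + b)) = (b :: 'r)"
  using char3_triple[OF char3, of a] by (simp_all flip: add.assoc)

text \<open>Replacing - a by a + a turns every element into a sum without signs; together with
  \<open>triple\<close> this makes identities in characteristic 3 accessible to rewriting.\<close>

lemma minus_double: "- a = a + a" "a - b = a + (b + (b :: 'r))"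
proof -
  show "- a = a + a" for a :: 'r
    using triple(1)[of a] by (simp add: minus_unique)
  then show "a - b = a + (b + b)"
    by (metis add_uminus_conv_diff)
qed

lemma comm:
  "G * (G * (G * a)) = a" "H * (H * (H * a)) = a" "C * (C * (C * a)) = a"
  "H * (G * a) = G * (H * (C * (C * a)))" "C * (G * a) = G * (C * a)" "C * (H * a) = H * (C * a)"
  using G3 H3 C3 HG CG CH by (metis mult.assoc mult_1_left)+

lemmas normal_form = G3 H3 C3 HG CG CH comm mult.assoc distrib_left distrib_right minus_double
  triple add.assoc add.left_commute add.commute

definition X where "X = G - G * G"
definition Y where "Y = H - H * H"
definition Z where "Z = X * Y - Y * X"

lemma X_cubed: "X ^ 3 = 0"
  by (simp only: X_def power3_eq_cube normal_form mult_1_left mult_1_right add_0_left add_0_right)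
lemma Y_cubed: "Y ^ 3 = 0"
  by (simp only: Y_def power3_eq_cube normal_form mult_1_left mult_1_right add_0_left add_0_right)
lemma G_eq: "G = 1 - X - X * X"
  by (simp only: X_def normal_form mult_1_left mult_1_right add_0_left add_0_right)
lemma H_eq: "H = 1 - Y - Y * Y"
  by (simp only: Y_def normal_form mult_1_left mult_1_right add_0_left add_0_right)

lemma Z_eq: "Z = G * H + G * (G * (H * H)) + G * (H * (H * C)) + G * (G * (H * C))
  - G * (H * (C * C)) - G * (G * (H * (H * (C * C)))) - G * (H * H) - G * (G * H)"
  by (simp add: X_def Y_def Z_def normal_form)

lemma XZ: "X * Z - Z * X = Z * Y * Z"
  unfolding Z_eq X_def Y_def by (simp add: normal_form)
lemma YZ: "Y * Z - Z * Y = - (Z * X * Z)"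
  unfolding Z_eq X_def Y_def by (simp add: normal_form)

end

subsection \<open>The group and its group algebra\<close>

text \<open>\<open>\<sigma>\<close> decomposes \<open>A\<close> into orbits of exactly three
  elements on which \<open>F\<close> is constant, and each orbit contributes 3 F(x) = 0. The
  induction removes one orbit at a time.\<close>

lemma fixpoint_free_order3_sum:
  assumes "finite A" "(3 :: 'k::field) = 0"
    and "\<And>x. x \<in> A \<Longrightarrow> \<sigma> x \<in> A" "\<And>x. x \<in> A \<Longrightarrow> \<sigma> (\<sigma> (\<sigma> x)) = x"
    and "\<And>x. x \<in> A \<Longrightarrow> \<sigma> x \<noteq> x" "\<And>x. x \<in> A \<Longrightarrow> F (\<sigma> x) = (F x :: 'k)"
  shows "sum F A = 0"
  using assms
proof (induction A rule: finite_psubset_induct)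
  case (psubset A)
  show ?case
  proof (cases "A = {}")
    case False
    then obtain x where x: "x \<in> A" by blast
    let ?B = "{x, \<sigma> x, \<sigma> (\<sigma> x)}"
    have B: "?B \<subseteq> A" using x psubset.prems by auto
    have distinct: "x \<noteq> \<sigma> x" "\<sigma> x \<noteq> \<sigma> (\<sigma> x)" "x \<noteq> \<sigma> (\<sigma> x)"
      using x psubset.prems by metis+
    have closed: "\<sigma> y \<in> A - ?B" if "y \<in> A - ?B" for y
      using that x psubset.prems(2-4) by (metis Diff_iff insert_iff emptyE)
    have "sum F (A - ?B) = 0"
      using psubset.prems x closed by (intro psubset.IH) auto
    moreover have "sum F ?B = F x + F x + F x"
      using distinct x psubset.prems by (simp add: add.assoc)
    moreover have "sum F A = sum F (A - ?B) + sum F ?B"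
      using psubset.hyps B by (rule sum.subset_diff[rotated])
    ultimately show ?thesis
      using char3_triple[OF psubset.prems(1)] by simp
  qed simp
qed

definition ideal_extension :: "'r::ring_1 set \<Rightarrow> 'r \<Rightarrow> 'r set" where
  "ideal_extension K u = {k + u * a | k a. k \<in> K}"

text \<open>Since \<open>u\<close> is normal modulo \<open>K\<close>, factors standing to its left
  can be moved to its right. This makes K + u A a two-sided ideal and turns (u a)^3 into u^3 b' b a
  modulo \<open>K\<close>.\<close>

lemma ideal_extension:
  assumes K: "two_sided_ideal K" and normal: "\<And>a. \<exists>b. a * u - u * b \<in> K"
  shows "two_sided_ideal (ideal_extension K u)"
    and "n \<in> ideal_extension K u \<Longrightarrow> u ^ 3 \<in> K \<Longrightarrow> n ^ 3 \<in> K"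
proof -
  show "two_sided_ideal (ideal_extension K u)"
    unfolding two_sided_ideal_def
  proof (intro conjI ballI allI)
    show "0 \<in> ideal_extension K u"
      unfolding ideal_extension_def using ideal_0[OF K] by (intro CollectI exI[of _ 0]) auto
    fix n assume "n \<in> ideal_extension K u"
    then obtain k a where n: "n = k + u * a" "k \<in> K" unfolding ideal_extension_def by blast
    show "n + n' \<in> ideal_extension K u" if n': "n' \<in> ideal_extension K u" for n'
    proof -
      obtain k' a' where "n' = k' + u * a'" "k' \<in> K" using n' unfolding ideal_extension_def by blast
      then have "n + n' = (k + k') + u * (a + a')" "k + k' \<in> K"
        using n ideal_add[OF K] by (auto simp: algebra_simps)
      then show ?thesis unfolding ideal_extension_def by blast
    qed
    fix r
    have "n * r = k * r + u * (a * r)" "k * r \<in> K"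
      using n ideal_mult_right[OF K] by (auto simp: algebra_simps)
    then show "n * r \<in> ideal_extension K u" unfolding ideal_extension_def by blast
    obtain b where "r * u - u * b \<in> K" using normal by blast
    then have "r * k + (r * u - u * b) * a \<in> K"
      by (intro ideal_add[OF K] ideal_mult_left[OF K] ideal_mult_right[OF K] n)
    moreover have "r * n = (r * k + (r * u - u * b) * a) + u * (b * a)"
      using n by (simp add: algebra_simps)
    ultimately show "r * n \<in> ideal_extension K u" unfolding ideal_extension_def by blast
  qed
  assume "n \<in> ideal_extension K u" and u3: "u ^ 3 \<in> K"
  then obtain k a where n: "n = k + u * a" "k \<in> K" unfolding ideal_extension_def by blast
  obtain b where b: "a * u - u * b \<in> K" using normal by blast
  obtain b' where b': "b * u - u * b' \<in> K" using normal by blast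
  have refl: "r - r \<in> K" for r using ideal_0[OF K] by simp
  note cong = ideal_mult_cong[OF K] ideal_trans[OF K]
  have 1: "n - u * a \<in> K" using n by simp
  have "n ^ 3 - (u * a) ^ 3 \<in> K" using 1 by (rule ideal_power_cong[OF K])
  moreover have "u * (a * u) * (a * u) * a - u * (u * b) * (u * b) * a \<in> K"
    by (intro cong(1) refl b)
  moreover have "u * u * (b * u) * (b * a) - u * u * (u * b') * (b * a) \<in> K"
    by (intro cong(1) refl b')
  ultimately have "n ^ 3 - u ^ 3 * (b' * b * a) \<in> K"
    using cong(2) by (simp add: power3_eq_cube mult.assoc)
  then show "n ^ 3 \<in> K"
    using ideal_cong_iff[OF K] ideal_mult_right[OF K u3] by blast
qed

locale quaternion_action =
  fixes P H :: "'g::group_add set" and g h c s t :: 'g and K :: "'k::field itself"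
  assumes char3: "(3 :: 'k) = 0"
    and extraspecial: "is_extraspecial_27 P g h c"
    and quaternion: "is_quaternion_8 H s t"
    and semidirect: "is_semidirect_product P H"
    and act_s_g: "- s + g + s = - g" and act_t_g: "- t + g + t = g"
    and act_s_h: "- s + h + s = h" and act_t_h: "- t + h + t = - h"
begin

definition el :: "'g \<Rightarrow> ('g \<Rightarrow>\<^sub>0 'k)" where
  "el a = Poly_Mapping.single a 1"

lemma el_add: "el (a + b) = el a * el b"
  by (simp add: el_def mult_single)

lemma el_0: "el 0 = 1"
  by (simp add: el_def)

lemma el_inject: "el a = el b \<longleftrightarrow> a = b"
  unfolding el_def by (metis lookup_single_eq lookup_single_not_eq zero_neq_one)

lemma el_diff: "el (a - b) = el a * el (- b)"
  using el_add[of a "- b"] by simp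

lemma single_eq_el: "Poly_Mapping.single a l = scal l * el a"
  by (simp add: el_def mult_single)

lemma subgroup_P: "is_subgroup P" and subgroup_H: "is_subgroup H"
  and normal_P: "p \<in> P \<Longrightarrow> - a + p + a \<in> P" and PH_0: "P \<inter> H = {0}"
  and PH_UNIV: "{p + q | p q. p \<in> P \<and> q \<in> H} = UNIV"
  using semidirect unfolding is_semidirect_product_def by blast+

lemma P_add: "a \<in> P \<Longrightarrow> b \<in> P \<Longrightarrow> a + b \<in> P" and P_minus: "a \<in> P \<Longrightarrow> - a \<in> P" and P_0: "0 \<in> P"
  using subgroup_P unfolding is_subgroup_def by auto

lemma H_add: "a \<in> H \<Longrightarrow> b \<in> H \<Longrightarrow> a + b \<in> H" and H_minus: "a \<in> H \<Longrightarrow> - a \<in> H" and H_0: "0 \<in> H"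
  using subgroup_H unfolding is_subgroup_def by auto

lemma P_hull: "P = is_subgroup hull {g, h, c}" and card_P: "card P = 27"
  and order_g: "g + (g + g) = 0" and order_h: "h + (h + h) = 0" and order_c: "c + (c + c) = 0"
  and gh: "g + h = c + (h + g)" and cg: "c + g = g + c" and ch: "c + h = h + c"
  using extraspecial unfolding is_extraspecial_27_def by (auto simp: add.assoc diff_eq_eq)

lemma c_eq: "c = g + h - g - h"
  using extraspecial unfolding is_extraspecial_27_def by auto

lemma H_hull: "H = is_subgroup hull {s, t}" and card_H: "card H = 8"
  and order_s: "s + (s + (s + s)) = 0" and tt: "t + t = s + s" and ts: "t + s = s + (s + (s + t))"
proof -
  have s4: "s + s + s + s = 0" and ts: "t + s = - s + t"
    using quaternion unfolding is_quaternion_8_def by auto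
  then show "s + (s + (s + s)) = 0" by (simp add: add.assoc)
  then have "- s = s + (s + s)" by (rule minus_unique)
  then show "t + s = s + (s + (s + t))" using ts by (simp add: add.assoc)
qed (use quaternion in \<open>auto simp: is_quaternion_8_def\<close>)

lemma gens: "g \<in> P" "h \<in> P" "c \<in> P" "s \<in> H" "t \<in> H"
  using hull_subset[of "{g, h, c}" is_subgroup] hull_subset[of "{s, t}" is_subgroup]
  by (auto simp flip: P_hull H_hull)

text \<open>The generator \<open>c\<close> needs no case of its own, being the commutator of
  \<open>g\<close> and \<open>h\<close>.\<close>

lemma P_induct:
  assumes "is_subgroup U" "g \<in> U" "h \<in> U" "p \<in> P"
  shows "p \<in> U"
proof -
  have "c \<in> U" using assms(1-3) unfolding c_eq is_subgroup_def by (simp only: diff_conv_add_uminus)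
  then have "P \<subseteq> U" unfolding P_hull using assms by (intro hull_minimal) auto
  then show ?thesis using assms by blast
qed

lemma H_induct:
  assumes "is_subgroup U" "s \<in> U" "t \<in> U" "q \<in> H"
  shows "q \<in> U"
proof -
  have "H \<subseteq> U" unfolding H_hull using assms by (intro hull_minimal) auto
  then show ?thesis using assms by blast
qed

lemma finite_P: "finite P" and finite_H: "finite H"
  using card_P card_H by (auto intro: card_ge_0_finite)

lemma decompose: obtains p q where "p \<in> P" "q \<in> H" "a = p + q"
  using PH_UNIV by blast

lemma decompose_unique:
  assumes "p \<in> P" "q \<in> H" "p' \<in> P" "q' \<in> H" "p + q = p' + q'"
  shows "p = p' \<and> q = q'"
proof -
  have "- p' + p = q' + - q"
    using assms(5) by (metis add.assoc add.right_inverse add.right_neutral minus_add_cancel)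
  then have "- p' + p \<in> P \<inter> H"
    using assms by (metis Int_iff P_add P_minus H_add H_minus)
  then have "- p' + p = 0" by (simp add: PH_0)
  then have "p = p'" by (metis add.right_neutral add_minus_cancel)
  then show ?thesis using assms(5) by simp
qed

lemma finite_UNIV_group: "finite (UNIV :: 'g set)"
proof -
  have "a \<in> (\<lambda>(p, q). p + q) ` (P \<times> H)" for a
    by (rule decompose[of a]) force
  then have "(UNIV :: 'g set) \<subseteq> (\<lambda>(p, q). p + q) ` (P \<times> H)" by blast
  then show ?thesis
    by (rule finite_subset) (simp add: finite_P finite_H)
qed

text \<open>The eight listed words are closed under addition and negation and contain
  \<open>s\<close> and \<open>t\<close>, so they exhaust \<open>H\<close>; as \<open>H\<close> has
  order 8, no two of them coincide.\<close>

lemma H_elements: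
  "H = set [0, s, s + s, s + (s + s), t, s + t, s + (s + t), s + (s + (s + t))]" (is "_ = set ?L")
  and H_distinct: "distinct [0, s, s + s, s + (s + s), t, s + t, s + (s + t), s + (s + (s + t))]"
proof -
  have tt': "t + (t + a) = s + (s + a)" and ts': "t + (s + a) = s + (s + (s + (t + a)))"
    and s4: "s + (s + (s + (s + a))) = a" for a
    using tt ts order_s by (metis add.assoc add.left_neutral)+
  note nf = add.assoc tt tt' ts ts' order_s s4
  have minus: "- s = s + (s + s)" "- (s + s) = s + s" "- (s + (s + s)) = s" "- t = s + (s + t)"
    "- (s + t) = s + (s + (s + t))" "- (s + (s + t)) = t" "- (s + (s + (s + t))) = s + t"
    by (rule minus_unique; simp only: nf)+
  have "is_subgroup (set ?L)"
    unfolding is_subgroup_def list.set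
    by (intro conjI ballI; (elim insertE emptyE)?; simp only: minus minus_zero nf add_0_left add_0_right insert_iff simp_thms)
  then have sub: "H \<subseteq> set ?L"
    unfolding H_hull by (intro hull_minimal) auto
  then have "card H \<le> card (set ?L)" by (intro card_mono) auto
  then have card: "card (set ?L) = length ?L"
    using card_length[of ?L] by (simp add: card_H)
  then show "distinct ?L" by (rule card_distinct)
  show "H = set ?L"
    using sub card by (intro card_subset_eq) (simp_all add: card_H)
qed

sublocale heisenberg_ring "el g" "el h" "el c"
proof
  have "(3 :: 'g \<Rightarrow>\<^sub>0 'k) = scal 3" by simp
  then show "(3 :: 'g \<Rightarrow>\<^sub>0 'k) = 0" unfolding char3 by simp
  have "g + (h + (c + c)) = c + (h + (g + (c + c)))"
    by (simp only: gh flip: add.assoc)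
  also have "\<dots> = h + (g + (c + (c + c)))"
    by (metis add.assoc cg ch)
  finally have "h + g = g + (h + (c + c))" by (simp add: order_c)
  then show "el h * el g = el g * (el h * (el c * el c))" by (simp flip: el_add)
qed (simp_all add: order_g order_h order_c cg ch el_0 flip: el_add)

abbreviation "G \<equiv> el g"
abbreviation "Hh \<equiv> el h"
abbreviation "C \<equiv> el c"
abbreviation "S \<equiv> el s"
abbreviation "T \<equiv> el t"

text \<open>Each of \<open>s\<close> and \<open>t\<close> inverts one of \<open>g\<close>,
  \<open>h\<close> and fixes the other, hence inverts their commutator \<open>c\<close>. The
  computation for \<open>c\<close> is done in the group algebra, where the rewriting rules of
  \<open>heisenberg_ring\<close> are available, and pulled back by \<open>el_inject\<close>.\<close>

lemma act_s_c: "s + c = c + (c + s)" and act_t_c: "t + c = c + (c + t)"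
  and s_g: "s + g = g + (g + s)" and s_h: "s + h = h + s"
  and t_g: "t + g = g + t" and t_h: "t + h = h + (h + t)"
proof -
  have move: "a + x = y + a" if "- a + y + a = x" for a x y :: 'g
    using that by (metis add.assoc add_minus_cancel)
  have neg: "- a + - y + a = - x" if "- a + y + a = x" for a x y :: 'g
    using that by (metis add.assoc minus_add minus_minus)
  have inv: "- g = g + g" "- h = h + h" "- c = c + c"
    using order_g order_h order_c by (auto intro: minus_unique)
  show sg: "s + g = g + (g + s)" using move[OF neg[OF act_s_g]] inv by (metis minus_minus add.assoc)
  show sh: "s + h = h + s" using move[OF act_s_h] .
  show tg: "t + g = g + t" using move[OF act_t_g] .
  show th: "t + h = h + (h + t)" using move[OF neg[OF act_t_h]] inv by (metis minus_minus add.assoc)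
  have S: "S * G = G * G * S" "S * Hh = Hh * S" "T * G = G * T" "T * Hh = Hh * Hh * T"
    using sg sh tg th by (simp_all add: add.assoc flip: el_add)
  then have S': "S * (G * a) = G * (G * (S * a))" "S * (Hh * a) = Hh * (S * a)"
    "T * (G * a) = G * (T * a)" "T * (Hh * a) = Hh * (Hh * (T * a))" for a
    by (simp_all flip: mult.assoc)
  have c: "c = g + (h + (g + g) + (h + h))"
    using c_eq inv by (metis add.assoc diff_conv_add_uminus)
  show "s + c = c + (c + s)"
  proof -
    have "S * C = S * G * Hh * (G * G) * (Hh * Hh)" by (simp add: c el_add mult.assoc)
    also have "\<dots> = G * G * (Hh * (G * G * (G * G))) * (Hh * Hh) * S"
      by (simp add: mult.assoc S S')
    also have "\<dots> = C * (C * S)" by (simp add: mult.assoc comm HG CG CH G3 H3 C3)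
    finally show ?thesis by (simp add: el_inject flip: el_add)
  qed
  show "t + c = c + (c + t)"
  proof -
    have "T * C = T * G * Hh * (G * G) * (Hh * Hh)" by (simp add: c el_add mult.assoc)
    also have "\<dots> = G * (Hh * (Hh * (G * G))) * (Hh * Hh * (Hh * Hh)) * T"
      by (simp add: mult.assoc S S')
    also have "\<dots> = C * (C * T)" by (simp add: mult.assoc comm HG CG CH G3 H3 C3)
    finally show ?thesis by (simp add: el_inject flip: el_add)
  qed
qed

lemma act_rules:
  "S * G = G * (G * S)" "S * Hh = Hh * S" "S * C = C * (C * S)"
  "T * G = G * T" "T * Hh = Hh * (Hh * T)" "T * C = C * (C * T)"
  by (simp_all add: act_s_c act_t_c s_g s_h t_g t_h flip: el_add)

lemma act_rules_assoc:
  "S * (G * a) = G * (G * (S * a))" "S * (Hh * a) = Hh * (S * a)" "S * (C * a) = C * (C * (S * a))"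
  "T * (G * a) = G * (T * a)" "T * (Hh * a) = Hh * (Hh * (T * a))" "T * (C * a) = C * (C * (T * a))"
  using act_rules by (simp_all flip: mult.assoc)

text \<open>The four generators have finite order, so their inverses are positive words and closure
  under products reaches every group element.\<close>

lemma group_algebra_induct [case_names const add mult g h s t]:
  assumes const: "\<And>l. Q (scal l)" and add: "\<And>a b. Q a \<Longrightarrow> Q b \<Longrightarrow> Q (a + b)"
    and mult: "\<And>a b. Q a \<Longrightarrow> Q b \<Longrightarrow> Q (a * b)" and "Q G" "Q Hh" "Q S" "Q T"
  shows "Q (a :: 'g \<Rightarrow>\<^sub>0 'k)"
proof -
  let ?U = "{a. Q (el a) \<and> Q (el (- a))}"
  have U: "is_subgroup ?U"
    unfolding is_subgroup_def using const[of 1] mult by (auto simp: el_0 el_add el_diff minus_add)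
  have "t + (t + (s + s)) = 0"
    using tt order_s by (metis add.assoc)
  then have neg: "- g = g + g" "- h = h + h" "- s = s + (s + s)" "- t = t + (s + s)"
    using order_g order_h order_s by (auto intro!: minus_unique)
  have "Q (el a)" for a
  proof -
    obtain p q where a: "p \<in> P" "q \<in> H" "a = p + q" by (rule decompose)
    have "p \<in> ?U" by (rule P_induct[OF U _ _ a(1)]) (use assms(4,5) mult neg in \<open>auto simp: el_add\<close>)
    moreover have "q \<in> ?U" by (rule H_induct[OF U _ _ a(2)]) (use assms(6,7) mult neg in \<open>auto simp: el_add\<close>)
    ultimately show ?thesis using mult a by (simp add: el_add)
  qed
  then have "Q (Poly_Mapping.single m l)" for m l
    by (subst single_eq_el) (intro mult const)
  then show ?thesis
    by (induction a rule: single_add_induct) (auto intro: add)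
qed

end

lemma alg_hom_monomial:
  assumes hom: "is_alg_hom \<phi>" and one: "\<phi> 1 = 1"
  shows "\<phi> (monomial x y z m) = monomial (\<phi> x) (\<phi> y) (\<phi> z) m"
proof -
  have "\<phi> (a ^ n) = \<phi> a ^ n" for a n
    by (induction n) (simp_all add: one alg_hom_mult[OF hom])
  then show ?thesis
    by (simp add: monomial_def alg_hom_mult[OF hom] split: prod.split)
qed

lemma mem_if_keys:
  fixes a :: "'m \<Rightarrow>\<^sub>0 'k::comm_monoid_add"
  assumes "\<And>m l. m \<in> Poly_Mapping.keys a \<Longrightarrow> Poly_Mapping.single m l \<in> V"
    and "0 \<in> V" "\<And>a b. a \<in> V \<Longrightarrow> b \<in> V \<Longrightarrow> a + b \<in> V"
  shows "a \<in> V"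
proof -
  have "a = (\<Sum>m\<in>Poly_Mapping.keys a. Poly_Mapping.single m (Poly_Mapping.lookup a m))"
    by (rule poly_mapping_eqI) (auto simp: lookup_sum lookup_single when_def in_keys_iff)
  moreover have "(\<Sum>m\<in>M. Poly_Mapping.single m (Poly_Mapping.lookup a m)) \<in> V"
    if "finite M" "M \<subseteq> Poly_Mapping.keys a" for M
    using that by (induction M) (auto intro: assms)
  ultimately show ?thesis by (metis finite_keys order_refl)
qed

section \<open>The presentation of the group algebra of P\<close>

context quaternion_action
begin

lemma char3_group_algebra: "(3 :: 'g \<Rightarrow>\<^sub>0 'k) = 0"
proof -
  have "(3 :: 'g \<Rightarrow>\<^sub>0 'k) = scal 3" by simp
  then show ?thesis unfolding char3 by simp
qed

lemma el_P_in_range: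
  fixes \<phi> :: "(gen3 list \<Rightarrow>\<^sub>0 'k) \<Rightarrow> ('g \<Rightarrow>\<^sub>0 'k)"
  assumes hom: "is_alg_hom \<phi>" and one: "\<phi> 1 = 1"
    and x: "\<phi> (free_gen Gen_x) = X" and y: "\<phi> (free_gen Gen_y) = Y" and p: "p \<in> P"
  shows "el p \<in> range \<phi>"
proof -
  have mult: "a * b \<in> range \<phi>" if "a \<in> range \<phi>" "b \<in> range \<phi>" for a b
    using that by (auto simp flip: alg_hom_mult[OF hom])
  have "\<phi> (1 - free_gen Gen_x - free_gen Gen_x * free_gen Gen_x) = G"
    by (simp add: alg_hom_diff[OF hom] alg_hom_mult[OF hom] one x flip: G_eq)
  then have G: "G \<in> range \<phi>" by (metis rangeI)
  have "\<phi> (1 - free_gen Gen_y - free_gen Gen_y * free_gen Gen_y) = Hh"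
    by (simp add: alg_hom_diff[OF hom] alg_hom_mult[OF hom] one y flip: H_eq)
  then have Hh: "Hh \<in> range \<phi>" by (metis rangeI)
  have neg: "- g = g + g" "- h = h + h"
    using order_g order_h by (auto intro: minus_unique)
  have "1 \<in> range \<phi>" using one by (metis rangeI)
  then have "is_subgroup {p. el p \<in> range \<phi> \<and> el (- p) \<in> range \<phi>}"
    unfolding is_subgroup_def using mult by (auto simp: el_0 el_add el_diff minus_add)
  from P_induct[OF this _ _ p] show ?thesis
    using G Hh mult by (auto simp: neg el_add)
qed

lemma mult_subgroup_algebra:
  assumes "a \<in> subgroup_algebra P" "b \<in> subgroup_algebra P"
  shows "a * b \<in> (subgroup_algebra P :: ('g \<Rightarrow>\<^sub>0 'k) set)"
  using assms keys_mult[of a b] P_add unfolding subgroup_algebra_def by blast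

lemma add_subgroup_algebra:
  assumes "a \<in> subgroup_algebra P" "b \<in> subgroup_algebra P"
  shows "a + b \<in> (subgroup_algebra P :: ('g \<Rightarrow>\<^sub>0 'k) set)"
  using assms keys_add[of a b] unfolding subgroup_algebra_def by blast

lemma uminus_subgroup_algebra:
  assumes "a \<in> subgroup_algebra P"
  shows "- a \<in> (subgroup_algebra P :: ('g \<Rightarrow>\<^sub>0 'k) set)"
  using assms unfolding subgroup_algebra_def by (auto simp: in_keys_iff)

lemma diff_subgroup_algebra:
  assumes "a \<in> subgroup_algebra P" "b \<in> subgroup_algebra P"
  shows "a - b \<in> (subgroup_algebra P :: ('g \<Rightarrow>\<^sub>0 'k) set)"
  using add_subgroup_algebra[OF assms(1) uminus_subgroup_algebra[OF assms(2)]] by simp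

lemma single_subgroup_algebra: "p \<in> P \<Longrightarrow> Poly_Mapping.single p l \<in> subgroup_algebra P"
  by (auto simp: subgroup_algebra_def)

lemma XYZ_subgroup_algebra:
  "X \<in> subgroup_algebra P" "Y \<in> subgroup_algebra P" "Z \<in> subgroup_algebra P"
proof -
  have el: "el p \<in> subgroup_algebra P" if "p \<in> P" for p
    using that by (simp add: el_def single_subgroup_algebra)
  show X: "X \<in> subgroup_algebra P" and Y: "Y \<in> subgroup_algebra P"
    unfolding X_def Y_def by (intro diff_subgroup_algebra mult_subgroup_algebra el gens)+
  show "Z \<in> subgroup_algebra P"
    unfolding Z_def by (intro diff_subgroup_algebra mult_subgroup_algebra X Y)
qed

lemma monomial_subgroup_algebra: "monomial X Y Z m \<in> subgroup_algebra P"
proof -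
  have "1 \<in> (subgroup_algebra P :: ('g \<Rightarrow>\<^sub>0 'k) set)"
    using single_subgroup_algebra[OF P_0, of 1] by simp
  then have "a ^ n \<in> subgroup_algebra P" if "a \<in> subgroup_algebra P" for a :: "'g \<Rightarrow>\<^sub>0 'k" and n
    using that by (induction n) (auto intro: mult_subgroup_algebra)
  then show ?thesis
    by (simp add: monomial_def mult_subgroup_algebra XYZ_subgroup_algebra split: prod.split)
qed

lemma hom_P_exists:
  obtains \<phi> :: "(gen3 list \<Rightarrow>\<^sub>0 'k) \<Rightarrow> ('g \<Rightarrow>\<^sub>0 'k)"
  where "is_alg_hom \<phi>" "\<phi> 1 = 1" "\<phi> (free_gen Gen_x) = X" "\<phi> (free_gen Gen_y) = Y"
    "\<phi> (free_gen Gen_z) = Z" "range \<phi> = subgroup_algebra P"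
    "relation_ideal (relations_P (free_gen Gen_x) (free_gen Gen_y) (free_gen Gen_z)) \<subseteq> {a. \<phi> a = 0}"
proof -
  obtain \<phi> :: "(gen3 list \<Rightarrow>\<^sub>0 'k) \<Rightarrow> ('g \<Rightarrow>\<^sub>0 'k)" where hom: "is_alg_hom \<phi>" and one: "\<phi> 1 = 1"
    and gen: "\<And>g. \<phi> (free_gen g) = (case g of Gen_x \<Rightarrow> X | Gen_y \<Rightarrow> Y | Gen_z \<Rightarrow> Z)"
    using alg_hom_exists[of 1 "\<lambda>g. case g of Gen_x \<Rightarrow> X | Gen_y \<Rightarrow> Y | Gen_z \<Rightarrow> Z"] by auto
  note hom_simps = alg_hom_add[OF hom] alg_hom_mult[OF hom] alg_hom_scal[OF hom]
    alg_hom_diff[OF hom] alg_hom_minus[OF hom] alg_hom_0[OF hom] gen power3_eq_cube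
  have "l - r \<in> {a. \<phi> a = 0}"
    if "(l, r) \<in> relations_P (free_gen Gen_x) (free_gen Gen_y) (free_gen Gen_z)" for l r
    using that X_cubed Y_cubed XZ YZ Z_def by (auto simp: relations_P_def hom_simps)
  then have "relation_ideal (relations_P (free_gen Gen_x) (free_gen Gen_y) (free_gen Gen_z)) \<subseteq> {a. \<phi> a = 0}"
    by (intro relation_ideal_subset two_sided_ideal_kernel[OF hom])
  moreover have "range \<phi> = subgroup_algebra P"
  proof
    have "\<phi> a \<in> subgroup_algebra P" for a
    proof (induction a rule: free_algebra_induct)
      case (const l)
      then show ?case
        using alg_hom_scal[OF hom, of l 1] one single_subgroup_algebra[OF P_0] by simp
    next
      case (gen g a)
      then show ?case
        by (cases g) (auto simp: hom_simps intro!: mult_subgroup_algebra XYZ_subgroup_algebra)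
    qed (simp add: hom_simps add_subgroup_algebra)
    then show "range \<phi> \<subseteq> subgroup_algebra P" by blast
    show "subgroup_algebra P \<subseteq> range \<phi>"
    proof
      fix a :: "'g \<Rightarrow>\<^sub>0 'k" assume a: "a \<in> subgroup_algebra P"
      show "a \<in> range \<phi>"
      proof (rule mem_if_keys)
        fix m l assume "m \<in> Poly_Mapping.keys a"
        then have "el m \<in> range \<phi>"
          using a by (intro el_P_in_range[OF hom one]) (auto simp: subgroup_algebra_def gen)
        then show "Poly_Mapping.single m l \<in> range \<phi>"
          unfolding single_eq_el[of m l] by (auto simp flip: hom_simps(3))
      next
        show "0 \<in> range \<phi>" using hom_simps by (metis rangeI)
      qed (auto simp flip: hom_simps(1))
    qed
  qed
  ultimately show ?thesis using that[OF hom one] by (simp add: gen)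
qed

text \<open>A dimension count: the monomials span the presented algebra, which maps onto k P, and
  the 27 group elements of \<open>P\<close> form an independent set inside their span.\<close>

lemma monomials_independent:
  assumes "(\<Sum>m\<in>exponents. scal (f m) * monomial X Y Z m) = 0" "m \<in> exponents"
  shows "f m = (0 :: 'k)"
proof -
  interpret F: free_twisted_relations "relation_ideal
      (relations_P (free_gen Gen_x) (free_gen Gen_y) (free_gen Gen_z :: gen3 list \<Rightarrow>\<^sub>0 'k))" 1
    using char3 by (rule free_twisted_relations_P)
  obtain \<phi> :: "(gen3 list \<Rightarrow>\<^sub>0 'k) \<Rightarrow> ('g \<Rightarrow>\<^sub>0 'k)"
    where hom: "is_alg_hom \<phi>" and one: "\<phi> 1 = 1"
      and gen: "\<phi> (free_gen Gen_x) = X" "\<phi> (free_gen Gen_y) = Y" "\<phi> (free_gen Gen_z) = Z"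
      and ran: "range \<phi> = subgroup_algebra P"
      and I: "relation_ideal (relations_P (free_gen Gen_x) (free_gen Gen_y) (free_gen Gen_z)) \<subseteq> {a. \<phi> a = 0}"
    by (rule hom_P_exists)
  have "inj_on el P" by (rule inj_onI) (simp add: el_inject)
  then have card: "card (el ` P) = 27" by (simp add: card_image card_P)
  have indep: "pm.independent (el ` P)"
  proof (rule pm.independent_if_scalars_zero)
    fix u a assume sum: "(\<Sum>a\<in>el ` P. scal (u a) * a) = 0" and "a \<in> el ` P"
    then obtain p where p: "p \<in> P" "a = el p" by blast
    have "(\<Sum>q\<in>P. scal (u (el q)) * el q) = 0"
      using sum \<open>inj_on el P\<close> by (simp add: sum.reindex)
    then have "(\<Sum>q\<in>P. Poly_Mapping.lookup (scal (u (el q)) * el q) p) = 0"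
      by (metis lookup_sum lookup_zero)
    then show "u a = 0"
      using p finite_P by (simp add: el_def lookup_single when_def if_distrib cong: if_cong)
  qed (simp add: finite_P)
  have "el ` P \<subseteq> pm.span (monomial X Y Z ` exponents)"
  proof
    fix b assume "b \<in> el ` P"
    then have "b \<in> range \<phi>" unfolding ran el_def using single_subgroup_algebra by blast
    then obtain a where a: "b = \<phi> a" by blast
    obtain d where "a - (\<Sum>m\<in>exponents. scal (d m) *
        monomial (free_gen Gen_x) (free_gen Gen_y) (free_gen Gen_z) m) \<in> relation_ideal
      (relations_P (free_gen Gen_x) (free_gen Gen_y) (free_gen Gen_z :: gen3 list \<Rightarrow>\<^sub>0 'k))"
      by (rule F.monomials_span)
    with I have "\<phi> (a - (\<Sum>m\<in>exponents. scal (d m) *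
        monomial (free_gen Gen_x) (free_gen Gen_y) (free_gen Gen_z) m)) = 0" by blast
    then have "b = (\<Sum>m\<in>exponents. scal (d m) * monomial X Y Z m)"
      by (simp add: a alg_hom_diff[OF hom] alg_hom_sum[OF hom] alg_hom_scal[OF hom]
          alg_hom_monomial[OF hom one] gen)
    then show "b \<in> pm.span (monomial X Y Z ` exponents)"
      unfolding span_family[OF finite_exponents] by blast
  qed
  with card indep show ?thesis
    using assms by (intro spanning_family_independent[where B="el ` P"])
      (auto simp: finite_exponents card_exponents)
qed

lemma has_presentation_P:
  "has_presentation (subgroup_algebra P :: ('g \<Rightarrow>\<^sub>0 'k) set) 1
    (relations_P (free_gen Gen_x) (free_gen Gen_y) (free_gen Gen_z))"
proof -
  interpret F: free_twisted_relations "relation_ideal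
      (relations_P (free_gen Gen_x) (free_gen Gen_y) (free_gen Gen_z :: gen3 list \<Rightarrow>\<^sub>0 'k))" 1
    using char3 by (rule free_twisted_relations_P)
  obtain \<phi> :: "(gen3 list \<Rightarrow>\<^sub>0 'k) \<Rightarrow> ('g \<Rightarrow>\<^sub>0 'k)"
    where hom: "is_alg_hom \<phi>" and one: "\<phi> 1 = 1"
      and gen: "\<phi> (free_gen Gen_x) = X" "\<phi> (free_gen Gen_y) = Y" "\<phi> (free_gen Gen_z) = Z"
      and ran: "range \<phi> = subgroup_algebra P"
      and I: "relation_ideal (relations_P (free_gen Gen_x) (free_gen Gen_y) (free_gen Gen_z)) \<subseteq> {a. \<phi> a = 0}"
    by (rule hom_P_exists)
  have "{a. \<phi> a = 0} = relation_ideal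
      (relations_P (free_gen Gen_x) (free_gen Gen_y) (free_gen Gen_z :: gen3 list \<Rightarrow>\<^sub>0 'k))"
    using hom I by (rule F.kernel_eq_ideal)
      (auto simp: alg_hom_monomial[OF hom one] gen intro: monomials_independent)
  then show ?thesis
    unfolding has_presentation_def using hom one ran unfolding is_alg_hom_def by blast
qed

section \<open>The nil kernel of k G -> k H\<close>

lemma normal_induct:
  assumes L: "two_sided_ideal L"
    and "\<exists>b. G * u - u * b \<in> L" "\<exists>b. Hh * u - u * b \<in> L" "\<exists>b. S * u - u * b \<in> L" "\<exists>b. T * u - u * b \<in> L"
  shows "\<exists>b. a * u - u * b \<in> (L :: ('g \<Rightarrow>\<^sub>0 'k) set)"
proof (induction a rule: group_algebra_induct)
  case (const l)
  show ?case by (rule exI[of _ "scal l"]) (simp add: scal_commute ideal_0[OF L])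
next
  case (add a a')
  then obtain b b' where "a * u - u * b \<in> L" "a' * u - u * b' \<in> L" by blast
  then have "(a * u - u * b) + (a' * u - u * b') \<in> L" by (rule ideal_add[OF L])
  then have "(a + a') * u - u * (b + b') \<in> L" by (simp add: algebra_simps)
  then show ?case by blast
next
  case (mult a a')
  then obtain b b' where b: "a * u - u * b \<in> L" "a' * u - u * b' \<in> L" by blast
  have "a * (a' * u - u * b') + (a * u - u * b) * b' \<in> L"
    by (intro ideal_add[OF L] ideal_mult_left[OF L] ideal_mult_right[OF L] b)
  then have "(a * a') * u - u * (b * b') \<in> L" by (simp add: algebra_simps)
  then show ?case by blast
qed (use assms in auto)

text \<open>The kernel is built in three layers because G - 1 and H - 1 are normal only modulo the
  preceding layer: commuting \<open>G\<close> and \<open>Hh\<close> produces multiples of C -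
  1.\<close>

definition J1 :: "('g \<Rightarrow>\<^sub>0 'k) set" where "J1 = ideal_extension {0} (C - 1)"
definition J2 :: "('g \<Rightarrow>\<^sub>0 'k) set" where "J2 = ideal_extension J1 (G - 1)"
definition J :: "('g \<Rightarrow>\<^sub>0 'k) set" where "J = ideal_extension J2 (Hh - 1)"

lemma cube_minus_1: "a * (a * a) = 1 \<Longrightarrow> (a - 1) ^ 3 = (0 :: 'g \<Rightarrow>\<^sub>0 'k)"
proof -
  assume a: "a * (a * a) = 1"
  have "(a - 1) ^ 3 = a * (a * a) - 1 - (a * a + a * a + a * a) + (a + a + a)"
    by (simp add: power3_eq_cube algebra_simps)
  also have "\<dots> = 0" using a by (simp add: char3_triple[OF char3_group_algebra])
  finally show ?thesis .
qed

lemma extension_superset: "k \<in> K' \<Longrightarrow> k \<in> ideal_extension K' u"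
  unfolding ideal_extension_def by (intro CollectI exI[of _ k] exI[of _ 0]) simp

lemma extension_gen: "0 \<in> K' \<Longrightarrow> u \<in> ideal_extension K' u"
  unfolding ideal_extension_def by (intro CollectI exI[of _ 0] exI[of _ 1]) simp

text \<open>In characteristic 3 the cube of a - 1 is a^3 - 1, so each layer has a generator of cube
  0 and one cubing descends one layer. Three layers give the exponent 27.\<close>

lemma two_sided_ideal_J: "two_sided_ideal J" and J_nil: "n \<in> J \<Longrightarrow> n ^ 27 = 0"
    and G_minus_1_J: "G - 1 \<in> J" and H_minus_1_J: "Hh - 1 \<in> J"
proof -
  have 0: "two_sided_ideal ({0} :: ('g \<Rightarrow>\<^sub>0 'k) set)" by (simp add: two_sided_ideal_def)
  have n1: "\<exists>b. a * (C - 1) - (C - 1) * b \<in> {0}" for a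
  proof (rule normal_induct[OF 0])
    show "\<exists>b. G * (C - 1) - (C - 1) * b \<in> {0}"
      by (rule exI[of _ G]) (simp add: algebra_simps CG)
    show "\<exists>b. Hh * (C - 1) - (C - 1) * b \<in> {0}"
      by (rule exI[of _ Hh]) (simp add: algebra_simps CH)
    \<comment> \<open>\<open>S\<close> conjugates \<open>C\<close> to C^2, and C^2 - 1 = (C - 1) (C
      + 1) supplies the witness. The same factorization serves for \<open>G\<close> and
      \<open>Hh\<close> below whenever they are inverted.\<close>
    show "\<exists>b. S * (C - 1) - (C - 1) * b \<in> {0}"
      by (rule exI[of _ "(C + 1) * S"]) (simp add: algebra_simps act_rules)
    show "\<exists>b. T * (C - 1) - (C - 1) * b \<in> {0}"
      by (rule exI[of _ "(C + 1) * T"]) (simp add: algebra_simps act_rules)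
  qed
  note J1 = ideal_extension[OF 0 n1, folded J1_def]
  have C1: "(C - 1) * a \<in> J1" for a
    using extension_gen[of "{0}" "C - 1"] by (auto simp: J1_def[symmetric] intro: ideal_mult_right[OF J1(1)])
  have n2: "\<exists>b. a * (G - 1) - (G - 1) * b \<in> J1" for a
  proof (rule normal_induct[OF J1(1)])
    show "\<exists>b. G * (G - 1) - (G - 1) * b \<in> J1"
      by (rule exI[of _ G]) (simp add: algebra_simps ideal_0[OF J1(1)])
    have "Hh * (G - 1) - (G - 1) * Hh = (C - 1) * ((C + 1) * (G * Hh))"
      by (simp add: algebra_simps HG CG CH comm)
    then show "\<exists>b. Hh * (G - 1) - (G - 1) * b \<in> J1"
      using C1 by metis
    have "S * (G - 1) - (G - 1) * ((G + 1) * S) = 0" by (simp add: algebra_simps act_rules)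
    then show "\<exists>b. S * (G - 1) - (G - 1) * b \<in> J1"
      using ideal_0[OF J1(1)] by metis
    show "\<exists>b. T * (G - 1) - (G - 1) * b \<in> J1"
      by (rule exI[of _ T]) (simp add: algebra_simps act_rules ideal_0[OF J1(1)])
  qed
  note J2 = ideal_extension[OF J1(1) n2, folded J2_def]
  have C2: "(C - 1) * a \<in> J2" for a
    using extension_superset[OF C1] by (simp add: J2_def)
  have n3: "\<exists>b. a * (Hh - 1) - (Hh - 1) * b \<in> J2" for a
  proof (rule normal_induct[OF J2(1)])
    have "G * (Hh - 1) - (Hh - 1) * G = - ((C - 1) * ((C + 1) * (G * Hh)))"
      by (simp add: algebra_simps HG CG CH comm)
    then show "\<exists>b. G * (Hh - 1) - (Hh - 1) * b \<in> J2"
      using ideal_minus[OF J2(1) C2] by metis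
    show "\<exists>b. Hh * (Hh - 1) - (Hh - 1) * b \<in> J2"
      by (rule exI[of _ Hh]) (simp add: algebra_simps ideal_0[OF J2(1)])
    show "\<exists>b. S * (Hh - 1) - (Hh - 1) * b \<in> J2"
      by (rule exI[of _ S]) (simp add: algebra_simps act_rules ideal_0[OF J2(1)])
    have "T * (Hh - 1) - (Hh - 1) * ((Hh + 1) * T) = 0" by (simp add: algebra_simps act_rules)
    then show "\<exists>b. T * (Hh - 1) - (Hh - 1) * b \<in> J2"
      using ideal_0[OF J2(1)] by metis
  qed
  note J = ideal_extension[OF J2(1) n3, folded J_def]
  show "two_sided_ideal J" by (rule J(1))
  show "Hh - 1 \<in> J" unfolding J_def by (intro extension_gen ideal_0[OF J2(1)])
  show "G - 1 \<in> J" unfolding J_def J2_def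
    by (intro extension_superset extension_gen ideal_0[OF J1(1)])
  assume "n \<in> J"
  then have "n ^ 3 \<in> J2"
    by (rule J(2)) (simp add: cube_minus_1 H3 ideal_0[OF J2(1)])
  then have "(n ^ 3) ^ 3 \<in> J1"
    by (rule J2(2)) (simp add: cube_minus_1 G3 ideal_0[OF J1(1)])
  then have "((n ^ 3) ^ 3) ^ 3 \<in> {0}"
    by (rule J1(2)) (simp add: cube_minus_1 C3)
  then show "n ^ 27 = 0" by (simp flip: power_mult)
qed

lemma idempotent_J: "a * a = a \<Longrightarrow> a \<in> J \<Longrightarrow> a = 0"
proof -
  assume a: "a * a = a" "a \<in> J"
  have "a ^ Suc n = a" for n using a(1) by (induction n) simp_all
  from this[of 26] show "a = 0" using J_nil[OF a(2)] by simp
qed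

lemma el_minus_1_J:
  assumes "p \<in> P"
  shows "el p - 1 \<in> J"
proof -
  note J = two_sided_ideal_J
  have "is_subgroup {p. el p - 1 \<in> J}"
    unfolding is_subgroup_def
  proof (intro conjI ballI)
    fix a b assume "a \<in> {p. el p - 1 \<in> J}" "b \<in> {p. el p - 1 \<in> J}"
    then have "el a * (el b - 1) + (el a - 1) \<in> J"
      by (intro ideal_add[OF J] ideal_mult_left[OF J]) auto
    then show "a + b \<in> {p. el p - 1 \<in> J}" by (simp add: el_add algebra_simps)
  next
    fix a assume "a \<in> {p. el p - 1 \<in> J}"
    then have "- el (- a) * (el a - 1) \<in> J" by (intro ideal_mult_left[OF J]) auto
    moreover have "el (- a) * el a = 1" by (simp add: el_0 flip: el_add)
    ultimately show "- a \<in> {p. el p - 1 \<in> J}" by (simp add: algebra_simps)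
  qed (simp add: el_0 ideal_0[OF J])
  from P_induct[OF this _ _ assms] show ?thesis
    using G_minus_1_J H_minus_1_J by auto
qed

text \<open>The coefficient at \<open>q\<close> of the image of \<open>a\<close> under \<open>k G \<rightarrow> k H\<close>.\<close>
definition coef :: "'g \<Rightarrow> ('g \<Rightarrow>\<^sub>0 'k) \<Rightarrow> 'k" where
  "coef q a = (\<Sum>p\<in>P. Poly_Mapping.lookup a (p + q))"

lemma coef_add: "coef q (a + b) = coef q a + coef q b"
  by (simp add: coef_def lookup_add sum.distrib)

lemma coef_single:
  assumes "p \<in> P" "r \<in> H" "q \<in> H"
  shows "coef q (Poly_Mapping.single (p + r) l) = (if q = r then l else 0)"
proof -
  have "p + r = p' + q \<longleftrightarrow> p' = p \<and> q = r" if "p' \<in> P" for p'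
    using decompose_unique[OF assms(1,2) that assms(3)] by auto
  then have "coef q (Poly_Mapping.single (p + r) l) = (\<Sum>p'\<in>P. if p' = p then (if q = r then l else 0) else 0)"
    unfolding coef_def by (intro sum.cong) (simp_all add: lookup_single when_def)
  then show ?thesis using assms finite_P by simp
qed

text \<open>Modulo \<open>J\<close> the elements of \<open>P\<close> become 1, so a group element p
  + r is congruent to its component r in \<open>H\<close>.\<close>

lemma coef_cong: "a - (\<Sum>q\<in>H. scal (coef q a) * el q) \<in> J"
proof (induction a rule: single_add_induct)
  case (single m l)
  obtain p r where m: "p \<in> P" "r \<in> H" "m = p + r" by (rule decompose)
  have "(\<Sum>q\<in>H. scal (coef q (Poly_Mapping.single m l)) * el q) = (\<Sum>q\<in>H. if q = r then scal l * el q else 0)"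
    by (rule sum.cong) (use m in \<open>auto simp: coef_single\<close>)
  also have "\<dots> = scal l * el r" using m finite_H by simp
  finally have "(\<Sum>q\<in>H. scal (coef q (Poly_Mapping.single m l)) * el q) = scal l * el r" .
  moreover have "Poly_Mapping.single m l = scal l * (el p * el r)"
    by (metis single_eq_el m(3) el_add)
  ultimately have "Poly_Mapping.single m l - (\<Sum>q\<in>H. scal (coef q (Poly_Mapping.single m l)) * el q) =
      scal l * ((el p - 1) * el r)"
    by (simp add: algebra_simps)
  also have "\<dots> \<in> J"
    by (intro ideal_mult_left[OF two_sided_ideal_J] ideal_mult_right[OF two_sided_ideal_J] el_minus_1_J m)
  finally show ?case .
next
  case (add a b)
  from ideal_add[OF two_sided_ideal_J add] show ?case
    by (simp add: coef_add single_add algebra_simps sum.distrib)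
qed

lemma augmentation_eq: "augmentation a = (\<Sum>q\<in>H. coef q a)"
proof -
  have aug: "augmentation a = (\<Sum>m\<in>UNIV. Poly_Mapping.lookup a m)" for a :: "'g \<Rightarrow>\<^sub>0 'k"
    unfolding augmentation_def
    by (rule sum.mono_neutral_left) (auto simp: in_keys_iff finite_UNIV_group)
  show ?thesis
  proof (induction a rule: single_add_induct)
    case (single m l)
    obtain p r where m: "p \<in> P" "r \<in> H" "m = p + r" by (rule decompose)
    have "augmentation (Poly_Mapping.single m l) = l"
      unfolding aug using finite_UNIV_group by (simp add: lookup_single when_def)
    moreover have "(\<Sum>q\<in>H. coef q (Poly_Mapping.single m l)) = (\<Sum>q\<in>H. if q = r then l else 0)"
      by (rule sum.cong) (use m in \<open>auto simp: coef_single\<close>)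
    ultimately show ?case using m finite_H by simp
  next
    case (add a b)
    then show ?case by (simp add: aug lookup_add sum.distrib coef_add)
  qed
qed

section \<open>Central elements of k G modulo the nil kernel\<close>

lemma lookup_el_mult_left: "Poly_Mapping.lookup (el a * b) (a + m) = Poly_Mapping.lookup b m"
  by (induction b rule: single_add_induct)
    (simp_all add: el_def mult_single distrib_left lookup_add lookup_single when_def)

lemma lookup_el_mult_right: "Poly_Mapping.lookup (b * el a) (m + a) = Poly_Mapping.lookup b m"
  by (induction b rule: single_add_induct)
    (simp_all add: el_def mult_single distrib_right lookup_add lookup_single when_def)

text \<open>The subgroup generated by \<open>c\<close>, which is the centre of the extraspecial
  group.\<close>

definition Zc :: "'g set" where
  "Zc = {0, c, c + c}"

lemma Zc_add: "k \<in> Zc \<Longrightarrow> k' \<in> Zc \<Longrightarrow> k + k' \<in> Zc" and Zc_minus: "k \<in> Zc \<Longrightarrow> - k \<in> Zc"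
proof -
  have "c + (c + (c + c)) = c" using order_c by (metis add.assoc add_0_left)
  then show "k \<in> Zc \<Longrightarrow> k' \<in> Zc \<Longrightarrow> k + k' \<in> Zc"
    using order_c by (auto simp: Zc_def add.assoc)
  have "- c = c + c" "- (c + c) = c" using order_c by (auto intro!: minus_unique simp: add.assoc)
  then show "k \<in> Zc \<Longrightarrow> - k \<in> Zc" by (auto simp: Zc_def)
qed

lemma Zc_commute: "k \<in> Zc \<Longrightarrow> a + c = c + a \<Longrightarrow> a + k = k + a"
proof -
  assume k: "k \<in> Zc" and ac: "a + c = c + a"
  then have "a + (c + c) = (c + c) + a" by (metis add.assoc)
  then show ?thesis using k ac by (auto simp: Zc_def)
qed

lemma P_shift:
  assumes a: "a + c = c + a" "\<exists>k\<in>Zc. a + g = g + (a + k)" "\<exists>k\<in>Zc. a + h = h + (a + k)" and p: "p \<in> P"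
  shows "\<exists>k\<in>Zc. a + p = p + (a + k)"
proof -
  \<comment> \<open>Commuting with \<open>c\<close> is carried along in the induction, since the
    element \<open>k\<close> of \<open>Zc\<close> left over from one factor has to pass the next
    one.\<close>
  let ?U = "{p. p + c = c + p \<and> (\<exists>k\<in>Zc. a + p = p + (a + k))}"
  have "is_subgroup ?U"
    unfolding is_subgroup_def
  proof (intro conjI ballI)
    show "0 \<in> ?U" by (auto simp: Zc_def)
  next
    fix p p' assume p: "p \<in> ?U" and p': "p' \<in> ?U"
    obtain k k' where k: "k \<in> Zc" "a + p = p + (a + k)" "k' \<in> Zc" "a + p' = p' + (a + k')"
      using p p' by blast
    have "a + (p + p') = p + (a + (k + p'))" using k by (metis add.assoc)
    also have "k + p' = p' + k" using Zc_commute[of k p'] k p' by simp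
    also have "p + (a + (p' + k)) = p + (a + p' + k)" by (simp add: add.assoc)
    also have "\<dots> = (p + p') + (a + (k' + k))" using k by (simp add: add.assoc)
    finally have "\<exists>k\<in>Zc. a + (p + p') = (p + p') + (a + k)" using Zc_add k by blast
    moreover have "p + p' + c = c + (p + p')"
    proof -
      have "p + (p' + c) = p + c + p'" using p' by (simp add: add.assoc)
      also have "\<dots> = c + (p + p')" using p by (simp add: add.assoc)
      finally show ?thesis by (simp add: add.assoc)
    qed
    ultimately show "p + p' \<in> ?U" by blast
  next
    fix p assume p: "p \<in> ?U"
    then obtain k where k: "k \<in> Zc" "a + p = p + (a + k)" by blast
    have "- p + (p + c) + - p = - p + (c + p) + - p" using p by simp
    then have pc: "- p + c = c + - p" by (simp add: add.assoc del: add_uminus_conv_diff)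
    have "- p + (a + p) + - p = - p + (p + (a + k)) + - p" using k(2) by simp
    then have "- p + a = a + k + - p" by (simp add: add.assoc del: add_uminus_conv_diff)
    also have "\<dots> = a + - p + k" using Zc_commute[OF k(1) pc] by (metis add.assoc)
    finally have "- p + a + - k = a + - p" by (simp add: add.assoc)
    then have "a + - p = - p + (a + - k)" by (metis add.assoc)
    then show "- p \<in> ?U" using Zc_minus[OF k(1)] pc by blast
  qed
  from P_induct[OF this _ _ p] show ?thesis using a cg ch by auto
qed

lemma card_P_cyclic: "a + (a + a) = 0 \<Longrightarrow> g \<in> {0, a, a + a} \<Longrightarrow> h \<in> {0, a, a + a} \<Longrightarrow> False"
proof -
  assume a: "a + (a + a) = 0" and gh: "g \<in> {0, a, a + a}" "h \<in> {0, a, a + a}"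
  have "- a = a + a" "- (a + a) = a" "a + (a + (a + a)) = a"
    using a by (auto intro!: minus_unique simp: add.assoc)
  then have "is_subgroup {0, a, a + a}"
    using a by (auto simp: is_subgroup_def add.assoc)
  then have "P \<subseteq> {0, a, a + a}" using gh P_induct by blast
  then have "card P \<le> card {0, a, a + a}" by (intro card_mono) auto
  also have "\<dots> \<le> 3" by (simp add: card_insert_if)
  finally show False by (simp add: card_P)
qed

text \<open>If \<open>g\<close> or \<open>h\<close> lay in \<open>Zc\<close>, the two would commute,
  so \<open>c\<close> and with it that generator would be 0. Then \<open>P\<close> would be
  generated by the other one, which has at most three multiples.\<close>

lemma g_notin_Zc: "g \<notin> Zc" and h_notin_Zc: "h \<notin> Zc"
proof -
  have c0: "c = 0" if "g + h = h + g"
    using gh that by (metis add_0_left add_right_cancel)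
  show "g \<notin> Zc"
  proof
    assume g: "g \<in> Zc"
    then have "c = 0" using Zc_commute[OF g] ch by (intro c0) simp
    then have "g = 0" using g unfolding Zc_def by simp
    then show False using card_P_cyclic[OF order_h] by simp
  qed
  show "h \<notin> Zc"
  proof
    assume h: "h \<in> Zc"
    then have "c = 0" using Zc_commute[OF h] cg by (intro c0) simp
    then have "h = 0" using h unfolding Zc_def by simp
    then show False using card_P_cyclic[OF order_g] by simp
  qed
qed

lemma g_shift: "p \<in> P \<Longrightarrow> \<exists>k\<in>Zc. g + p = p + (g + k)"
proof (rule P_shift)
  have "g + h = h + (g + c)" using gh cg ch by (metis add.assoc)
  then show "\<exists>k\<in>Zc. g + h = h + (g + k)" by (auto simp: Zc_def)
qed (auto simp: Zc_def cg)

lemma h_shift: "p \<in> P \<Longrightarrow> \<exists>k\<in>Zc. h + p = p + (h + k)"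
proof (rule P_shift)
  have "g + (h + (c + c)) = c + (c + c) + (h + g)" using gh cg ch by (metis add.assoc)
  then have "h + g = g + (h + (c + c))" by (simp only: order_c add.assoc add_0_left add_0_right)
  then show "\<exists>k\<in>Zc. h + g = g + (h + k)" by (auto simp: Zc_def)
  show "\<exists>k\<in>Zc. h + h = h + (h + k)" by (rule bexI[of _ 0]) (simp_all add: Zc_def)
qed (simp_all add: ch)

lemma Zc_shift:
  assumes "q \<in> H" "k \<in> Zc"
  shows "\<exists>k'\<in>Zc. k + q = q + k'"
proof -
  have s: "c + s = s + (c + c)" "c + t = t + (c + c)"
    using act_s_c act_t_c order_c by (metis add.assoc add_0_left)+
  have cc: "c + c + s = s + c" "c + c + t = t + c"
    using act_s_c act_t_c by (simp_all add: add.assoc)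
  have st: "\<exists>k'\<in>Zc. k + q = q + k'" if "q = s \<or> q = t" "k \<in> Zc" for q k
    using that s cc by (auto simp: Zc_def)
  have add: "\<exists>k'\<in>Zc. k + (q + q') = (q + q') + k'"
    if "\<And>k. k \<in> Zc \<Longrightarrow> \<exists>k'\<in>Zc. k + q = q + k'" "\<And>k. k \<in> Zc \<Longrightarrow> \<exists>k'\<in>Zc. k + q' = q' + k'" "k \<in> Zc" for q q' k
    using that by (metis add.assoc)
  show ?thesis
    using assms unfolding H_elements list.set by (elim insertE; simp) (intro add st; simp)+
qed

text \<open>
  Conjugation by \<open>a\<close> permutes the coset \<open>P q\<close> in orbits of length 3, since \<open>q\<close> inverts \<open>a\<close> modulo
  the centre of \<open>P\<close>, and the coefficients of a central element are constant on them.
\<close>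
lemma coef_central_0:
  assumes e: "e \<in> ring_center" and q: "q \<in> H" and a: "a \<in> P" "a + (a + a) = 0" "a \<notin> Zc"
    and shift: "\<And>p. p \<in> P \<Longrightarrow> \<exists>k\<in>Zc. a + p = p + (a + k)" and inv: "a + q = q + (a + a)"
  shows "coef q e = 0"
proof -
  let ?A = "(\<lambda>p. p + q) ` P"
  have "coef q e = (\<Sum>x\<in>?A. Poly_Mapping.lookup e x)"
    unfolding coef_def by (subst sum.reindex) (auto intro: inj_onI)
  also have "\<dots> = 0"
  proof (rule fixpoint_free_order3_sum[where \<sigma>="\<lambda>x. a + x - a"])
    show "finite ?A" using finite_P by simp
    show "(3 :: 'k) = 0" by (rule char3)
    fix x assume "x \<in> ?A"
    then obtain p where p: "p \<in> P" "x = p + q" by blast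
    have "a + p + (q - a - q) \<in> P"
      using normal_P[OF P_minus[OF a(1)], of "- q"] by (simp add: P_add a(1) p(1))
    moreover have "a + x - a = (a + p + (q - a - q)) + q"
      by (simp add: p(2) add_diff_eq flip: add.assoc)
    ultimately show "a + x - a \<in> ?A" by blast
    have "a + (a + (a + x - a) - a) - a = a + (a + a) + x - (a + (a + a))"
      by (simp add: add_diff_eq diff_add_eq_diff_diff_swap flip: add.assoc)
    then show "a + (a + (a + x - a) - a) - a = x" by (simp add: a(2))
    show "Poly_Mapping.lookup e (a + x - a) = Poly_Mapping.lookup e x"
    proof -
      have "Poly_Mapping.lookup (el a * e) (a + x) = Poly_Mapping.lookup e x"
        by (rule lookup_el_mult_left)
      moreover have "Poly_Mapping.lookup (e * el a) ((a + x - a) + a) = Poly_Mapping.lookup e (a + x - a)"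
        by (rule lookup_el_mult_right)
      moreover have "e * el a = el a * e" using e by (simp add: ring_center_def)
      ultimately show ?thesis by simp
    qed
    show "a + x - a \<noteq> x"
    proof
      assume "a + x - a = x"
      then have fix_x: "a + (p + q) = p + q + a" by (simp add: p(2) diff_eq_eq)
      obtain k where k: "k \<in> Zc" "a + p = p + (a + k)" using shift[OF p(1)] by blast
      obtain k' where k': "k' \<in> Zc" "k + q = q + k'" using Zc_shift[OF q k(1)] by blast
      \<comment> \<open>A fixed point would give a = a + a + k' with \<open>k'\<close> in
        \<open>Zc\<close>, hence \<open>a\<close> in \<open>Zc\<close>.\<close>
      have "p + (q + a) = a + p + q" using fix_x by (simp add: add.assoc)
      also have "\<dots> = p + (a + (k + q))" unfolding k(2) by (simp add: add.assoc)
      also have "\<dots> = p + (a + q + k')" by (simp add: k'(2) add.assoc)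
      also have "\<dots> = p + (q + (a + (a + k')))" by (simp add: inv add.assoc)
      finally have "a = a + (a + k')" by simp
      then have "a + k' = 0" by (metis add_0_right add_left_cancel)
      then have "a = - k'" by (simp add: eq_neg_iff_add_eq_0)
      then show False using a(3) Zc_minus[OF k'(1)] by simp
    qed
  qed
  finally show ?thesis .
qed

text \<open>Every element of \<open>H\<close> other than 1 and s^2 inverts \<open>g\<close> or
  \<open>h\<close>: s and s^3 invert \<open>g\<close>, t and s^2 t invert \<open>h\<close>, and the
  remaining two invert both. So \<open>coef_central_0\<close> applies to one of these.\<close>

lemma coef_central_eq_0:
  assumes e: "e \<in> ring_center" and q: "q \<in> H - {0, s + s}"
  shows "coef q e = 0"
proof -
  have assoc: "s + (g + a) = g + (g + (s + a))" "s + (h + a) = h + (s + a)"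
    "t + (g + a) = g + (t + a)" "t + (h + a) = h + (h + (t + a))"
    "g + (g + (g + a)) = a" "h + (h + (h + a)) = a" for a
    using s_g s_h t_g t_h order_g order_h by (simp_all flip: add.assoc)
  note nf = add.assoc s_g s_h t_g t_h order_g order_h assoc
  have "g + q = q + (g + g) \<or> h + q = q + (h + h)"
    using q unfolding H_elements list.set by (auto simp: nf)
  then show ?thesis
    using q coef_central_0[OF e _ gens(1) order_g g_notin_Zc g_shift]
      coef_central_0[OF e _ gens(2) order_h h_notin_Zc h_shift] by blast
qed

lemma s2: "0 \<noteq> s + s" "s + s \<in> H"
  using H_distinct by (simp_all add: gens H_add)

lemma central_cong:
  assumes e: "e \<in> ring_center"
  shows "e - (scal (coef 0 e) + scal (coef (s + s) e) * (S * S)) \<in> J"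
proof -
  have "(\<Sum>q\<in>H. scal (coef q e) * el q) = (\<Sum>q\<in>{0, s + s}. scal (coef q e) * el q)"
    using coef_central_eq_0[OF e] s2 H_0
    by (intro sum.mono_neutral_right) (auto simp: finite_H)
  also have "\<dots> = scal (coef 0 e) + scal (coef (s + s) e) * (S * S)"
    using s2 by (simp add: el_0 el_add)
  finally show ?thesis using coef_cong[of e] by simp
qed

lemma augmentation_central:
  assumes e: "e \<in> ring_center"
  shows "augmentation e = coef 0 e + coef (s + s) e"
proof -
  have "augmentation e = (\<Sum>q\<in>{0, s + s}. coef q e)"
    unfolding augmentation_eq using coef_central_eq_0[OF e] s2 H_0
    by (intro sum.mono_neutral_right) (auto simp: finite_H)
  then show ?thesis using s2 by simp
qed

section \<open>Identification of the non-principal block\<close>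

text \<open>In characteristic 3 this is \<open>(1 - s\<^sup>2) / 2\<close>.\<close>
definition E :: "'g \<Rightarrow>\<^sub>0 'k" where
  "E = S * S - 1"

lemma S4: "S * (S * (S * S)) = 1" and TT: "T * T = S * S" and TS: "T * S = S * (S * (S * T))"
  by (simp_all add: order_s tt ts el_0 flip: el_add)

lemma S4_assoc: "S * (S * (S * (S * a))) = a" and TT_assoc: "T * (T * a) = S * (S * a)"
  and TS_assoc: "T * (S * a) = S * (S * (S * (T * a)))"
  using S4 TT TS by (simp_all flip: mult.assoc)

lemma E_commute: "a * E = E * a"
proof (induction a rule: group_algebra_induct)
  case (mult a b)
  then show ?case by (metis mult.assoc)
next
  case t
  show ?case by (simp add: E_def algebra_simps TS TS_assoc S4_assoc)
qed (simp_all add: E_def algebra_simps act_rules act_rules_assoc comm scal_commute)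

lemma E_idempotent: "E * E = E" and SSE: "S * (S * E) = - E"
proof -
  have "S * (S * E) = - E"
    by (simp add: E_def algebra_simps S4)
  then show "S * (S * E) = - E" .
  have "E * E = S * (S * E) - E"
    by (simp add: E_def algebra_simps)
  also have "\<dots> = - (E + E)" using \<open>S * (S * E) = - E\<close> by simp
  also have "\<dots> = E" by (simp flip: minus_double(1))
  finally show "E * E = E" .
qed

lemma E_nonzero: "E \<noteq> 0"
proof
  assume "E = 0"
  then have "el (s + s) = el 0" by (simp add: E_def el_add el_0)
  then show False using s2 by (simp add: el_inject)
qed

lemma E_notin_J: "E \<notin> J"
  using idempotent_J[OF E_idempotent] E_nonzero by blast

lemma ring_center_mult: "a \<in> ring_center \<Longrightarrow> b \<in> ring_center \<Longrightarrow> a * b \<in> ring_center"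
proof -
  assume "a \<in> ring_center" "b \<in> ring_center"
  then have a: "\<And>r. a * r = r * a" and b: "\<And>r. b * r = r * b" by (auto simp: ring_center_def)
  have "a * b * r = r * (a * b)" for r
  proof -
    have "a * b * r = a * r * b" by (simp only: mult.assoc b[of r])
    then show ?thesis by (simp only: a[of r] mult.assoc)
  qed
  then show ?thesis by (simp add: ring_center_def)
qed

lemma ring_center_diff: "a \<in> ring_center \<Longrightarrow> b \<in> ring_center \<Longrightarrow> a - b \<in> ring_center"
  unfolding ring_center_def by (simp add: algebra_simps)

text \<open>Primitivity kills e E or e - e E. In the first case \<open>e\<close> is congruent to a
  multiple of 1 - E whose factor is its augmentation 0, so \<open>e\<close> is an idempotent in
  \<open>J\<close> and vanishes. In the second, \<open>e\<close> is congruent to l E with l^2 = l; l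
  = 0 is excluded in the same way, and for l = 1 the idempotent E - e lies in
  \<open>J\<close>.\<close>

lemma nonprincipal_block_eq:
  assumes e: "is_block e" "\<not> is_principal_block e"
  shows "e = E"
proof -
  note J = two_sided_ideal_J
  have aug: "augmentation e = 0" using e by (simp add: is_principal_block_def)
  have cen: "e \<in> ring_center" and ee: "e * e = e" and e0: "e \<noteq> 0"
    and prim: "\<And>a b. a \<in> ring_center \<Longrightarrow> b \<in> ring_center \<Longrightarrow> a * a = a \<Longrightarrow> b * b = b \<Longrightarrow>
      a * b = 0 \<Longrightarrow> b * a = 0 \<Longrightarrow> e = a + b \<Longrightarrow> a = 0 \<or> b = 0"
    using e(1) unfolding is_block_def primitive_idempotent_def by blast+
  have e_commute: "e * a = a * e" for a using cen by (simp add: ring_center_def)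
  have eE: "e * E = E * e" by (rule E_commute)
  have eEe: "e * (E * a) = E * (e * a)" "e * (e * a) = e * a" "E * (E * a) = E * a" for a
    using eE ee E_idempotent by (simp_all flip: mult.assoc)
  have E_center: "E \<in> ring_center" by (simp add: ring_center_def E_commute)
  let ?\<alpha> = "coef 0 e" and ?\<beta> = "coef (s + s) e"
  have cong: "e - (scal ?\<alpha> + scal ?\<beta> * (S * S)) \<in> J"
    using cen by (rule central_cong)
  have "e * E = 0 \<or> e - e * E = 0"
  proof (rule prim)
    show "e * E \<in> ring_center" "e - e * E \<in> ring_center"
      using cen E_center by (auto intro: ring_center_mult ring_center_diff)
    show "e * E * (e * E) = e * E" "(e - e * E) * (e - e * E) = e - e * E"
      "e * E * (e - e * E) = 0" "(e - e * E) * (e * E) = 0" "e = e * E + (e - e * E)"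
      by (simp_all add: algebra_simps eEe ee eE E_idempotent)
  qed
  then show ?thesis
  proof
    assume eE: "e * E = 0"
    have "S * S = 1 + E" by (simp add: E_def)
    then have "(e - (scal ?\<alpha> + scal ?\<beta> * (S * S))) * (1 - E) = e - scal (?\<alpha> + ?\<beta>) * (1 - E)"
      by (simp add: algebra_simps eE E_idempotent single_add)
    then have "e \<in> J"
      using ideal_mult_right[OF J cong, of "1 - E"] aug augmentation_central[OF cen] by simp
    then show "e = E" using idempotent_J[OF ee] e0 by blast
  next
    assume eE: "e - e * E = 0"
    then have Ee: "e * E = e" "E * e = e" using E_commute[of e] by auto
    define l where "l = ?\<alpha> - ?\<beta>"
    have "(e - (scal ?\<alpha> + scal ?\<beta> * (S * S))) * E = e * E - (scal ?\<alpha> * E + scal ?\<beta> * (S * (S * E)))"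
      by (simp add: algebra_simps)
    also have "\<dots> = e - scal l * E"
      using eE by (simp add: SSE l_def single_diff algebra_simps)
    finally have l: "e - scal l * E \<in> J"
      using ideal_mult_right[OF J cong, of E] by simp
    have "scal l * E * (scal l * E) = scal l * (E * scal l) * E" by (simp only: mult.assoc)
    also have "\<dots> = scal l * scal l * (E * E)" by (simp only: scal_commute[of l E, symmetric] mult.assoc)
    finally have "scal l * E * (scal l * E) = scal (l * l) * E"
      by (simp only: scal_mult E_idempotent)
    then have "e - scal (l * l) * E \<in> J"
      using ideal_mult_cong[OF J l l] by (simp only: ee)
    from ideal_diff[OF J l this] have d: "scal (l * l - l) * E \<in> J"
      by (simp add: single_diff algebra_simps)
    have "l * l - l = 0"
    proof (rule ccontr)
      assume n: "l * l - l \<noteq> 0"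
      have "scal (inverse (l * l - l)) * (scal (l * l - l) * E) \<in> J"
        using d by (rule ideal_mult_left[OF J])
      then have "scal (inverse (l * l - l) * (l * l - l)) * E \<in> J"
        unfolding scal_mult mult.assoc .
      then have "E \<in> J" unfolding left_inverse[OF n] by simp
      then show False using E_notin_J by blast
    qed
    then have "l * (l - 1) = 0" by (simp add: algebra_simps)
    then have "l = 0 \<or> l = 1" by simp
    then show "e = E"
    proof
      assume "l = 0"
      then have "e \<in> J" using l by simp
      then show ?thesis using idempotent_J[OF ee] e0 by blast
    next
      assume "l = 1"
      then have "E - e \<in> J" using ideal_diff_commute[OF J l] by simp
      moreover have "(E - e) * (E - e) = E - e"
        using Ee by (simp add: algebra_simps E_idempotent ee)
      ultimately show ?thesis using idempotent_J by fastforce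
    qed
  qed
qed

end

subsection \<open>The quaternion algebra and the primitive idempotents of the block\<close>

lemma geometric_sum_ring: "(1 - n) * (\<Sum>i<k. n ^ i) = (1 - n ^ k :: 'r::ring_1)"
proof (induction k)
  case (Suc k)
  have "(1 - n) * (\<Sum>i<Suc k. n ^ i) = (1 - n) * (\<Sum>i<k. n ^ i) + (1 - n) * n ^ k"
    by (simp add: distrib_left)
  then show ?case unfolding Suc by (simp add: left_diff_distrib)
qed simp

context quaternion_action
begin

text \<open>On the block s^2 acts as -1, so these are the quaternion units i, j, k with
  \<open>E\<close> as identity.\<close>

definition qi :: "'g \<Rightarrow>\<^sub>0 'k" where "qi = E * S"
definition qj :: "'g \<Rightarrow>\<^sub>0 'k" where "qj = E * T"
definition qk :: "'g \<Rightarrow>\<^sub>0 'k" where "qk = E * (S * T)"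

lemma E_left: "S * E = E * S" "T * E = E * T" "S * (E * a) = E * (S * a)" "T * (E * a) = E * (T * a)"
  "E * (E * a) = E * a"
  using E_commute[of S] E_commute[of T] E_idempotent by (simp_all flip: mult.assoc)

lemma E_SS: "E * (S * S) = - E" "E * (S * (S * a)) = - (E * a)"
proof -
  show "E * (S * S) = - E" using SSE by (simp add: E_left)
  then have "E * (S * S) * a = - E * a" by simp
  then show "E * (S * (S * a)) = - (E * a)" by (simp add: mult.assoc)
qed

lemmas E_normal = E_left E_idempotent E_SS TS TS_assoc TT TT_assoc mult.assoc

lemma quaternion_table:
  "E * qi = qi" "qi * E = qi" "E * qj = qj" "qj * E = qj" "E * qk = qk" "qk * E = qk"
  "qi * qi = - E" "qj * qj = - E" "qk * qk = - E"
  "qi * qj = qk" "qj * qi = - qk" "qj * qk = qi" "qk * qj = - qi" "qk * qi = qj" "qi * qk = - qj"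
  by (simp_all add: qi_def qj_def qk_def E_normal)

lemma quaternion_table_assoc:
  "E * (qi * a) = qi * a" "qi * (E * a) = qi * a" "E * (qj * a) = qj * a" "qj * (E * a) = qj * a"
  "E * (qk * a) = qk * a" "qk * (E * a) = qk * a"
  "qi * (qi * a) = - (E * a)" "qj * (qj * a) = - (E * a)" "qk * (qk * a) = - (E * a)"
  "qi * (qj * a) = qk * a" "qj * (qi * a) = - (qk * a)" "qj * (qk * a) = qi * a"
  "qk * (qj * a) = - (qi * a)" "qk * (qi * a) = qj * a" "qi * (qk * a) = - (qj * a)"
  by (simp_all add: quaternion_table flip: mult.assoc)

definition quat :: "'k \<Rightarrow> 'k \<Rightarrow> 'k \<Rightarrow> 'k \<Rightarrow> ('g \<Rightarrow>\<^sub>0 'k)" where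
  "quat \<alpha> \<beta> \<gamma> \<delta> = scal \<alpha> * E + scal \<beta> * qi + scal \<gamma> * qj + scal \<delta> * qk"

lemma S_quat: "S * quat \<alpha> \<beta> \<gamma> \<delta> = quat (- \<beta>) \<alpha> (- \<delta>) \<gamma>"
  and T_quat: "T * quat \<alpha> \<beta> \<gamma> \<delta> = quat (- \<gamma>) \<delta> \<alpha> (- \<beta>)"
proof -
  have "S * E = qi" "S * qi = - E" "S * qj = qk" "S * qk = - qj"
    "T * E = qj" "T * qi = - qk" "T * qj = - E" "T * qk = qi"
    by (simp_all add: qi_def qj_def qk_def E_normal)
  then show "S * quat \<alpha> \<beta> \<gamma> \<delta> = quat (- \<beta>) \<alpha> (- \<delta>) \<gamma>"
    "T * quat \<alpha> \<beta> \<gamma> \<delta> = quat (- \<gamma>) \<delta> \<alpha> (- \<beta>)"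
    by (simp_all add: quat_def distrib_left scal_left_commute[of S] scal_left_commute[of T] single_uminus)
qed

lemma quat_add: "quat \<alpha> \<beta> \<gamma> \<delta> + quat \<alpha>' \<beta>' \<gamma>' \<delta>' = quat (\<alpha> + \<alpha>') (\<beta> + \<beta>') (\<gamma> + \<gamma>') (\<delta> + \<delta>')"
  by (simp add: quat_def single_add algebra_simps)

lemma quat_scal: "scal l * quat \<alpha> \<beta> \<gamma> \<delta> = quat (l * \<alpha>) (l * \<beta>) (l * \<gamma>) (l * \<delta>)"
  unfolding quat_def scal_mult by (simp only: distrib_left mult.assoc)

definition quats :: "('g \<Rightarrow>\<^sub>0 'k) set" where
  "quats = {quat \<alpha> \<beta> \<gamma> \<delta> | \<alpha> \<beta> \<gamma> \<delta>. True}"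

text \<open>Modulo \<open>J\<close> the generators \<open>G\<close> and \<open>Hh\<close> act as 1,
  while \<open>S\<close> and \<open>T\<close> permute the quaternion units up to sign. Applied to
  \<open>E\<close> this shows that the block is the quaternion algebra plus elements of
  \<open>J\<close>.\<close>

lemma mult_quats_cong: "\<forall>q\<in>quats. \<exists>q'\<in>quats. a * q - q' \<in> J"
proof (induction a rule: group_algebra_induct)
  case (const l)
  show ?case
  proof
    fix q assume "q \<in> quats"
    then have "scal l * q \<in> quats" unfolding quats_def using quat_scal by blast
    then show "\<exists>q'\<in>quats. scal l * q - q' \<in> J"
      using ideal_0[OF two_sided_ideal_J] by (intro bexI[of _ "scal l * q"]) simp_all
  qed
next
  case (add a b)
  show ?case
  proof
    fix q assume "q \<in> quats"
    with add obtain q1 q2 where q: "q1 \<in> quats" "q2 \<in> quats" "a * q - q1 \<in> J" "b * q - q2 \<in> J" by blast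
    have "q1 + q2 \<in> quats" using q(1,2) unfolding quats_def using quat_add by blast
    moreover have "(a + b) * q - (q1 + q2) \<in> J"
      using ideal_add[OF two_sided_ideal_J q(3,4)] by (simp add: algebra_simps)
    ultimately show "\<exists>q'\<in>quats. (a + b) * q - q' \<in> J" by blast
  qed
next
  case (mult a b)
  show ?case
  proof
    fix q assume "q \<in> quats"
    with mult(2) obtain q1 where q1: "q1 \<in> quats" "b * q - q1 \<in> J" by blast
    with mult(1) obtain q2 where q2: "q2 \<in> quats" "a * q1 - q2 \<in> J" by blast
    have "a * (b * q - q1) + (a * q1 - q2) \<in> J"
      using q1 q2 by (intro ideal_add[OF two_sided_ideal_J] ideal_mult_left[OF two_sided_ideal_J])
    then have "a * b * q - q2 \<in> J" by (simp add: algebra_simps)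
    then show "\<exists>q'\<in>quats. a * b * q - q' \<in> J" using q2(1) by blast
  qed
next
  case g
  have "G * q - q \<in> J" for q
    using ideal_mult_right[OF two_sided_ideal_J G_minus_1_J, of q] by (simp add: algebra_simps)
  then show ?case by blast
next
  case h
  have "Hh * q - q \<in> J" for q
    using ideal_mult_right[OF two_sided_ideal_J H_minus_1_J, of q] by (simp add: algebra_simps)
  then show ?case by blast
next
  case s
  have "S * q \<in> quats" if "q \<in> quats" for q
    using that unfolding quats_def using S_quat by blast
  moreover have "S * q - S * q \<in> J" for q using ideal_0[OF two_sided_ideal_J] by simp
  ultimately show ?case by blast
next
  case t
  have "T * q \<in> quats" if "q \<in> quats" for q
    using that unfolding quats_def using T_quat by blast
  moreover have "T * q - T * q \<in> J" for q using ideal_0[OF two_sided_ideal_J] by simp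
  ultimately show ?case by blast
qed

lemma quat_cong:
  obtains \<alpha> \<beta> \<gamma> \<delta> where "a * E - quat \<alpha> \<beta> \<gamma> \<delta> \<in> J"
proof -
  have "E = quat 1 0 0 0" by (simp add: quat_def)
  then have "E \<in> quats" unfolding quats_def by blast
  then show ?thesis using mult_quats_cong[of a] that unfolding quats_def by blast
qed

text \<open>The sum of u a u^-1 over the units E, i, j, k, where i, j, k have inverse -i, -j, -k. On
  a quaternion it gives four times the scalar part, which is the scalar part in characteristic
  3.\<close>

definition trace :: "('g \<Rightarrow>\<^sub>0 'k) \<Rightarrow> ('g \<Rightarrow>\<^sub>0 'k)" where
  "trace a = E * a * E - qi * a * qi - qj * a * qj - qk * a * qk"

lemma trace_quat: "trace (quat \<alpha> \<beta> \<gamma> \<delta>) = scal \<alpha> * E"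
proof -
  note comm = scal_left_commute[of E] scal_left_commute[of qi] scal_left_commute[of qj] scal_left_commute[of qk]
  have "trace (quat \<alpha> \<beta> \<gamma> \<delta>) = scal \<alpha> * E + (scal \<alpha> * E + scal \<alpha> * E + scal \<alpha> * E)"
    by (simp add: trace_def quat_def distrib_left distrib_right left_diff_distrib
        right_diff_distrib mult.assoc comm quaternion_table quaternion_table_assoc E_idempotent E_left)
  then show ?thesis by (simp add: char3_triple[OF char3_group_algebra])
qed

lemma trace_cong: "a - b \<in> J \<Longrightarrow> trace a - trace b \<in> J"
proof -
  note J = two_sided_ideal_J
  assume ab: "a - b \<in> J"
  have "E * (a - b) * E - qi * (a - b) * qi - qj * (a - b) * qj - qk * (a - b) * qk \<in> J"
    by (intro ideal_diff[OF J] ideal_mult_left[OF J] ideal_mult_right[OF J] ab)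
  then show ?thesis by (simp add: trace_def algebra_simps)
qed

text \<open>An element of trace 1 and norm 0 of the quaternion algebra, since \<open>1 / 2 = - 1\<close>.\<close>
definition F :: "'g \<Rightarrow>\<^sub>0 'k" where
  "F = qi + qj - E"

lemma F_E: "F * E = F" "E * F = F" "F * (E * a) = F * a" "E * (F * a) = F * a"
proof -
  show 1: "F * E = F" "E * F = F"
    by (simp_all add: F_def algebra_simps quaternion_table E_idempotent)
  show "F * (E * a) = F * a" "E * (F * a) = F * a" by (simp_all add: 1 flip: mult.assoc)
qed

text \<open>\<open>F\<close> is an idempotent of rank one in a split quaternion algebra, so its
  corner there is one-dimensional; these are the resulting coefficients.\<close>

lemma F_q_F: "F * F = F" "F * (qi * F) = F" "F * (qj * F) = F" "F * (qk * F) = 0"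
proof -
  have triple: "a + (a + (a + b)) = b" for a b :: "'g \<Rightarrow>\<^sub>0 'k"
    using char3_triple[OF char3_group_algebra, of a] by (simp flip: add.assoc)
  note nf = mult.assoc distrib_left distrib_right minus_double triple quaternion_table
    quaternion_table_assoc E_idempotent
    add.assoc add.left_commute add.commute add_0_left add_0_right mult_minus_left mult_minus_right
  show "F * F = F" "F * (qi * F) = F" "F * (qj * F) = F" "F * (qk * F) = 0"
    by (simp_all only: F_def nf heisenberg_ring.triple[OF heisenberg_ring_axioms])
qed

lemma FF_assoc: "F * (F * a) = F * a"
  by (simp add: F_q_F flip: mult.assoc)

lemma trace_F: "trace F = - E"
proof -
  have "F = quat (- 1) 1 1 0" by (simp add: F_def quat_def single_uminus)
  then show ?thesis by (simp add: trace_quat single_uminus)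
qed

lemma F_notin_J: "F \<notin> J"
proof
  assume "F \<in> J"
  then have "F = 0" using idempotent_J F_q_F by blast
  then show False using trace_F E_nonzero by (simp add: trace_def)
qed

lemma scal_J_cancel:
  assumes "scal l * a \<in> J" "l \<noteq> 0"
  shows "a \<in> J"
proof -
  have "scal (inverse l) * (scal l * a) \<in> J"
    using assms(1) by (rule ideal_mult_left[OF two_sided_ideal_J])
  then have "scal (inverse l * l) * a \<in> J" unfolding scal_mult mult.assoc .
  then show ?thesis unfolding left_inverse[OF assms(2)] by simp
qed

lemma F_x_F: obtains \<mu> where "F * x * F - scal \<mu> * F \<in> J"
proof -
  note J = two_sided_ideal_J
  obtain \<alpha> \<beta> \<gamma> \<delta> where q: "x * E - quat \<alpha> \<beta> \<gamma> \<delta> \<in> J" by (rule quat_cong)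
  have "F * (x * E - quat \<alpha> \<beta> \<gamma> \<delta>) * F \<in> J"
    by (intro ideal_mult_left[OF J] ideal_mult_right[OF J] q)
  moreover have "F * quat \<alpha> \<beta> \<gamma> \<delta> * F = scal (\<alpha> + \<beta> + \<gamma>) * F"
    by (simp add: quat_def distrib_left distrib_right mult.assoc scal_left_commute[of F] F_q_F F_E single_add)
  ultimately have "F * x * F - scal (\<alpha> + \<beta> + \<gamma>) * F \<in> J"
    by (simp add: left_diff_distrib right_diff_distrib mult.assoc F_E)
  then show ?thesis by (rule that)
qed

text \<open>Some quaternion coefficient of \<open>a\<close> is nonzero modulo \<open>J\<close>.
  Multiplying by 1, \<open>S\<close>, \<open>T\<close> or \<open>S * T\<close> moves it, up to sign,
  to the scalar position, where \<open>trace\<close> reads it off.\<close>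

lemma exists_trace_nonzero:
  assumes "a * E \<notin> J"
  obtains v \<rho> where "\<rho> \<noteq> 0" "trace (v * a) - scal \<rho> * E \<in> J"
proof -
  note J = two_sided_ideal_J
  obtain \<alpha> \<beta> \<gamma> \<delta> where q: "a * E - quat \<alpha> \<beta> \<gamma> \<delta> \<in> J" by (rule quat_cong)
  have "quat 0 0 0 0 = 0" by (simp add: quat_def)
  then have nz: "\<alpha> \<noteq> 0 \<or> \<beta> \<noteq> 0 \<or> \<gamma> \<noteq> 0 \<or> \<delta> \<noteq> 0" using q assms by auto
  have tr_E: "trace (v * (a * E)) = trace (v * a)" for v
    by (simp add: trace_def mult.assoc E_idempotent quaternion_table)
  have tr: "trace (v * a) - trace (v * quat \<alpha> \<beta> \<gamma> \<delta>) \<in> J" for v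
  proof -
    have "v * (a * E - quat \<alpha> \<beta> \<gamma> \<delta>) \<in> J" using q by (rule ideal_mult_left[OF J])
    then show ?thesis using trace_cong[of "v * (a * E)" "v * quat \<alpha> \<beta> \<gamma> \<delta>"] tr_E
      by (simp add: right_diff_distrib)
  qed
  consider "\<alpha> \<noteq> 0" | "\<beta> \<noteq> 0" | "\<gamma> \<noteq> 0" | "\<delta> \<noteq> 0" using nz by blast
  then show ?thesis
  proof cases
    case 1
    then show ?thesis using that[of \<alpha> 1] tr[of 1] by (simp add: trace_quat)
  next
    case 2
    then show ?thesis using that[of "- \<beta>" S] tr[of S] by (simp add: S_quat trace_quat)
  next
    case 3
    then show ?thesis using that[of "- \<gamma>" T] tr[of T] by (simp add: T_quat trace_quat)
  next
    case 4
    then show ?thesis using that[of "- \<delta>" "S * T"] tr[of "S * T"]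
      by (simp add: T_quat S_quat trace_quat mult.assoc)
  qed
qed

text \<open>
  Modulo \<open>J\<close> the algebra \<open>k G e\<close> is a quaternion algebra, hence simple: averaging over the quaternion
  units turns \<open>v a\<close> into a nonzero scalar, so one of the summands survives between two copies of \<open>F\<close>.
\<close>
lemma F_in_ideal:
  assumes "a * E \<notin> J"
  obtains b b' where "F * b * a * b' * F - F \<in> J"
proof -
  note J = two_sided_ideal_J
  obtain v \<rho> where \<rho>: "\<rho> \<noteq> 0" "trace (v * a) - scal \<rho> * E \<in> J"
    using assms by (rule exists_trace_nonzero)
  have sum: "F * (E * (v * a) * E) * F - F * (qi * (v * a) * qi) * F - F * (qj * (v * a) * qj) * F
      - F * (qk * (v * a) * qk) * F - scal \<rho> * F \<in> J"
  proof -
    have "F * (trace (v * a) - scal \<rho> * E) * F \<in> J"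
      by (intro ideal_mult_left[OF J] ideal_mult_right[OF J] \<rho>)
    moreover have "F * (scal \<rho> * E) * F = scal \<rho> * F"
      by (simp add: scal_left_commute[of F] mult.assoc F_E F_q_F)
    ultimately show ?thesis
      by (simp only: trace_def left_diff_distrib right_diff_distrib)
  qed
  define t where "t = (\<lambda>u. F * (u * (v * a) * u) * F)"
  have sum: "t E - t qi - t qj - t qk - scal \<rho> * F \<in> J" using sum by (simp only: t_def)
  have "\<exists>u. t u \<notin> J"
  proof (rule ccontr)
    assume "\<not> ?thesis"
    then have t: "t u \<in> J" for u by blast
    have "(t E - t qi - t qj - t qk) - (t E - t qi - t qj - t qk - scal \<rho> * F) \<in> J"
      by (intro ideal_diff[OF J] t sum)
    then have "scal \<rho> * F \<in> J" by simp
    then show False using scal_J_cancel \<rho>(1) F_notin_J by blast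
  qed
  then obtain u where u: "F * (u * (v * a) * u) * F \<notin> J" unfolding t_def by blast
  obtain \<mu> where \<mu>: "F * (u * (v * a) * u) * F - scal \<mu> * F \<in> J" by (rule F_x_F)
  then have "\<mu> \<noteq> 0" using u by auto
  have "scal (inverse \<mu>) * (F * (u * (v * a) * u) * F - scal \<mu> * F) \<in> J"
    using \<mu> by (rule ideal_mult_left[OF J])
  moreover have "scal (inverse \<mu>) * (scal \<mu> * F) = F"
  proof -
    have "scal (inverse \<mu>) * (scal \<mu> * F) = scal (inverse \<mu> * \<mu>) * F"
      by (simp only: scal_mult mult.assoc)
    then show ?thesis using \<open>\<mu> \<noteq> 0\<close> by simp
  qed
  moreover have "scal (inverse \<mu>) * (F * (u * (v * a) * u) * F) = F * (scal (inverse \<mu>) * (u * v)) * a * u * F"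
    by (simp only: scal_left_commute[of F] mult.assoc)
  ultimately have "F * (scal (inverse \<mu>) * (u * v)) * a * u * F - F \<in> J"
    by (simp only: right_diff_distrib)
  then show ?thesis by (rule that)
qed

section \<open>Primitive idempotents of the block\<close>

lemma block_algebra_iff: "a \<in> block_algebra E \<longleftrightarrow> a * E = a"
proof
  show "a \<in> block_algebra E \<Longrightarrow> a * E = a"
    by (auto simp: block_algebra_def mult.assoc E_idempotent)
  assume "a * E = a"
  then show "a \<in> block_algebra E"
    unfolding block_algebra_def by (intro range_eqI[of _ _ a]) simp
qed

text \<open>\<open>F_in_ideal\<close> factors \<open>F\<close> through \<open>f\<close> up to an
  error \<open>n\<close> in \<open>J\<close>. As \<open>n\<close> is nilpotent, 1 - n can be
  inverted and the right factor corrected, which gives u w = F exactly. Then w u is a nonzero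
  idempotent below \<open>f\<close>, hence equal to \<open>f\<close> by primitivity.\<close>

lemma primitive_equivalent_F:
  assumes f: "primitive_idempotent (block_algebra E) f"
  obtains u w where "F * u = u" "u * f = u" "f * w = w" "w * F = w" "u * w = F" "w * u = f"
proof -
  note J = two_sided_ideal_J
  have fE: "f * E = f" and ff: "f * f = f" and f0: "f \<noteq> 0"
    using f by (simp_all add: primitive_idempotent_def block_algebra_iff)
  have prim: "a = 0 \<or> b = 0" if "a * E = a" "b * E = b" "a * a = a" "b * b = b"
      "a * b = 0" "b * a = 0" "f = a + b" for a b
    using f that(1,2) unfolding primitive_idempotent_def block_algebra_iff[symmetric]
    by (elim conjE) (drule bspec[where x=a], assumption, drule bspec[where x=b], assumption, simp add: that(3-))
  have "f * E \<notin> J" using idempotent_J[OF ff] f0 fE by auto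
  then obtain b b' where b: "F * b * f * b' * F - F \<in> J" by (rule F_in_ideal)
  have ff_assoc: "f * (f * a) = f * a" for a by (simp add: ff flip: mult.assoc)
  define n where "n = F - F * b * f * b' * F"
  have n: "n \<in> J" using ideal_minus[OF J b] by (simp add: n_def)
  have nF: "n * F = n" "F * n = n"
    by (simp_all add: n_def left_diff_distrib right_diff_distrib mult.assoc F_q_F FF_assoc)
  \<comment> \<open>The geometric series for the inverse of 1 - n breaks off after 27 terms by
    \<open>J_nil\<close>.\<close>
  define m where "m = (\<Sum>i<27. n ^ i)"
  have m: "(1 - n) * m = 1"
    unfolding m_def geometric_sum_ring J_nil[OF n] by simp
  define u where "u = F * b * f"
  define w where "w = f * b' * F * m * F"
  have Fu: "F * u = u" "u * f = u" and fw: "f * w = w" "w * F = w"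
    by (simp_all add: u_def w_def ff F_q_F mult.assoc ff_assoc FF_assoc)
  have "u * w = (F * b * f * b' * F) * m * F"
    by (simp add: u_def w_def mult.assoc ff_assoc)
  also have "F * b * f * b' * F = F * (1 - n)"
    by (simp add: right_diff_distrib nF) (simp add: n_def)
  also have "F * (1 - n) * m * F = F * ((1 - n) * m) * F" by (simp only: mult.assoc)
  also have "\<dots> = F" by (simp add: m F_q_F)
  finally have uw: "u * w = F" .
  have idem: "w * u * (w * u) = w * u"
  proof -
    have "w * u * (w * u) = w * (u * w) * u" by (simp only: mult.assoc)
    then show ?thesis by (simp only: uw fw)
  qed
  have wuf: "w * u * f = w * u" "f * (w * u) = w * u"
    by (simp_all add: mult.assoc Fu) (simp add: fw(1) flip: mult.assoc)
  have "w * u = 0 \<or> f - w * u = 0"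
  proof (rule prim)
    have "w * u * f * E = w * u * f" by (simp only: mult.assoc fE)
    then show "w * u * E = w * u" by (simp only: wuf)
    then show "(f - w * u) * E = f - w * u" by (simp add: left_diff_distrib fE)
    show "w * u * (w * u) = w * u" by (rule idem)
    show "(f - w * u) * (f - w * u) = f - w * u" "w * u * (f - w * u) = 0" "(f - w * u) * (w * u) = 0"
      by (simp_all only: left_diff_distrib right_diff_distrib ff idem wuf) simp_all
  qed simp
  moreover have "w * u \<noteq> 0"
  proof
    assume "w * u = 0"
    then have "u * (w * u) * w = 0" by simp
    moreover have "u * (w * u) * w = (u * w) * (u * w)" by (simp only: mult.assoc)
    ultimately have "F * F = 0" by (simp only: uw)
    then show False using F_q_F F_notin_J ideal_0[OF J] by simp
  qed
  ultimately have "w * u = f" by simp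
  then show ?thesis using that Fu fw uw by blast
qed

text \<open>Both idempotents are equivalent to \<open>F\<close>; composing the two equivalences
  gives \<open>x\<close> and \<open>y\<close> with x y = i and y x = j, and right multiplication by
  them is a pair of inverse module maps.\<close>

lemma primitive_isomorphic:
  assumes i: "primitive_idempotent (block_algebra E) i" and j: "primitive_idempotent (block_algebra E) j"
  shows "isomorphic_projectives (block_algebra E) i j"
proof -
  let ?A = "block_algebra E"
  obtain u w where u: "F * u = u" "u * i = u" "i * w = w" "w * F = w" "u * w = F" "w * u = i"
    using i by (rule primitive_equivalent_F)
  obtain u' w' where u': "F * u' = u'" "u' * j = u'" "j * w' = w'" "w' * F = w'" "u' * w' = F" "w' * u' = j"
    using j by (rule primitive_equivalent_F)
  have iE: "i * E = i" and ii: "i * i = i" and jE: "j * E = j" and jj: "j * j = j"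
    using i j by (simp_all add: primitive_idempotent_def block_algebra_iff)
  define x where "x = w * u'"
  define y where "y = w' * u"
  have xj: "x * j = x" and yi: "y * i = y" by (simp_all add: x_def y_def mult.assoc u u')
  have xy: "x * y = i"
  proof -
    have "x * y = w * (u' * w') * u" by (simp only: x_def y_def mult.assoc)
    then show ?thesis by (simp only: u u')
  qed
  have yx: "y * x = j"
  proof -
    have "y * x = w' * (u * w) * u'" by (simp only: x_def y_def mult.assoc)
    then show ?thesis by (simp only: u u')
  qed
  have mem: "a \<in> (\<lambda>a. a * l) ` ?A \<longleftrightarrow> a * l = a" if "l * E = l" "l * l = l" for a l
  proof
    show "a \<in> (\<lambda>a. a * l) ` ?A \<Longrightarrow> a * l = a" using that(2) by (auto simp: mult.assoc)
    assume a: "a * l = a"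
    then have "a * E = a" by (metis that(1) mult.assoc)
    then show "a \<in> (\<lambda>a. a * l) ` ?A" using a block_algebra_iff by (intro image_eqI[of _ _ a]) auto
  qed
  have ax: "a * x * j = a * x" and ay: "a * y * i = a * y" for a
    by (simp_all add: mult.assoc xj yi)
  have axy: "a * x * y = a" if "a * i = a" for a using that by (simp add: mult.assoc xy)
  have ayx: "a * y * x = a" if "a * j = a" for a using that by (simp add: mult.assoc yx)
  have "bij_betw (\<lambda>a. a * x) ((\<lambda>a. a * i) ` ?A) ((\<lambda>a. a * j) ` ?A)"
    by (rule bij_betw_byWitness[where f'="\<lambda>a. a * y"])
      (auto simp: mem[OF iE ii] mem[OF jE jj] axy ayx ax ay simp del: image_iff)
  then show ?thesis
    unfolding isomorphic_projectives_def
    by (intro exI[of _ "\<lambda>a. a * x"]) (simp add: distrib_right mult.assoc)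
qed

text \<open>There is only one indecomposable projective up to isomorphism, so a set of
  representatives has exactly one element.\<close>

lemma basic_idempotent_primitive:
  assumes "is_basic_idempotent (block_algebra E) E f"
  shows "primitive_idempotent (block_algebra E) f"
proof -
  obtain I J' where I: "finite I" "J' \<subseteq> I" "\<forall>i\<in>I. primitive_idempotent (block_algebra E) i"
    "\<Sum>I = E" "\<forall>i\<in>J'. \<forall>j\<in>J'. isomorphic_projectives (block_algebra E) i j \<longrightarrow> i = j"
    "\<forall>i\<in>I. \<exists>j\<in>J'. isomorphic_projectives (block_algebra E) i j" "f = \<Sum>J'"
    using assms unfolding is_basic_idempotent_def by blast
  have "I \<noteq> {}" using I(4) E_nonzero by auto
  then obtain j where j: "j \<in> J'" using I(6) by blast
  have "J' = {j}" using I(2,3,5) j primitive_isomorphic by blast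
  then show ?thesis using I j by auto
qed

subsection \<open>The presentation of the basic algebra\<close>

lemma S_X: "S * X = - (X * S)" and T_X: "T * X = X * T"
  and S_Y: "S * Y = Y * S" and T_Y: "T * Y = - (Y * T)"
  by (simp_all add: X_def Y_def algebra_simps act_rules act_rules_assoc comm)

lemma S_XYZ_assoc: "S * (X * a) = - (X * (S * a))" "T * (X * a) = X * (T * a)"
    "S * (Y * a) = Y * (S * a)" "T * (Y * a) = - (Y * (T * a))"
  by (simp_all add: S_X T_X S_Y T_Y flip: mult.assoc)

lemma S_Z: "S * Z = - (Z * S)" and T_Z: "T * Z = - (Z * T)"
  by (simp_all add: Z_def algebra_simps S_X T_X S_Y T_Y S_XYZ_assoc)

lemma S_Z_assoc: "S * (Z * a) = - (Z * (S * a))" "T * (Z * a) = - (Z * (T * a))"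
  by (simp_all add: S_Z T_Z flip: mult.assoc)

lemma E_right: "E * X = X * E" "E * (X * a) = X * (E * a)" "E * Y = Y * E" "E * (Y * a) = Y * (E * a)"
    "E * Z = Z * E" "E * (Z * a) = Z * (E * a)"
  using E_commute[of X] E_commute[of Y] E_commute[of Z] by (simp_all flip: mult.assoc)

lemmas XYZ_normal = S_X T_X S_Y T_Y S_XYZ_assoc S_Z T_Z S_Z_assoc E_right E_normal

lemma XZ_mult: "X * (Z * a) = Z * (X * a) + Z * (Y * (Z * a))"
  and YZ_mult: "Y * (Z * a) = Z * (Y * a) - Z * (X * (Z * a))"
  and XY_mult: "X * (Y * a) = Y * (X * a) + Z * a"
proof -
  have "X * Z = Z * X + Z * Y * Z" "Y * Z = Z * Y - Z * X * Z" "X * Y = Y * X + Z"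
    using XZ YZ by (simp_all add: Z_def algebra_simps)
  then have "X * Z * a = (Z * X + Z * Y * Z) * a" "Y * Z * a = (Z * Y - Z * X * Z) * a"
    "X * Y * a = (Y * X + Z) * a" by simp_all
  then show "X * (Z * a) = Z * (X * a) + Z * (Y * (Z * a))"
    "Y * (Z * a) = Z * (Y * a) - Z * (X * (Z * a))" "X * (Y * a) = Y * (X * a) + Z * a"
    by (simp_all add: distrib_right left_diff_distrib mult.assoc)
qed

text \<open>On the block, \<open>X\<close> and \<open>T\<close> pick up the same signs when moved
  past \<open>S\<close> and \<open>T\<close>; so do \<open>Y\<close> and \<open>S\<close>, and
  \<open>Z\<close> and \<open>S * T\<close>. In each product the two signs cancel, which gives
  elements commuting with the quaternion units.\<close>

definition xx :: "'g \<Rightarrow>\<^sub>0 'k" where "xx = X * T"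
definition yy :: "'g \<Rightarrow>\<^sub>0 'k" where "yy = Y * S"
definition zz :: "'g \<Rightarrow>\<^sub>0 'k" where "zz = Z * (S * T)"

lemma twisted_cubes: "xx ^ 3 * E = 0" "yy ^ 3 * E = 0"
proof -
  have "xx ^ 3 * E = X * (X * (X * (T * (T * (T * E)))))"
    by (simp only: xx_def power3_eq_cube mult.assoc T_X S_XYZ_assoc)
  also have "\<dots> = X ^ 3 * (T * (T * (T * E)))" by (simp only: power3_eq_cube mult.assoc)
  finally show "xx ^ 3 * E = 0" by (simp add: X_cubed)
  have "yy ^ 3 * E = Y * (Y * (Y * (S * (S * (S * E)))))"
    by (simp only: yy_def power3_eq_cube mult.assoc S_Y S_XYZ_assoc)
  also have "\<dots> = Y ^ 3 * (S * (S * (S * E)))" by (simp only: power3_eq_cube mult.assoc)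
  finally show "yy ^ 3 * E = 0" by (simp add: Y_cubed)
qed

lemma twisted_relations_E: "(xx * yy + yy * xx - zz) * E = 0"
  "(xx * zz + zz * xx + zz * yy * zz) * E = 0" "(yy * zz + zz * yy + zz * xx * zz) * E = 0"
proof -
  have "(xx * yy + yy * xx - zz) * E = X * (Y * (E * (S * T))) - Y * (X * (E * (S * T))) - Z * (E * (S * T))"
    by (simp add: xx_def yy_def zz_def distrib_right left_diff_distrib XYZ_normal)
  then show "(xx * yy + yy * xx - zz) * E = 0" by (simp add: XY_mult)
  have "(xx * zz + zz * xx + zz * yy * zz) * E =
      - (X * (Z * (E * S)) - (Z * (X * (E * S)) + Z * (Y * (Z * (E * S)))))"
    by (simp add: xx_def yy_def zz_def distrib_right left_diff_distrib XYZ_normal)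
  then show "(xx * zz + zz * xx + zz * yy * zz) * E = 0" by (simp only: XZ_mult[of "E * S"]) simp
  have "(yy * zz + zz * yy + zz * xx * zz) * E =
      Y * (Z * (E * T)) - (Z * (Y * (E * T)) - Z * (X * (Z * (E * T))))"
    by (simp add: xx_def yy_def zz_def distrib_right left_diff_distrib XYZ_normal)
  then show "(yy * zz + zz * yy + zz * xx * zz) * E = 0" by (simp only: YZ_mult[of "E * T"]) simp
qed

lemma xyz_commute: "a \<in> {xx, yy, zz} \<Longrightarrow> b \<in> {qi, qj} \<Longrightarrow> a * b = b * a"
  by (auto simp: xx_def yy_def zz_def qi_def qj_def XYZ_normal)

section \<open>Linear independence of the twisted monomials\<close>

text \<open>The exact sign and the exact element of \<open>H\<close> are irrelevant for linear independence.\<close>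
definition coset_multiple :: "('g \<Rightarrow>\<^sub>0 'k) \<Rightarrow> ('g \<Rightarrow>\<^sub>0 'k) \<Rightarrow> bool" where
  "coset_multiple a b \<longleftrightarrow> (\<exists>q\<in>H. \<exists>l. l \<noteq> 0 \<and> a = scal l * (b * el q))"

lemma el_commute_up_to_scalar:
  assumes "q \<in> H" and V: "\<exists>l. l \<noteq> 0 \<and> S * V = scal l * (V * S)" "\<exists>l. l \<noteq> 0 \<and> T * V = scal l * (V * T)"
  shows "\<exists>l. l \<noteq> 0 \<and> el q * V = scal l * (V * el q)"
proof -
  let ?U = "{q. \<exists>l. l \<noteq> 0 \<and> el q * V = scal l * (V * el q)}"
  have "is_subgroup ?U"
    unfolding is_subgroup_def
  proof (intro conjI ballI)
    show "0 \<in> ?U" by (auto simp: el_0 intro!: exI[of _ 1])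
  next
    fix a b assume "a \<in> ?U" "b \<in> ?U"
    then obtain l l' where l: "l \<noteq> 0" "el a * V = scal l * (V * el a)" "l' \<noteq> 0" "el b * V = scal l' * (V * el b)"
      by blast
    have "el (a + b) * V = el a * (el b * V)" by (simp only: el_add mult.assoc)
    also have "\<dots> = scal l' * (el a * V * el b)" by (simp only: l(4) scal_left_commute[of "el a"] mult.assoc)
    also have "\<dots> = scal l' * (scal l * (V * el a) * el b)" by (simp only: l(2))
    also have "\<dots> = scal (l' * l) * (V * el (a + b))" by (simp only: el_add scal_mult mult.assoc)
    finally show "a + b \<in> ?U" using l(1,3) by (intro CollectI exI[of _ "l' * l"]) simp
  next
    fix a assume "a \<in> ?U"
    then obtain l where l: "l \<noteq> 0" "el a * V = scal l * (V * el a)" by blast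
    have inv: "el (- a) * el a = 1" "el a * el (- a) = 1" by (simp_all add: el_0 flip: el_add)
    have "V * el (- a) = el (- a) * (el a * V) * el (- a)" by (simp add: inv flip: mult.assoc)
    also have "\<dots> = scal l * (el (- a) * V * (el a * el (- a)))"
      by (simp only: l scal_left_commute[of "el (- a)"] mult.assoc)
    finally have "scal (inverse l) * (V * el (- a)) = scal (inverse l) * (scal l * (el (- a) * V))"
      by (simp add: inv)
    also have "\<dots> = scal (inverse l * l) * (el (- a) * V)" by (simp only: scal_mult mult.assoc)
    finally have "el (- a) * V = scal (inverse l) * (V * el (- a))" using l(1) by simp
    then show "- a \<in> ?U" using l(1) by (intro CollectI exI[of _ "inverse l"]) simp
  qed
  from H_induct[OF this _ _ assms(1)] V show ?thesis by blast
qed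

text \<open>In a power of V q the factors from \<open>H\<close> can be collected on the right, since
  they commute with \<open>V\<close> up to nonzero scalars.\<close>

lemma coset_multiple_power:
  assumes ab: "coset_multiple a b" and r: "r \<in> H"
    and V: "\<exists>l. l \<noteq> 0 \<and> S * V = scal l * (V * S)" "\<exists>l. l \<noteq> 0 \<and> T * V = scal l * (V * T)"
  shows "coset_multiple (a * (V * el r) ^ n) (b * V ^ n)"
proof (induction n)
  case 0
  then show ?case using ab by simp
next
  case (Suc n)
  then obtain q l where q: "q \<in> H" "l \<noteq> 0" "a * (V * el r) ^ n = scal l * (b * V ^ n * el q)"
    unfolding coset_multiple_def by blast
  obtain l' where l': "l' \<noteq> 0" "el q * V = scal l' * (V * el q)"
    using el_commute_up_to_scalar[OF q(1) V] by blast
  have "a * (V * el r) ^ Suc n = a * (V * el r) ^ n * (V * el r)"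
    by (simp only: power_Suc2 mult.assoc)
  also have "\<dots> = scal l * (b * V ^ n * (el q * V) * el r)"
    unfolding q(3) by (simp only: mult.assoc)
  also have "\<dots> = scal l * (b * V ^ n * (scal l' * (V * el q)) * el r)"
    by (simp only: l'(2))
  also have "\<dots> = scal l * (scal l' * (b * V ^ n * (V * el q * el r)))"
    by (simp only: scal_left_commute[of b] scal_left_commute[of "V ^ n"] mult.assoc)
  also have "\<dots> = scal (l * l') * (b * V ^ Suc n * el (q + r))"
    by (simp only: scal_mult el_add power_Suc2 mult.assoc)
  finally show ?case
    unfolding coset_multiple_def using q l'(1) H_add[OF q(1) r] by (metis mult_eq_0_iff)
qed

lemma monomial_coset_multiple: "coset_multiple (monomial xx yy zz m) (monomial X Y Z m)"
proof (cases m)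
  case (fields l i j)
  have sign: "\<exists>l. l \<noteq> 0 \<and> a = scal l * b" if "a = b \<or> a = - b" for a b :: "'g \<Rightarrow>\<^sub>0 'k"
    using that
  proof
    assume "a = - b"
    then show ?thesis by (intro exI[of _ "- 1"]) (simp add: single_uminus)
  qed (intro exI[of _ 1], simp)
  have X: "\<exists>l. l \<noteq> 0 \<and> S * X = scal l * (X * S)" "\<exists>l. l \<noteq> 0 \<and> T * X = scal l * (X * T)"
    and Y: "\<exists>l. l \<noteq> 0 \<and> S * Y = scal l * (Y * S)" "\<exists>l. l \<noteq> 0 \<and> T * Y = scal l * (Y * T)"
    and Z: "\<exists>l. l \<noteq> 0 \<and> S * Z = scal l * (Z * S)" "\<exists>l. l \<noteq> 0 \<and> T * Z = scal l * (Z * T)"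
    by (rule sign; simp add: S_X T_X S_Y T_Y S_Z T_Z)+
  have "coset_multiple 1 1"
    unfolding coset_multiple_def using H_0 by (intro bexI[of _ 0] exI[of _ 1]) (simp_all add: el_0)
  then have "coset_multiple (1 * (Z * el (s + t)) ^ l) (1 * Z ^ l)"
    by (rule coset_multiple_power) (use gens H_add Z in auto)
  then have "coset_multiple (1 * (Z * el (s + t)) ^ l * (X * T) ^ i) (1 * Z ^ l * X ^ i)"
    by (rule coset_multiple_power) (use gens X in auto)
  then have "coset_multiple (1 * (Z * el (s + t)) ^ l * (X * T) ^ i * (Y * S) ^ j) (1 * Z ^ l * X ^ i * Y ^ j)"
    by (rule coset_multiple_power) (use gens Y in auto)
  then show ?thesis by (simp add: fields monomial_def xx_def yy_def zz_def el_add)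
qed

text \<open>k G is a free left module over k P with basis \<open>H\<close>; this is the coordinate
  at \<open>q\<close>.\<close>

definition restrict :: "'g \<Rightarrow> ('g \<Rightarrow>\<^sub>0 'k) \<Rightarrow> ('g \<Rightarrow>\<^sub>0 'k)" where
  "restrict q a = (\<Sum>p\<in>P. Poly_Mapping.single p (Poly_Mapping.lookup a (p + q)))"

lemma lookup_restrict: "Poly_Mapping.lookup (restrict q a) p = (if p \<in> P then Poly_Mapping.lookup a (p + q) else 0)"
proof -
  have "Poly_Mapping.lookup (restrict q a) p = (\<Sum>p'\<in>P. if p' = p then Poly_Mapping.lookup a (p + q) else 0)"
    unfolding restrict_def lookup_sum by (rule sum.cong) (auto simp: lookup_single when_def)
  then show ?thesis using finite_P by simp
qed

lemma restrict_diff: "restrict q (a - b) = restrict q a - restrict q b"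
  and restrict_scal: "restrict q (scal l * a) = scal l * restrict q a"
  by (rule poly_mapping_eqI; simp add: lookup_restrict lookup_minus)+

lemma restrict_sum: "restrict q (sum f A) = (\<Sum>m\<in>A. restrict q (f m))"
  by (rule poly_mapping_eqI) (simp add: lookup_restrict lookup_sum)

lemma restrict_el:
  assumes d: "d \<in> subgroup_algebra P" and "q \<in> H" "r \<in> H"
  shows "restrict q (d * el r) = (if q = r then d else 0)"
proof (rule poly_mapping_eqI)
  fix p
  have lookup: "Poly_Mapping.lookup (d * el r) (p + q) = Poly_Mapping.lookup d (p + q - r)"
    using lookup_el_mult_right[of d r "p + q - r"] by simp
  have outside: "Poly_Mapping.lookup d p = 0" if "p \<notin> P" for p
    using d that by (auto simp: subgroup_algebra_def in_keys_iff)
  have "p + q - r \<notin> P" if "p \<in> P" "q \<noteq> r"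
  proof
    assume "p + q - r \<in> P"
    moreover have "p + q = (p + q - r) + r" by simp
    ultimately have "q = r" using decompose_unique[OF that(1) assms(2) _ assms(3)] by blast
    with that(2) show False ..
  qed
  then show "Poly_Mapping.lookup (restrict q (d * el r)) p = Poly_Mapping.lookup (if q = r then d else 0) p"
    using outside by (auto simp: lookup_restrict lookup)
qed

text \<open>A twisted monomial times \<open>E\<close> is a nonzero multiple of M q s^2 - M q with M
  an ordinary monomial, so it lives on two cosets of \<open>P\<close>. Taking the coordinate at the
  coset element of the given \<open>m\<close> reduces the claim to independence of the M in k
  P.\<close>

lemma twisted_monomials_independent:
  assumes sum: "(\<Sum>m\<in>exponents. scal (f m) * monomial xx yy zz m) * E = 0" and m: "m \<in> exponents"
  shows "f m = 0"
proof -
  obtain q l where q: "\<And>m. q m \<in> H" "\<And>m. l m \<noteq> 0"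
    "\<And>m. monomial xx yy zz m = scal (l m) * (monomial X Y Z m * el (q m))"
    using monomial_coset_multiple unfolding coset_multiple_def by metis
  let ?r = "q m"
  have "(\<Sum>n\<in>exponents. scal (f n * l n) * (monomial X Y Z n * el (q n + (s + s)) - monomial X Y Z n * el (q n))) = 0"
  proof -
    have "(scal (f n) * monomial xx yy zz n) * E =
        scal (f n * l n) * (monomial X Y Z n * el (q n + (s + s)) - monomial X Y Z n * el (q n))" for n
      unfolding q(3) by (simp only: E_def scal_mult el_add mult.assoc right_diff_distrib mult_1_right)
    with sum show ?thesis by (simp add: sum_distrib_right)
  qed
  then have "restrict ?r (\<Sum>n\<in>exponents. scal (f n * l n) *
      (monomial X Y Z n * el (q n + (s + s)) - monomial X Y Z n * el (q n))) = restrict ?r 0" by simp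
  moreover have "restrict ?r 0 = 0" by (simp add: restrict_def)
  moreover have "restrict ?r (scal (f n * l n) * (monomial X Y Z n * el (q n + (s + s)) - monomial X Y Z n * el (q n)))
      = scal (f n * l n * ((if ?r = q n + (s + s) then 1 else 0) - (if ?r = q n then 1 else 0))) * monomial X Y Z n" for n
    using restrict_el[OF monomial_subgroup_algebra q(1) q(1)]
      restrict_el[OF monomial_subgroup_algebra q(1) H_add[OF q(1) s2(2)]]
    by (simp add: restrict_scal restrict_diff single_uminus)
  ultimately have "(\<Sum>n\<in>exponents. scal (f n * l n * ((if ?r = q n + (s + s) then 1 else 0) - (if ?r = q n then 1 else 0)))
      * monomial X Y Z n) = 0"
    by (simp only: restrict_sum)
  from monomials_independent[OF this m]
  have "f m * l m * ((if q m = q m + (s + s) then 1 else 0) - 1) = 0" by simp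
  \<comment> \<open>The two cosets differ because s^2 is not 1, so the bracket is -1 and does not
    cancel.\<close>
  moreover have "q m \<noteq> q m + (s + s)" by (metis add_0_right add_left_cancel s2(1))
  ultimately show "f m = 0" using q(2)[of m] by simp
qed

section \<open>The corner of F and its transport to primitive idempotents\<close>

context
  fixes \<Phi> :: "(gen3 list \<Rightarrow>\<^sub>0 'k) \<Rightarrow> ('g \<Rightarrow>\<^sub>0 'k)"
  assumes hom: "is_alg_hom \<Phi>" and one: "\<Phi> 1 = 1" and gen_x: "\<Phi> (free_gen Gen_x) = xx"
    and gen_y: "\<Phi> (free_gen Gen_y) = yy" and gen_z: "\<Phi> (free_gen Gen_z) = zz"
begin

lemma twisted_hom_commute: "\<Phi> a * E = E * \<Phi> a" "\<Phi> a * qi = qi * \<Phi> a" "\<Phi> a * qj = qj * \<Phi> a" "\<Phi> a * qk = qk * \<Phi> a"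
    "\<Phi> a * F = F * \<Phi> a"
proof -
  show E: "\<Phi> a * E = E * \<Phi> a" by (rule E_commute)
  have comm: "\<Phi> a * b = b * \<Phi> a" if b: "b \<in> {qi, qj}" for b
  proof (induction a rule: free_algebra_induct)
    case (const l)
    have "\<Phi> (scal l) = scal l" using alg_hom_scal[OF hom, of l 1] one by simp
    then show ?case by (simp add: scal_commute)
  next
    case (gen g a)
    have "\<Phi> (free_gen g) * b = b * \<Phi> (free_gen g)"
      using b by (intro xyz_commute) (cases g; simp add: gen_x gen_y gen_z)+
    then show ?case using gen by (metis alg_hom_mult[OF hom] mult.assoc)
  qed (simp add: alg_hom_add[OF hom] algebra_simps)
  then show qi: "\<Phi> a * qi = qi * \<Phi> a" and qj: "\<Phi> a * qj = qj * \<Phi> a" by auto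
  have "qk = qi * qj" by (simp add: quaternion_table)
  then show "\<Phi> a * qk = qk * \<Phi> a" by (metis qi qj mult.assoc)
  show "\<Phi> a * F = F * \<Phi> a"
    using qi qj E by (simp add: F_def algebra_simps)
qed

text \<open>\<open>\<Phi> a\<close> commutes with the quaternion units, so along with
  \<open>F\<close> it annihilates all u F u and hence \<open>trace F\<close>, which is
  \<open>- E\<close>. Thus independence over \<open>E\<close> carries over to
  \<open>F\<close>.\<close>

lemma twisted_hom_F_injective:
  assumes "\<Phi> a * F = 0"
  shows "\<Phi> a * E = 0"
proof -
  have 0: "\<Phi> a * (u * F * v) = 0" if "\<Phi> a * u = u * \<Phi> a" for u v
  proof -
    have "\<Phi> a * (u * F * v) = u * (\<Phi> a * F) * v" using that by (simp flip: mult.assoc)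
    then show ?thesis by (simp add: assms)
  qed
  have "- (\<Phi> a * E) = \<Phi> a * trace F" by (simp add: trace_F)
  also have "\<dots> = 0"
    unfolding trace_def by (simp add: right_diff_distrib 0 twisted_hom_commute)
  finally show ?thesis by simp
qed

lemma twisted_hom_relations:
  "relation_ideal (relations_block (free_gen Gen_x) (free_gen Gen_y) (free_gen Gen_z)) \<subseteq> {a. \<Phi> a * F = 0}"
proof (rule relation_ideal_subset)
  have F: "a * F = 0" if "a * E = 0" for a
    using that F_E(4)[of 1] by (metis F_E(2) mult.assoc mult_zero_left)
  show "two_sided_ideal {a. \<Phi> a * F = 0}"
  proof -
    have "\<Phi> a * \<Phi> r * F = 0" if "\<Phi> a * F = 0" for a r
      using that twisted_hom_commute(5)[of r] by (metis mult.assoc mult_zero_left)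
    then show ?thesis
      unfolding two_sided_ideal_def
      by (simp add: alg_hom_0[OF hom] alg_hom_add[OF hom] alg_hom_mult[OF hom] distrib_right mult.assoc)
  qed
  fix l r :: "gen3 list \<Rightarrow>\<^sub>0 'k"
  assume "(l, r) \<in> relations_block (free_gen Gen_x) (free_gen Gen_y) (free_gen Gen_z)"
  then have "\<Phi> (l - r) \<in> {xx ^ 3, yy ^ 3, xx * yy + yy * xx - zz, xx * zz + zz * xx + zz * yy * zz,
      yy * zz + zz * yy + zz * xx * zz}"
    by (auto simp: relations_block_def alg_hom_add[OF hom] alg_hom_diff[OF hom] alg_hom_minus[OF hom]
        alg_hom_mult[OF hom] alg_hom_0[OF hom] gen_x gen_y gen_z power3_eq_cube)
  then have "\<Phi> (l - r) * E = 0"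
    using twisted_cubes twisted_relations_E by auto
  then show "l - r \<in> {a. \<Phi> a * F = 0}" by (simp add: F)
qed

lemma twisted_hom_kernel:
  "{a. \<Phi> a * F = 0} = relation_ideal (relations_block (free_gen Gen_x) (free_gen Gen_y) (free_gen Gen_z))"
proof -
  interpret B: free_twisted_relations "relation_ideal
      (relations_block (free_gen Gen_x) (free_gen Gen_y) (free_gen Gen_z :: gen3 list \<Rightarrow>\<^sub>0 'k))" "- 1"
    using char3 by (rule free_twisted_relations_block)
  have mult: "\<Phi> a * \<Phi> b * F = \<Phi> a * F * (\<Phi> b * F)" for a b
    by (metis twisted_hom_commute(5) F_q_F(1) mult.assoc)
  have homF: "is_alg_hom (\<lambda>a. \<Phi> a * F)"
    unfolding is_alg_hom_def
  proof (intro conjI allI)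
    show "\<Phi> (a + b) * F = \<Phi> a * F + \<Phi> b * F" for a b
      by (simp add: alg_hom_add[OF hom] distrib_right)
    show "\<Phi> (a * b) * F = \<Phi> a * F * (\<Phi> b * F)" for a b
      by (simp only: alg_hom_mult[OF hom] mult)
    show "\<Phi> (scal l * a) * F = scal l * (\<Phi> a * F)" for l a
      by (simp only: alg_hom_scal[OF hom] mult.assoc)
  qed
  show ?thesis
  proof (rule B.kernel_eq_ideal[OF homF twisted_hom_relations])
    fix f m
    let ?m = "\<lambda>m. monomial (free_gen Gen_x) (free_gen Gen_y) (free_gen Gen_z) m :: gen3 list \<Rightarrow>\<^sub>0 'k"
    assume sum: "(\<Sum>m\<in>exponents. scal (f m) * (\<Phi> (?m m) * F)) = 0" and m: "m \<in> exponents"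
    have Phi: "\<Phi> (\<Sum>m\<in>exponents. scal (f m) * ?m m) = (\<Sum>m\<in>exponents. scal (f m) * \<Phi> (?m m))"
      by (simp add: alg_hom_sum[OF hom] alg_hom_scal[OF hom])
    have "\<Phi> (\<Sum>m\<in>exponents. scal (f m) * ?m m) * F = 0"
      unfolding Phi using sum by (simp add: sum_distrib_right mult.assoc)
    then have "\<Phi> (\<Sum>m\<in>exponents. scal (f m) * ?m m) * E = 0"
      by (rule twisted_hom_F_injective)
    then have "(\<Sum>m\<in>exponents. scal (f m) * monomial xx yy zz m) * E = 0"
      unfolding Phi by (simp add: alg_hom_monomial[OF hom one] gen_x gen_y gen_z)
    then show "f m = 0" using m by (rule twisted_monomials_independent)
  qed
qed

text \<open>Shown below to be stable under left multiplication by k G; as it contains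
  \<open>E\<close>, it then contains the whole block.\<close>

definition module_M :: "('g \<Rightarrow>\<^sub>0 'k) set" where
  "module_M = {\<Phi> a0 * E + \<Phi> a1 * qi + \<Phi> a2 * qj + \<Phi> a3 * qk | a0 a1 a2 a3. True}"

lemma module_MI: "\<Phi> a0 * E + \<Phi> a1 * qi + \<Phi> a2 * qj + \<Phi> a3 * qk \<in> module_M"
  unfolding module_M_def by blast

lemma module_M_add: "m \<in> module_M \<Longrightarrow> n \<in> module_M \<Longrightarrow> m + n \<in> module_M"
proof -
  assume "m \<in> module_M" "n \<in> module_M"
  then obtain a0 a1 a2 a3 a0' a1' a2' a3' where
    "m = \<Phi> a0 * E + \<Phi> a1 * qi + \<Phi> a2 * qj + \<Phi> a3 * qk" "n = \<Phi> a0' * E + \<Phi> a1' * qi + \<Phi> a2' * qj + \<Phi> a3' * qk"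
    unfolding module_M_def by blast
  then have "m + n = \<Phi> (a0 + a0') * E + \<Phi> (a1 + a1') * qi + \<Phi> (a2 + a2') * qj + \<Phi> (a3 + a3') * qk"
    by (simp add: alg_hom_add[OF hom] algebra_simps)
  then show ?thesis using module_MI by metis
qed

lemma module_M_mult: "m \<in> module_M \<Longrightarrow> \<Phi> r * m \<in> module_M"
proof -
  assume "m \<in> module_M"
  then obtain a0 a1 a2 a3 where "m = \<Phi> a0 * E + \<Phi> a1 * qi + \<Phi> a2 * qj + \<Phi> a3 * qk"
    unfolding module_M_def by blast
  then have "\<Phi> r * m = \<Phi> (r * a0) * E + \<Phi> (r * a1) * qi + \<Phi> (r * a2) * qj + \<Phi> (r * a3) * qk"
    by (simp add: alg_hom_mult[OF hom] distrib_left mult.assoc)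
  then show ?thesis using module_MI by metis
qed

lemma module_M_E: "m \<in> module_M \<Longrightarrow> E * m = m"
proof -
  have comm: "E * (\<Phi> r * u) = \<Phi> r * (E * u)" for r u
    using twisted_hom_commute(1)[of r] by (simp flip: mult.assoc)
  show "m \<in> module_M \<Longrightarrow> E * m = m"
    unfolding module_M_def by (auto simp: distrib_left quaternion_table E_idempotent comm)
qed

lemma module_M_q:
  assumes "m \<in> module_M"
  shows "qi * m \<in> module_M" "qj * m \<in> module_M"
proof -
  obtain a0 a1 a2 a3 where m: "m = \<Phi> a0 * E + \<Phi> a1 * qi + \<Phi> a2 * qj + \<Phi> a3 * qk"
    using assms unfolding module_M_def by blast
  have comm: "qi * (\<Phi> r * u) = \<Phi> r * (qi * u)" "qj * (\<Phi> r * u) = \<Phi> r * (qj * u)" for r u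
    using twisted_hom_commute(2,3)[of r] by (simp_all flip: mult.assoc)
  have "qi * m = \<Phi> (- a1) * E + \<Phi> a0 * qi + \<Phi> (- a3) * qj + \<Phi> a2 * qk"
    "qj * m = \<Phi> (- a2) * E + \<Phi> a3 * qi + \<Phi> a0 * qj + \<Phi> (- a1) * qk"
    by (simp_all add: m distrib_left comm quaternion_table alg_hom_minus[OF hom])
  then show "qi * m \<in> module_M" "qj * m \<in> module_M" using module_MI by metis+
qed

text \<open>The block algebra is the tensor product of the image of \<open>\<Phi>\<close> and the quaternion algebra.\<close>
lemma module_M_all: "\<forall>m\<in>module_M. a * m \<in> module_M"
proof (induction a rule: group_algebra_induct)
  case (const l)
  have "\<Phi> (scal l) = scal l" using alg_hom_scal[OF hom, of l 1] one by simp
  then show ?case using module_M_mult by metis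
next
  case (add a b)
  then show ?case by (simp add: distrib_right module_M_add)
next
  case (mult a b)
  then show ?case by (simp add: mult.assoc)
next
  case s
  have "S * m = qi * m" if "m \<in> module_M" for m
    using module_M_E[OF that] by (metis qi_def E_left(1) mult.assoc)
  then show ?case using module_M_q by simp
next
  case t
  have "T * m = qj * m" if "m \<in> module_M" for m
    using module_M_E[OF that] by (metis qj_def E_left(2) mult.assoc)
  then show ?case using module_M_q by simp
next
  case g
  have X: "X * m \<in> module_M" if m: "m \<in> module_M" for m
  proof -
    \<comment> \<open>\<open>xx * qj\<close> is X T^2 E, and T^2 = s^2 acts as -1 on the block; this
      recovers \<open>X\<close> from its twisted form.\<close>
    have "X * E = \<Phi> (- free_gen Gen_x) * qj"
      by (simp add: alg_hom_minus[OF hom] gen_x xx_def qj_def XYZ_normal)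
    then have "X * m = \<Phi> (- free_gen Gen_x) * (qj * m)" using module_M_E[OF m] by (metis mult.assoc)
    then show ?thesis using module_M_mult module_M_q[OF m] by simp
  qed
  show ?case
  proof
    fix m assume m: "m \<in> module_M"
    have "G * m = m + \<Phi> (- 1) * (X * m) + \<Phi> (- 1) * (X * (X * m))"
      by (subst G_eq) (simp add: algebra_simps alg_hom_minus[OF hom] one)
    then show "G * m \<in> module_M" using m X module_M_mult module_M_add by simp
  qed
next
  case h
  have Y: "Y * m \<in> module_M" if m: "m \<in> module_M" for m
  proof -
    have "Y * E = \<Phi> (- free_gen Gen_y) * qi"
      by (simp add: alg_hom_minus[OF hom] gen_y yy_def qi_def XYZ_normal)
    then have "Y * m = \<Phi> (- free_gen Gen_y) * (qi * m)" using module_M_E[OF m] by (metis mult.assoc)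
    then show ?thesis using module_M_mult module_M_q[OF m] by simp
  qed
  show ?case
  proof
    fix m assume m: "m \<in> module_M"
    have "Hh * m = m + \<Phi> (- 1) * (Y * m) + \<Phi> (- 1) * (Y * (Y * m))"
      by (subst H_eq) (simp add: algebra_simps alg_hom_minus[OF hom] one)
    then show "Hh * m \<in> module_M" using m Y module_M_mult module_M_add by simp
  qed
qed

lemma twisted_hom_range: "range (\<lambda>a. \<Phi> a * F) = corner F (block_algebra E)"
proof
  show "range (\<lambda>a. \<Phi> a * F) \<subseteq> corner F (block_algebra E)"
  proof
    fix b assume "b \<in> range (\<lambda>a. \<Phi> a * F)"
    then obtain a where a: "b = \<Phi> a * F" by blast
    have "F * (\<Phi> a * E) * F = \<Phi> a * F"
      by (metis twisted_hom_commute(5) F_E(2) F_q_F(1) mult.assoc)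
    moreover have "\<Phi> a * E \<in> block_algebra E" by (simp add: block_algebra_iff mult.assoc E_idempotent)
    ultimately show "b \<in> corner F (block_algebra E)" unfolding corner_def a by (metis image_eqI)
  qed
  show "corner F (block_algebra E) \<subseteq> range (\<lambda>a. \<Phi> a * F)"
  proof
    fix b assume "b \<in> corner F (block_algebra E)"
    then obtain m where m: "m * E = m" "b = F * m * F"
      unfolding corner_def by (auto simp: block_algebra_iff)
    have "E \<in> module_M" using module_MI[of 1 0 0 0] by (simp add: one alg_hom_0[OF hom])
    then have "m \<in> module_M" using module_M_all[of m] m(1) by metis
    then obtain a0 a1 a2 a3 where a: "m = \<Phi> a0 * E + \<Phi> a1 * qi + \<Phi> a2 * qj + \<Phi> a3 * qk"
      unfolding module_M_def by blast
    have comm: "F * (\<Phi> r * u) = \<Phi> r * (F * u)" for r u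
      using twisted_hom_commute(5)[of r] by (simp flip: mult.assoc)
    \<comment> \<open>The units E, i, j, k contribute the coefficients 1, 1, 1, 0 of
      \<open>F_q_F\<close> between two copies of \<open>F\<close>.\<close>
    have "b = \<Phi> (a0 + a1 + a2) * F"
      unfolding m(2) a by (simp add: distrib_left distrib_right mult.assoc comm F_q_F F_E alg_hom_add[OF hom])
    then show "b \<in> range (\<lambda>a. \<Phi> a * F)" by blast
  qed
qed

end

text \<open>The equivalence between \<open>F\<close> and \<open>f\<close> gives inverse isomorphisms
  a -> w a u and b -> u b w between the two corners, along which the presentation of the corner of
  \<open>F\<close> is carried over.\<close>

lemma corner_presentation:
  assumes f: "primitive_idempotent (block_algebra E) f"
  shows "has_presentation (corner f (block_algebra E)) f
    (relations_block (free_gen Gen_x) (free_gen Gen_y) (free_gen Gen_z))"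
proof -
  obtain \<Phi> :: "(gen3 list \<Rightarrow>\<^sub>0 'k) \<Rightarrow> ('g \<Rightarrow>\<^sub>0 'k)" where hom: "is_alg_hom \<Phi>" and one: "\<Phi> 1 = 1"
    and gen: "\<And>g. \<Phi> (free_gen g) = (case g of Gen_x \<Rightarrow> xx | Gen_y \<Rightarrow> yy | Gen_z \<Rightarrow> zz)"
    using alg_hom_exists[of 1 "\<lambda>g. case g of Gen_x \<Rightarrow> xx | Gen_y \<Rightarrow> yy | Gen_z \<Rightarrow> zz"] by auto
  have gens: "\<Phi> (free_gen Gen_x) = xx" "\<Phi> (free_gen Gen_y) = yy" "\<Phi> (free_gen Gen_z) = zz"
    by (simp_all add: gen)
  note Phi = hom one gens
  note commute = twisted_hom_commute[OF Phi]
  obtain u w where uw: "F * u = u" "u * f = u" "f * w = w" "w * F = w" "u * w = F" "w * u = f"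
    using f by (rule primitive_equivalent_F)
  define \<psi> where "\<psi> = (\<lambda>a. w * (\<Phi> a * F) * u)"
  have recover: "u * \<psi> a * w = \<Phi> a * F" for a
  proof -
    have "u * \<psi> a * w = (u * w) * (\<Phi> a * F) * (u * w)" by (simp only: \<psi>_def mult.assoc)
    also have "\<dots> = F * (\<Phi> a * F) * F" by (simp only: uw)
    also have "\<dots> = \<Phi> a * (F * F * F)" by (metis commute(5) mult.assoc)
    finally show ?thesis by (simp add: F_q_F)
  qed
  have "\<psi> (a + b) = \<psi> a + \<psi> b" "\<psi> (scal l * a) = scal l * \<psi> a" for a b l
    by (simp_all add: \<psi>_def alg_hom_add[OF hom] alg_hom_scal[OF hom] distrib_left distrib_right
        mult.assoc scal_left_commute[of w])
  moreover have "\<psi> (a * b) = \<psi> a * \<psi> b" for a b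
  proof -
    have "\<psi> a * \<psi> b = w * (\<Phi> a * F) * (u * w) * (\<Phi> b * F) * u" by (simp only: \<psi>_def mult.assoc)
    also have "\<dots> = w * (\<Phi> a * (F * F * (\<Phi> b * F))) * u" by (simp only: uw mult.assoc)
    also have "\<dots> = w * (\<Phi> a * (\<Phi> b * F)) * u" by (metis commute(5) F_q_F(1) mult.assoc)
    finally show ?thesis by (simp add: \<psi>_def alg_hom_mult[OF hom] mult.assoc)
  qed
  moreover have "\<psi> 1 = f" by (simp add: \<psi>_def one uw)
  moreover have "{a. \<psi> a = 0} = relation_ideal (relations_block (free_gen Gen_x) (free_gen Gen_y) (free_gen Gen_z))"
  proof -
    have "\<psi> a = 0 \<longleftrightarrow> \<Phi> a * F = 0" for a
      using recover[of a] by (auto simp: \<psi>_def)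
    then show ?thesis using twisted_hom_kernel[OF Phi] by simp
  qed
  moreover have "range \<psi> = corner f (block_algebra E)"
  proof
    have fE: "f * E = f" using f by (simp add: primitive_idempotent_def block_algebra_iff)
    show "range \<psi> \<subseteq> corner f (block_algebra E)"
    proof
      fix b assume "b \<in> range \<psi>"
      then obtain a where a: "b = \<psi> a" by blast
      have "f * b = b" "b * f = b"
        by (simp_all add: a \<psi>_def mult.assoc uw) (simp add: uw flip: mult.assoc)
      moreover from this have "b * E = b" by (metis fE mult.assoc)
      ultimately show "b \<in> corner f (block_algebra E)"
        unfolding corner_def by (intro image_eqI[of _ _ b]) (simp_all add: block_algebra_iff)
    qed
    show "corner f (block_algebra E) \<subseteq> range \<psi>"
    proof
      fix b assume "b \<in> corner f (block_algebra E)"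
      then obtain m where b: "b = f * m * f" unfolding corner_def by blast
      have uE: "u * E = u" by (metis uw(2) fE mult.assoc)
      have "u * b * w * E = u * b * w" by (metis uw(4) F_E(1) mult.assoc)
      then have "F * (u * b * w) * F \<in> corner F (block_algebra E)"
        unfolding corner_def by (simp add: block_algebra_iff)
      then obtain a where a: "F * (u * b * w) * F = \<Phi> a * F"
        unfolding twisted_hom_range[OF Phi, symmetric] by blast
      have "\<psi> a = w * (F * (u * b * w) * F) * u" by (simp only: \<psi>_def a)
      also have "\<dots> = (w * F) * u * b * (w * F) * u" by (simp only: mult.assoc)
      also have "\<dots> = f * b * f" by (simp add: uw mult.assoc)
      also have "\<dots> = b"
      proof -
        have "f * f = f" using f by (simp add: primitive_idempotent_def)
        then show ?thesis unfolding b by (metis mult.assoc)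
      qed
      finally show "b \<in> range \<psi>" by (metis rangeI)
    qed
  qed
  ultimately show ?thesis
    unfolding has_presentation_def by (intro exI[of _ \<psi>]) simp
qed

end

lemma z_cubed_relations:
  assumes "(3 :: 'k::field) = 0"
  shows "(free_gen Gen_z :: gen3 list \<Rightarrow>\<^sub>0 'k) ^ 3 \<in> relation_ideal
      (relations_P (free_gen Gen_x) (free_gen Gen_y) (free_gen Gen_z))"
    and "(free_gen Gen_z :: gen3 list \<Rightarrow>\<^sub>0 'k) ^ 3 \<in> relation_ideal
      (relations_block (free_gen Gen_x) (free_gen Gen_y) (free_gen Gen_z))"
proof -
  interpret P: free_twisted_relations "relation_ideal
      (relations_P (free_gen Gen_x) (free_gen Gen_y) (free_gen Gen_z :: gen3 list \<Rightarrow>\<^sub>0 'k))" 1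
    using assms by (rule free_twisted_relations_P)
  interpret B: free_twisted_relations "relation_ideal
      (relations_block (free_gen Gen_x) (free_gen Gen_y) (free_gen Gen_z :: gen3 list \<Rightarrow>\<^sub>0 'k))" "- 1"
    using assms by (rule free_twisted_relations_block)
  show "(free_gen Gen_z :: gen3 list \<Rightarrow>\<^sub>0 'k) ^ 3 \<in> relation_ideal
      (relations_P (free_gen Gen_x) (free_gen Gen_y) (free_gen Gen_z))" by (rule P.z_cubed)
  show "(free_gen Gen_z :: gen3 list \<Rightarrow>\<^sub>0 'k) ^ 3 \<in> relation_ideal
      (relations_block (free_gen Gen_x) (free_gen Gen_y) (free_gen Gen_z))" by (rule B.z_cubed)
qed

theorem theorem1p3:
  fixes P H :: "'g::group_add set" and g h c s t :: 'g
    and e :: "'g \<Rightarrow>\<^sub>0 'k::alg_closed_field"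
    and x y z :: "gen3 list \<Rightarrow>\<^sub>0 'k"
  assumes "CHAR('k) = 3"
    and "is_extraspecial_27 P g h c"
    and "is_quaternion_8 H s t"
    and "is_semidirect_product P H"
    and "- s + g + s = - g" and "- t + g + t = g"
    and "- s + h + s = h" and "- t + h + t = - h"
    and "is_block e" and "\<not> is_principal_block e"
    and "x = free_gen Gen_x" and "y = free_gen Gen_y" and "z = free_gen Gen_z"
  shows "has_presentation (subgroup_algebra P :: ('g \<Rightarrow>\<^sub>0 'k) set) 1 (relations_P x y z)
       \<and> z ^ 3 \<in> relation_ideal (relations_P x y z)
       \<and> (\<forall>f. is_basic_idempotent (block_algebra e) e f \<longrightarrow>
              has_presentation (corner f (block_algebra e)) f (relations_block x y z))
       \<and> z ^ 3 \<in> relation_ideal (relations_block x y z)"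
proof -
  have three: "(3 :: 'k) = 0"
    using of_nat_CHAR[where 'a='k] assms(1) by simp
  interpret quaternion_action P H g h c s t "TYPE('k)"
    using three assms(2-8) by unfold_locales
  have e: "e = E"
    using assms(9,10) by (rule nonprincipal_block_eq)
  show ?thesis
    unfolding assms(11-13) e
    using has_presentation_P z_cubed_relations[OF three] corner_presentation basic_idempotent_primitive
    by blast
qed

end
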